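(* Let $(H,\Delta,\epsilon,\Phi,S,\alpha,\beta)$ be a quasi-Hopf algebra with bijective antipode $S$. Let $F_\delta\in H\otimes H$ be its Drinfeld twist and let $$F_0=(S^{-1}\otimes S^{-1})F_\delta^T,\qquad F_\delta^T=T(F_\delta)$$ (called the second Drinfeld twist). Then the quasi-Hopf algebra structure on $H$ with the same co-unit $\epsilon$ and antipode $S$, with co-product $\Delta_0(a)=(S^{-1}\otimes S^{-1})\Delta^T(S(a))$ for $a\in H$, co-associator $\Phi_0=(S^{-1}\otimes S^{-1}\otimes S^{-1})\Phi_{321}$ and canonical elements $\alpha_0=S^{-1}(\beta)$, $\beta_0=S^{-1}(\alpha)$ is obtained from $H$ by twisting with $F_0$; that is, $F_0$ is a twist and $$\Delta_{F_0}=\Delta_0,\qquad \Phi_{F_0}=\Phi_0,\qquad \alpha_{F_0}=\alpha_0,\qquad \beta_{F_0}=\beta_0 .$$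
   Context: A quasi-bialgebra $(H,\Delta,\epsilon,\Phi)$ over a field $k$ is a unital associative $k$-algebra $H$ with algebra homomorphisms $\epsilon:H\to k$, $\Delta:H\to H\otimes H$ and an invertible $\Phi\in H\otimes H\otimes H$ such that (with $1$ also denoting the identity map) $(1\otimes\Delta)\Delta(a)=\Phi^{-1}(\Delta\otimes 1)\Delta(a)\Phi$ for all $a\in H$; $(\Delta\otimes 1\otimes 1)\Phi\cdot(1\otimes 1\otimes\Delta)\Phi=(\Phi\otimes 1)\cdot(1\otimes\Delta\otimes 1)\Phi\cdot(1\otimes\Phi)$; $(\epsilon\otimes 1)\Delta=1=(1\otimes\epsilon)\Delta$; $(1\otimes\epsilon\otimes 1)\Phi=1$. Write $\Phi=\sum_\nu X_\nu\otimes Y_\nu\otimes Z_\nu$, $\Phi^{-1}=\sum_\nu\bar X_\nu\otimes\bar Y_\nu\otimes\bar Z_\nu$, $\Delta(a)=\sum a_{(1)}\otimes a_{(2)}$. A quasi-Hopf algebra $(H,\Delta,\epsilon,\Phi,S,\alpha,\beta)$ is a quasi-bialgebra with an algebra anti-homomorphism $S:H\to H$ (the antipode) and canonical elements $\alpha,\beta\in H$ such that $\sum S(X_\nu)\alpha Y_\nu\beta S(Z_\nu)=1=\sum\bar X_\nu\beta S(\bar Y_\nu)\alpha\bar Z_\nu$ and $\sum S(a_{(1)})\alpha a_{(2)}=\epsilon(a)\alpha$, $\sum a_{(1)}\beta S(a_{(2)})=\epsilon(a)\beta$ for all $a\in H$. $T$ is the flip $T(a\otimes b)=b\otimes a$,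 $\Delta^T=T\circ\Delta$, $\Phi_{321}=\sum_\nu Z_\nu\otimes Y_\nu\otimes X_\nu$. A twist is an invertible $F\in H\otimes H$ with $(\epsilon\otimes 1)F=(1\otimes\epsilon)F=1$. With $F=\sum f_i\otimes f^i$, $F^{-1}=\sum\bar f_i\otimes\bar f^i$, the structure obtained by twisting with $F$ has the same $\epsilon$ and $S$, and $\Delta_F(a)=F\Delta(a)F^{-1}$, $\Phi_F=(F\otimes 1)\cdot(\Delta\otimes 1)F\cdot\Phi\cdot(1\otimes\Delta)F^{-1}\cdot(1\otimes F^{-1})$, $\alpha_F=\sum S(\bar f_i)\alpha\bar f^i$, $\beta_F=\sum f_i\beta S(f^i)$. The Drinfeld twist is $$F_\delta=\sum_\nu (S\otimes S)\Delta^T(X_\nu)\cdot\gamma\cdot\Delta(Y_\nu\beta S(Z_\nu)),\qquad \gamma=\sum_i S(B_i)\alpha C_i\otimes S(A_i)\alpha D_i,$$ where $\sum_i A_i\otimes B_i\otimes C_i\otimes D_i=(\Phi^{-1}\otimes 1)\cdot(\Delta\otimes 1\otimes 1)\Phi$. It is invertible, with inverse $$F_\delta^{-1}=\sum_\nu\Delta(S(X_\nu)\alpha Y_\nu)\cdot\bar\gamma\cdot(S\otimes S)\Delta^T(Z_\nu),\qquad \bar\gamma=\sum_i\bar A_i\beta S(\bar D_i)\otimes\bar B_i\beta S(\bar C_i),$$ where $\sum_i\bar A_i\otimes\bar B_i\otimes\bar C_i\otimes\bar D_i=(\Delta\otimes 1\otimes 1)\Phi^{-1}\cdot(\Phi\otimes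 1)$.
   Formalization: The formal theorem adds the normalisation ε(α)=1. Without it the claim fails: for H=k with α=c, β=1/c one gets F_0=c, which is not a twist if c≠1; in general F_0 is a twist only if ε(α)=1. *)

theory Defs
  imports Complex_Main "HOL-Library.Function_Algebras"
begin

section \<open>Algebras over a field\<close>

text \<open>
  The class \<open>ring_1\<close> demands \<open>0 \<noteq> 1\<close>.  This is no restriction below: an algebra with
  a counit is never the zero ring.
\<close>

locale k_algebra = vector_space scale
  for scale :: "'k::field \<Rightarrow> 'h::ring_1 \<Rightarrow> 'h" (infixr "*s" 75) +
  assumes scale_mult_left: "(c *s x) * y = c *s (x * y)"
    and scale_mult_right: "x * (c *s y) = c *s (x * y)"


section \<open>Tensor powers\<close>

text \<open>
  The pure tensor \<open>x\<^sub>1 \<otimes> \<dots> \<otimes> x\<^sub>n\<close> is represented by evaluation of \<open>n\<close>-linear forms at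
  \<open>(x\<^sub>1, \<dots>, x\<^sub>n)\<close>, and the \<open>n\<close>-th tensor power by the set of finite sums of such evaluations.
  Over a field this is a model of the tensor power: \<open>multilinear_tens\<close>, \<open>tsum_tens\<close>,
  \<open>tsum_add\<close>, \<open>tsum_scale\<close> and \<open>tsum_unique\<close> below are its universal property.
  Addition of tensors is pointwise; the product of tensors is \<open>tmult\<close>, not the
  pointwise product of functions.
\<close>

type_synonym ('k, 'h) tensor = "('h list \<Rightarrow> 'k) \<Rightarrow> 'k"

definition tscale :: "'k::field \<Rightarrow> ('k, 'h) tensor \<Rightarrow> ('k, 'h) tensor"
  where "tscale c u = (\<lambda>m. c * u m)"

definition multilinear ::
  "('k::field \<Rightarrow> 'v::ab_group_add \<Rightarrow> 'v) \<Rightarrow> ('k \<Rightarrow> 'w::ab_group_add \<Rightarrow> 'w) \<Rightarrow> nat \<Rightarrow> ('v list \<Rightarrow> 'w) \<Rightarrow> bool"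
  where "multilinear s1 s2 n f \<longleftrightarrow>
    (\<forall>xs i. length xs = n \<longrightarrow> i < n \<longrightarrow> Vector_Spaces.linear s1 s2 (\<lambda>a. f (xs[i := a])))"

context k_algebra
begin

definition tens :: "'h list \<Rightarrow> ('k, 'h) tensor"
  where "tens xs = (\<lambda>m. if multilinear scale (*) (length xs) m then m xs else 0)"

text \<open>
  Sums of pure tensors without coefficients are closed under scalars for \<open>n > 0\<close>, which are
  the only tensor powers that are used.
\<close>

definition tpow :: "nat \<Rightarrow> ('k, 'h) tensor set"
  where "tpow n = {\<Sum>xs\<leftarrow>ls. tens xs |ls. \<forall>xs\<in>set ls. length xs = n}"

text \<open>
  If \<open>u = \<Sum>\<^sub>\<nu> x\<^sub>\<nu>\<^sub>1 \<otimes> \<dots> \<otimes> x\<^sub>\<nu>\<^sub>n\<close>, then \<open>tsum n f u\<close> is \<open>\<Sum>\<^sub>\<nu> f [x\<^sub>\<nu>\<^sub>1, \<dots>, x\<^sub>\<nu>\<^sub>n]\<close>.  For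
  multilinear \<open>f\<close> the choice of the decomposition is irrelevant, see \<open>tsum_eq\<close>.
\<close>

definition tsum :: "nat \<Rightarrow> ('h list \<Rightarrow> 'w::ab_group_add) \<Rightarrow> ('k, 'h) tensor \<Rightarrow> 'w"
  where "tsum n f u =
    (\<Sum>xs\<leftarrow>(SOME ls. (\<forall>xs\<in>set ls. length xs = n) \<and> u = (\<Sum>xs\<leftarrow>ls. tens xs)). f xs)"

definition tsum2 :: "('h \<Rightarrow> 'h \<Rightarrow> 'w::ab_group_add) \<Rightarrow> ('k, 'h) tensor \<Rightarrow> 'w"
  where "tsum2 f = tsum 2 (\<lambda>xs. f (xs ! 0) (xs ! 1))"

definition tsum3 :: "('h \<Rightarrow> 'h \<Rightarrow> 'h \<Rightarrow> 'w::ab_group_add) \<Rightarrow> ('k, 'h) tensor \<Rightarrow> 'w"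
  where "tsum3 f = tsum 3 (\<lambda>xs. f (xs ! 0) (xs ! 1) (xs ! 2))"

definition tsum4 :: "('h \<Rightarrow> 'h \<Rightarrow> 'h \<Rightarrow> 'h \<Rightarrow> 'w::ab_group_add) \<Rightarrow> ('k, 'h) tensor \<Rightarrow> 'w"
  where "tsum4 f = tsum 4 (\<lambda>xs. f (xs ! 0) (xs ! 1) (xs ! 2) (xs ! 3))"

definition tone :: "nat \<Rightarrow> ('k, 'h) tensor"
  where "tone n = tens (replicate n 1)"

definition tmult :: "nat \<Rightarrow> ('k, 'h) tensor \<Rightarrow> ('k, 'h) tensor \<Rightarrow> ('k, 'h) tensor"
  where "tmult n u v = tsum n (\<lambda>xs. tsum n (\<lambda>ys. tens (map2 (*) xs ys)) v) u"

abbreviation tmult2 (infixl "\<cdot>\<^sub>2" 70) where "u \<cdot>\<^sub>2 v \<equiv> tmult 2 u v"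
abbreviation tmult3 (infixl "\<cdot>\<^sub>3" 70) where "u \<cdot>\<^sub>3 v \<equiv> tmult 3 u v"
abbreviation tmult4 (infixl "\<cdot>\<^sub>4" 70) where "u \<cdot>\<^sub>4 v \<equiv> tmult 4 u v"

definition tinvertible :: "nat \<Rightarrow> ('k, 'h) tensor \<Rightarrow> bool"
  where "tinvertible n u \<longleftrightarrow>
    u \<in> tpow n \<and> (\<exists>v\<in>tpow n. tmult n u v = tone n \<and> tmult n v u = tone n)"

definition tinv :: "nat \<Rightarrow> ('k, 'h) tensor \<Rightarrow> ('k, 'h) tensor"
  where "tinv n u = (THE v. v \<in> tpow n \<and> tmult n u v = tone n \<and> tmult n v u = tone n)"

text \<open>\<open>u \<otimes> v\<close> for \<open>u\<close> in the \<open>m\<close>-th and \<open>v\<close> in the \<open>n\<close>-th tensor power\<close>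
definition tcat :: "nat \<Rightarrow> nat \<Rightarrow> ('k, 'h) tensor \<Rightarrow> ('k, 'h) tensor \<Rightarrow> ('k, 'h) tensor"
  where "tcat m n u v = tsum m (\<lambda>xs. tsum n (\<lambda>ys. tens (xs @ ys)) v) u"

text \<open>\<open>f \<otimes> \<dots> \<otimes> f\<close>\<close>
definition tmap :: "nat \<Rightarrow> ('h \<Rightarrow> 'h) \<Rightarrow> ('k, 'h) tensor \<Rightarrow> ('k, 'h) tensor"
  where "tmap n f = tsum n (\<lambda>xs. tens (map f xs))"

text \<open>The flip \<open>T\<close> for \<open>n = 2\<close>, and \<open>u \<mapsto> u\<^sub>3\<^sub>2\<^sub>1\<close> for \<open>n = 3\<close>\<close>
definition trev :: "nat \<Rightarrow> ('k, 'h) tensor \<Rightarrow> ('k, 'h) tensor"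
  where "trev n = tsum n (\<lambda>xs. tens (rev xs))"

text \<open>
  \<open>comult_at D n i\<close> applies \<open>D\<close> to the factor number \<open>i\<close>, counted from \<open>0\<close>: for example
  \<open>comult_at D 3 1\<close> is \<open>1 \<otimes> D \<otimes> 1\<close>.  Likewise \<open>counit_at e 3 1\<close> is \<open>1 \<otimes> e \<otimes> 1\<close>,
  with the scalar absorbed.
\<close>
definition comult_at ::
  "('h \<Rightarrow> ('k, 'h) tensor) \<Rightarrow> nat \<Rightarrow> nat \<Rightarrow> ('k, 'h) tensor \<Rightarrow> ('k, 'h) tensor"
  where "comult_at D n i =
    tsum n (\<lambda>xs. tsum 2 (\<lambda>ys. tens (take i xs @ ys @ drop (Suc i) xs)) (D (xs ! i)))"

definition counit_at :: "('h \<Rightarrow> 'k) \<Rightarrow> nat \<Rightarrow> nat \<Rightarrow> ('k, 'h) tensor \<Rightarrow> ('k, 'h) tensor"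
  where "counit_at e n i =
    tsum n (\<lambda>xs. tscale (e (xs ! i)) (tens (take i xs @ drop (Suc i) xs)))"


subsection \<open>The universal property\<close>

lemma vs_linear_iff:
  "Vector_Spaces.linear s1 s2 f \<longleftrightarrow> vector_space s1 \<and> vector_space s2 \<and>
    (\<forall>x y. f (x + y) = f x + f y) \<and> (\<forall>c x. f (s1 c x) = s2 c (f x))"
  unfolding Vector_Spaces.linear_def module_hom_def module_hom_axioms_def module_iff_vector_space
  by blast

lemma vector_space_tscale: "vector_space (tscale :: 'k \<Rightarrow> ('k, 'h) tensor \<Rightarrow> _)"
  by unfold_locales (auto simp: tscale_def fun_eq_iff algebra_simps)

lemma multilinear_tens: "multilinear scale tscale n tens"
  unfolding multilinear_def
proof (intro allI impI)
  fix xs :: "'h list" and i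
  assume l: "length xs = n" and i: "i < n"
  show "Vector_Spaces.linear scale tscale (\<lambda>a. tens (xs[i := a]))"
  proof (intro vs_linear_iff[THEN iffD2] conjI vector_space_axioms vector_space_tscale allI)
    fix x y
    show "tens (xs[i := x + y]) = tens (xs[i := x]) + tens (xs[i := y])"
    proof
      fix m :: "'h list \<Rightarrow> 'k"
      show "tens (xs[i := x + y]) m = (tens (xs[i := x]) + tens (xs[i := y])) m"
      proof (cases "multilinear scale (*) n m")
        case True
        then have "m (xs[i := x + y]) = m (xs[i := x]) + m (xs[i := y])"
          using l i unfolding multilinear_def vs_linear_iff by blast
        then show ?thesis using True l by (simp add: tens_def)
      qed (simp add: tens_def l)
    qed
  next
    fix c x
    show "tens (xs[i := c *s x]) = tscale c (tens (xs[i := x]))"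
    proof
      fix m :: "'h list \<Rightarrow> 'k"
      show "tens (xs[i := c *s x]) m = tscale c (tens (xs[i := x])) m"
      proof (cases "multilinear scale (*) n m")
        case True
        then have "m (xs[i := c *s x]) = c * m (xs[i := x])"
          using l i unfolding multilinear_def vs_linear_iff by blast
        then show ?thesis using True l by (simp add: tens_def tscale_def)
      qed (simp add: tens_def tscale_def l)
    qed
  qed
qed

lemma sum_tens_cong:
  fixes f :: "'h list \<Rightarrow> 'w::ab_group_add" and sW :: "'k \<Rightarrow> 'w \<Rightarrow> 'w"
  assumes W: "vector_space sW" and f: "multilinear scale sW n f"
    and l1: "\<forall>xs\<in>set l1. length xs = n" and l2: "\<forall>xs\<in>set l2. length xs = n"
    and eq: "(\<Sum>xs\<leftarrow>l1. tens xs) = (\<Sum>xs\<leftarrow>l2. tens xs)"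
  shows "(\<Sum>xs\<leftarrow>l1. f xs) = (\<Sum>xs\<leftarrow>l2. f xs)"
proof (rule ccontr)
  define w where "w = (\<Sum>xs\<leftarrow>l1. f xs) - (\<Sum>xs\<leftarrow>l2. f xs)"
  assume "\<not> ?thesis"
  then have w0: "w \<noteq> 0" by (simp add: w_def)
  interpret W: vector_space sW by (rule W)
  interpret K: vector_space "(*) :: 'k \<Rightarrow> 'k \<Rightarrow> 'k"
    by unfold_locales (auto simp: algebra_simps)
  interpret P: vector_space_pair sW "(*) :: 'k \<Rightarrow> 'k \<Rightarrow> 'k" ..
  have "W.independent {w}" using w0 by simp
  from P.linear_independent_extend[OF this, of "\<lambda>_. 1"]
  obtain \<phi> where lin: "Vector_Spaces.linear sW (*) \<phi>" and \<phi>w: "\<phi> w = 1" by auto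
  have add: "\<phi> (a + b) = \<phi> a + \<phi> b" and sc: "\<phi> (sW c a) = c * \<phi> a" for a b c
    using lin by (auto simp: vs_linear_iff)
  have z: "\<phi> 0 = 0" using sc[of 0 0] by simp
  have dif: "\<phi> (a - b) = \<phi> a - \<phi> b" for a b
    using add[of "a - b" b] by (simp add: algebra_simps)
  have sm: "\<phi> (\<Sum>xs\<leftarrow>ls. f xs) = (\<Sum>xs\<leftarrow>ls. \<phi> (f xs))" for ls
    by (induction ls) (auto simp: z add)
  have ml: "multilinear scale (*) n (\<lambda>xs. \<phi> (f xs))"
    unfolding multilinear_def
  proof (intro allI impI)
    fix xs :: "'h list" and i
    assume "length xs = n" "i < n"
    with f have "Vector_Spaces.linear scale sW (\<lambda>a. f (xs[i := a]))"
      unfolding multilinear_def by blast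
    from Vector_Spaces.linear_compose[OF this lin]
    show "Vector_Spaces.linear scale (*) (\<lambda>a. \<phi> (f (xs[i := a])))"
      by (simp add: comp_def)
  qed
  have ev: "(\<Sum>xs\<leftarrow>ls. tens xs) (\<lambda>xs. \<phi> (f xs)) = (\<Sum>xs\<leftarrow>ls. \<phi> (f xs))"
    if "\<forall>xs\<in>set ls. length xs = n" for ls
    using that by (induction ls) (simp_all add: tens_def ml)
  have "\<phi> w = 0"
    unfolding w_def dif sm using ev[OF l1] ev[OF l2] eq by simp
  with \<phi>w show False by simp
qed

lemma tsum_eq:
  fixes f :: "'h list \<Rightarrow> 'w::ab_group_add" and sW :: "'k \<Rightarrow> 'w \<Rightarrow> 'w"
  assumes "vector_space sW" "multilinear scale sW n f" "\<forall>xs\<in>set ls. length xs = n"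
  shows "tsum n f (\<Sum>xs\<leftarrow>ls. tens xs) = (\<Sum>xs\<leftarrow>ls. f xs)"
proof -
  let ?P = "\<lambda>l. (\<forall>xs\<in>set l. length xs = n) \<and> (\<Sum>xs\<leftarrow>ls. tens xs) = (\<Sum>xs\<leftarrow>l. tens xs)"
  have P: "?P (SOME l. ?P l)" by (rule someI[of ?P ls]) (simp add: assms(3))
  show ?thesis
    unfolding tsum_def
    by (rule sum_tens_cong[OF assms(1,2,3) P[THEN conjunct1] P[THEN conjunct2], symmetric])
qed

lemma tsum_tens:
  fixes f :: "'h list \<Rightarrow> 'w::ab_group_add" and sW :: "'k \<Rightarrow> 'w \<Rightarrow> 'w"
  assumes "vector_space sW" "multilinear scale sW n f" "length xs = n"
  shows "tsum n f (tens xs) = f xs"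
  using tsum_eq[OF assms(1,2), of "[xs]"] assms(3) by simp

lemma tsum_add:
  fixes f :: "'h list \<Rightarrow> 'w::ab_group_add" and sW :: "'k \<Rightarrow> 'w \<Rightarrow> 'w"
  assumes "vector_space sW" "multilinear scale sW n f" "u \<in> tpow n" "v \<in> tpow n"
  shows "u + v \<in> tpow n" "tsum n f (u + v) = tsum n f u + tsum n f v"
proof -
  from assms(3) obtain l where l: "u = (\<Sum>xs\<leftarrow>l. tens xs)" "\<forall>xs\<in>set l. length xs = n"
    by (auto simp: tpow_def)
  from assms(4) obtain l' where l': "v = (\<Sum>xs\<leftarrow>l'. tens xs)" "\<forall>xs\<in>set l'. length xs = n"
    by (auto simp: tpow_def)
  have uv: "u + v = (\<Sum>xs\<leftarrow>l @ l'. tens xs)" using l l' by simp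
  have len: "\<forall>xs\<in>set (l @ l'). length xs = n" using l l' by auto
  show "u + v \<in> tpow n" unfolding tpow_def using uv len by blast
  show "tsum n f (u + v) = tsum n f u + tsum n f v"
    unfolding uv tsum_eq[OF assms(1,2) len] unfolding l(1) l'(1)
      tsum_eq[OF assms(1,2) l(2)] tsum_eq[OF assms(1,2) l'(2)] by simp
qed

lemma tsum_scale:
  fixes f :: "'h list \<Rightarrow> 'w::ab_group_add" and sW :: "'k \<Rightarrow> 'w \<Rightarrow> 'w"
  assumes "vector_space sW" "multilinear scale sW n f" "u \<in> tpow n" "n > 0"
  shows "tscale c u \<in> tpow n" "tsum n f (tscale c u) = sW c (tsum n f u)"
proof -
  interpret W: vector_space sW by (rule assms(1))
  interpret T: vector_space "tscale :: 'k \<Rightarrow> ('k, 'h) tensor \<Rightarrow> _" by (rule vector_space_tscale)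
  from assms(3) obtain l where l: "u = (\<Sum>xs\<leftarrow>l. tens xs)" "\<forall>xs\<in>set l. length xs = n"
    by (auto simp: tpow_def)
  define h :: "'h list \<Rightarrow> 'h list" where "h xs = xs[0 := c *s (xs ! 0)]" for xs
  have hf: "g (h xs) = s c (g xs)" if "multilinear scale s n g" "length xs = n"
    for g :: "'h list \<Rightarrow> 'z::ab_group_add" and s xs
  proof -
    have "g (xs[0 := c *s (xs ! 0)]) = s c (g (xs[0 := xs ! 0]))"
      using that assms(4) unfolding multilinear_def vs_linear_iff by blast
    then show ?thesis by (simp add: h_def)
  qed
  have len: "\<forall>xs\<in>set (map h l). length xs = n" using l(2) by (auto simp: h_def)
  have "tscale c (\<Sum>xs\<leftarrow>l'. tens xs) = (\<Sum>xs\<leftarrow>map h l'. tens xs)"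
    if "\<forall>xs\<in>set l'. length xs = n" for l'
    using that by (induction l') (simp_all add: T.scale_right_distrib hf[OF multilinear_tens])
  from this[OF l(2)] have cu: "tscale c u = (\<Sum>xs\<leftarrow>map h l. tens xs)" using l(1) by simp
  show "tscale c u \<in> tpow n" unfolding tpow_def using cu len by blast
  have "(\<Sum>xs\<leftarrow>map h l'. f xs) = sW c (\<Sum>xs\<leftarrow>l'. f xs)"
    if "\<forall>xs\<in>set l'. length xs = n" for l'
    using that by (induction l') (simp_all add: W.scale_right_distrib hf[OF assms(2)])
  from this[OF l(2)] show "tsum n f (tscale c u) = sW c (tsum n f u)"
    unfolding cu tsum_eq[OF assms(1,2) len] unfolding l(1) tsum_eq[OF assms(1,2) l(2)] .
qed

lemma tsum_unique:
  fixes g :: "('k, 'h) tensor \<Rightarrow> 'w::ab_group_add" and sW :: "'k \<Rightarrow> 'w \<Rightarrow> 'w"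
  assumes "vector_space sW" "multilinear scale sW n f"
    and g: "\<And>u v. u \<in> tpow n \<Longrightarrow> v \<in> tpow n \<Longrightarrow> g (u + v) = g u + g v"
    and gf: "\<And>xs. length xs = n \<Longrightarrow> g (tens xs) = f xs"
    and "u \<in> tpow n"
  shows "g u = tsum n f u"
proof -
  from assms(5) obtain l where l: "u = (\<Sum>xs\<leftarrow>l. tens xs)" "\<forall>xs\<in>set l. length xs = n"
    by (auto simp: tpow_def)
  have mem: "(\<Sum>xs\<leftarrow>l'. tens xs) \<in> tpow n" if "\<forall>xs\<in>set l'. length xs = n" for l'
    using that unfolding tpow_def by blast
  have z: "g 0 = 0" using g[of 0 0] mem[of "[]"] by simp
  have "g (\<Sum>xs\<leftarrow>l'. tens xs) = (\<Sum>xs\<leftarrow>l'. f xs)" if "\<forall>xs\<in>set l'. length xs = n" for l'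
    using that
  proof (induction l')
    case Nil
    show ?case by (simp only: list.map sum_list.Nil z)
  next
    case (Cons x l')
    then have "g (tens x + (\<Sum>xs\<leftarrow>l'. tens xs)) = g (tens x) + g (\<Sum>xs\<leftarrow>l'. tens xs)"
      using mem[of "[x]"] mem[of l'] by (intro g) auto
    also have "\<dots> = f x + (\<Sum>xs\<leftarrow>l'. f xs)" using Cons gf by simp
    finally show ?case by (simp only: list.map sum_list.Cons)
  qed
  then show ?thesis using l tsum_eq[OF assms(1,2) l(2)] by simp
qed

end


section \<open>Quasi-Hopf algebras\<close>

locale quasi_bialgebra = k_algebra scale
  for scale :: "'k::field \<Rightarrow> 'h::ring_1 \<Rightarrow> 'h" (infixr "*s" 75) +
  fixes \<Delta> :: "'h \<Rightarrow> ('k, 'h) tensor" and \<epsilon> :: "'h \<Rightarrow> 'k" and \<Phi> :: "('k, 'h) tensor"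
  assumes counit_linear: "Vector_Spaces.linear scale (*) \<epsilon>"
    and counit_mult: "\<epsilon> (a * b) = \<epsilon> a * \<epsilon> b"
    and counit_one: "\<epsilon> 1 = 1"
    and comult_in: "\<Delta> a \<in> tpow 2"
    and comult_linear: "Vector_Spaces.linear scale tscale \<Delta>"
    and comult_mult: "\<Delta> (a * b) = \<Delta> a \<cdot>\<^sub>2 \<Delta> b"
    and comult_one: "\<Delta> 1 = tone 2"
    and coassoc_invertible: "tinvertible 3 \<Phi>"
    and quasi_coassoc:
      "comult_at \<Delta> 2 1 (\<Delta> a) = tinv 3 \<Phi> \<cdot>\<^sub>3 comult_at \<Delta> 2 0 (\<Delta> a) \<cdot>\<^sub>3 \<Phi>"
    and pentagon:
      "comult_at \<Delta> 3 0 \<Phi> \<cdot>\<^sub>4 comult_at \<Delta> 3 2 \<Phi> =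
        tcat 3 1 \<Phi> (tone 1) \<cdot>\<^sub>4 comult_at \<Delta> 3 1 \<Phi> \<cdot>\<^sub>4 tcat 1 3 (tone 1) \<Phi>"
    and counit_left: "counit_at \<epsilon> 2 0 (\<Delta> a) = tens [a]"
    and counit_right: "counit_at \<epsilon> 2 1 (\<Delta> a) = tens [a]"
    and counit_coassoc: "counit_at \<epsilon> 3 1 \<Phi> = tone 2"

locale quasi_hopf_algebra = quasi_bialgebra scale \<Delta> \<epsilon> \<Phi>
  for scale :: "'k::field \<Rightarrow> 'h::ring_1 \<Rightarrow> 'h" (infixr "*s" 75)
    and \<Delta> :: "'h \<Rightarrow> ('k, 'h) tensor" and \<epsilon> :: "'h \<Rightarrow> 'k" and \<Phi> :: "('k, 'h) tensor" +
  fixes S :: "'h \<Rightarrow> 'h" and \<alpha> \<beta> :: 'h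
  assumes antipode_linear: "Vector_Spaces.linear scale scale S"
    and antipode_mult: "S (a * b) = S b * S a"
    and antipode_one: "S 1 = 1"
    and antipode_coassoc: "tsum3 (\<lambda>X Y Z. S X * \<alpha> * Y * \<beta> * S Z) \<Phi> = 1"
    and antipode_coassoc_inv: "tsum3 (\<lambda>X Y Z. X * \<beta> * S Y * \<alpha> * Z) (tinv 3 \<Phi>) = 1"
    and antipode_alpha: "tsum2 (\<lambda>a1 a2. S a1 * \<alpha> * a2) (\<Delta> a) = \<epsilon> a *s \<alpha>"
    and antipode_beta: "tsum2 (\<lambda>a1 a2. a1 * \<beta> * S a2) (\<Delta> a) = \<epsilon> a *s \<beta>"
begin

definition is_twist :: "('k, 'h) tensor \<Rightarrow> bool"
  where "is_twist F \<longleftrightarrow>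
    tinvertible 2 F \<and> counit_at \<epsilon> 2 0 F = tone 1 \<and> counit_at \<epsilon> 2 1 F = tone 1"

definition twist_comult :: "('k, 'h) tensor \<Rightarrow> 'h \<Rightarrow> ('k, 'h) tensor"
  where "twist_comult F a = F \<cdot>\<^sub>2 \<Delta> a \<cdot>\<^sub>2 tinv 2 F"

definition twist_coassoc :: "('k, 'h) tensor \<Rightarrow> ('k, 'h) tensor"
  where "twist_coassoc F =
    tcat 2 1 F (tone 1) \<cdot>\<^sub>3 comult_at \<Delta> 2 0 F \<cdot>\<^sub>3 \<Phi> \<cdot>\<^sub>3
    comult_at \<Delta> 2 1 (tinv 2 F) \<cdot>\<^sub>3 tcat 1 2 (tone 1) (tinv 2 F)"

definition twist_alpha :: "('k, 'h) tensor \<Rightarrow> 'h"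
  where "twist_alpha F = tsum2 (\<lambda>x y. S x * \<alpha> * y) (tinv 2 F)"

definition twist_beta :: "('k, 'h) tensor \<Rightarrow> 'h"
  where "twist_beta F = tsum2 (\<lambda>x y. x * \<beta> * S y) F"

definition drinfeld_gamma :: "('k, 'h) tensor"
  where "drinfeld_gamma =
    tsum4 (\<lambda>A B C D. tens [S B * \<alpha> * C, S A * \<alpha> * D])
      (tcat 3 1 (tinv 3 \<Phi>) (tone 1) \<cdot>\<^sub>4 comult_at \<Delta> 3 0 \<Phi>)"

definition drinfeld_twist :: "('k, 'h) tensor"
  where "drinfeld_twist =
    tsum3 (\<lambda>X Y Z. tmap 2 S (trev 2 (\<Delta> X)) \<cdot>\<^sub>2 drinfeld_gamma \<cdot>\<^sub>2 \<Delta> (Y * \<beta> * S Z)) \<Phi>"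

definition second_drinfeld_twist :: "('k, 'h) tensor"
  where "second_drinfeld_twist = tmap 2 (inv S) (trev 2 drinfeld_twist)"

end

end

theory Submission
  imports Defs
begin

text \<open>
  The antipode of a quasi-Hopf algebra is unique up to a unit, and the Drinfeld twist is such a
  unit.  If \<open>f : H \<rightarrow> B\<close> is an algebra map, \<open>g : H \<rightarrow> B\<close> an antimultiplicative map and \<open>\<rho>, \<sigma> \<in> B\<close>
  satisfy the axioms of an antipode with canonical elements along \<open>f\<close>, then for a second such
  triple \<open>(g', \<rho>', \<sigma>')\<close> the element \<open>F = \<Sum> g'(X) \<rho>' f(Y) \<sigma> g(Z)\<close> is invertible and carries the first
  triple to the second.  Take \<open>B = H \<otimes> H\<close> and \<open>f = \<Delta>\<close>.  One triple is
  \<open>(\<Delta> \<circ> S, \<Delta>(\<alpha>), \<Delta>(\<beta>))\<close>; the other one is \<open>(\<Theta>, \<gamma>, \<gamma>')\<close> with \<open>\<Theta> = (S \<otimes> S)\<Delta>\<^sup>T\<close>, and the unit that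
  belongs to them is the Drinfeld twist \<open>F\<close>.  Hence \<open>F \<Delta>(S a) = \<Theta>(a) F\<close> (\<open>F_\<Delta>\<close>) and
  \<open>F \<Delta>(\<alpha>) = \<gamma>\<close> (\<open>F_alpha\<close>).

  What has to be shown is that \<open>(\<Theta>, \<gamma>, \<gamma>')\<close> satisfies the axioms.  The elements \<open>\<gamma>\<close> and \<open>\<gamma>'\<close> are built from
  four elements \<open>q\<^sub>L\<close>, \<open>p\<^sub>R\<close>, \<open>q'\<close>, \<open>p'\<close> of \<open>H \<otimes> H\<close>, each of which moves one leg of a coproduct to the
  other side (\<open>q\<^sub>L_comult\<close> and its companions) and each of which satisfies a normalisation that
  comes from one form of the pentagon (\<open>pq_unit\<close>).  The invariance of \<open>\<gamma>\<close> and \<open>\<gamma>'\<close> is then immediate, and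
  in each of the two antipode identities \<open>snake1\<close> and \<open>snake2\<close> the pentagon turns the product of
  three coassociators into a product of two, after which the sum splits into two normalisations.

  The same uniqueness principle gives the coassociator.  Both sides of
  \<open>(F \<otimes> 1)(\<Delta> \<otimes> 1)F \<Phi> = \<Omega> (1 \<otimes> F)(1 \<otimes> \<Delta>)F\<close> with \<open>\<Omega> = (S \<otimes> S \<otimes> S)\<Phi>\<^sub>3\<^sub>2\<^sub>1\<close> intertwine the same pair of
  antipodes along \<open>(1 \<otimes> \<Delta>)\<Delta>\<close>, so they agree as soon as they agree after multiplication by the image
  of \<open>\<alpha>\<close> (\<open>intertwiner_unique\<close>).  There \<open>F \<Delta>(\<alpha>) = \<gamma>\<close> reduces the claim to an identity between
  coassociators, which \<open>left_gamma\<close>, \<open>right_gamma\<close> and \<open>\<Omega>_M'\<close> establish.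

  Finally \<open>\<sigma> = (S\<^sup>-\<^sup>1 \<otimes> \<dots> \<otimes> S\<^sup>-\<^sup>1)\<close>, followed by the reversal of the factors, is an
  antiautomorphism of every tensor power.  It maps \<open>F\<close> to the second Drinfeld twist and each
  statement about \<open>F\<close> to the corresponding statement about \<open>F\<^sub>0\<close>, and it maps the axioms of \<open>H\<close> to those
  of the new structure.  Since \<open>\<sigma>\<close> reverses products, it exchanges the roles of the old and the new
  coproduct, which is why \<open>F\<^sub>0\<close> rather than its inverse does the twisting.
\<close>

section \<open>Tensor powers as algebras\<close>

text \<open>
  Tensors are functions, but here they are elements of an abstract vector space: sums of
  tensors should not be evaluated pointwise.
\<close>
declare plus_fun_apply [simp del] zero_fun_apply [simp del]

context k_algebra
begin

abbreviation lin :: "('k \<Rightarrow> 'w::ab_group_add \<Rightarrow> 'w) \<Rightarrow> ('h \<Rightarrow> 'w) \<Rightarrow> bool"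
  where "lin sW f \<equiv> Vector_Spaces.linear scale sW f"

abbreviation mlin :: "('k \<Rightarrow> 'w::ab_group_add \<Rightarrow> 'w) \<Rightarrow> nat \<Rightarrow> ('h list \<Rightarrow> 'w) \<Rightarrow> bool"
  where "mlin sW n f \<equiv> multilinear scale sW n f"

text \<open>
  Because \<open>tsum\<close> sums over one fixed decomposition of the tensor, it can be exchanged with other sums
  and with additive maps without any hypothesis on the summand.  Multilinearity enters only where two
  different decompositions are compared, as in \<open>tsum_tsum\<close>.
\<close>

definition decomp :: "nat \<Rightarrow> ('k, 'h) tensor \<Rightarrow> 'h list list"
  where "decomp n u = (SOME ls. (\<forall>xs\<in>set ls. length xs = n) \<and> u = (\<Sum>xs\<leftarrow>ls. tens xs))"

lemma tsum_decomp: "tsum n f u = (\<Sum>xs\<leftarrow>decomp n u. f xs)"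
  by (simp add: tsum_def decomp_def)

lemma decomp:
  assumes "u \<in> tpow n"
  shows "\<forall>xs\<in>set (decomp n u). length xs = n" "(\<Sum>xs\<leftarrow>decomp n u. tens xs) = u"
proof -
  have "\<exists>ls. (\<forall>xs\<in>set ls. length xs = n) \<and> u = (\<Sum>xs\<leftarrow>ls. tens xs)"
    using assms by (auto simp: tpow_def)
  from someI_ex[OF this]
  show "\<forall>xs\<in>set (decomp n u). length xs = n" "(\<Sum>xs\<leftarrow>decomp n u. tens xs) = u"
    by (simp_all add: decomp_def)
qed

lemma lin_vector_space: "lin sW f \<Longrightarrow> vector_space sW"
  by (simp add: vs_linear_iff)

lemma mlin_vector_space: "mlin sW n f \<Longrightarrow> n > 0 \<Longrightarrow> vector_space sW"
  unfolding multilinear_def using lin_vector_space by (metis length_replicate)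

lemma linI:
  assumes "vector_space sW" "\<And>x y. f (x + y) = f x + f y" "\<And>c x. f (c *s x) = sW c (f x)"
  shows "lin sW f"
  using assms vector_space_axioms by (simp add: vs_linear_iff)

lemma lin_add: "lin sW f \<Longrightarrow> f (x + y) = f x + f y"
  and lin_scale: "lin sW f \<Longrightarrow> f (c *s x) = sW c (f x)"
  by (simp_all add: vs_linear_iff)


subsection \<open>Membership\<close>

lemma zero_in: "0 \<in> tpow n"
  unfolding tpow_def by (rule CollectI, rule exI[of _ "[]"]) simp

lemma tens_in [simp]: "length xs = n \<Longrightarrow> tens xs \<in> tpow n"
  unfolding tpow_def by (rule CollectI, rule exI[of _ "[xs]"]) simp

lemma add_in: "u \<in> tpow n \<Longrightarrow> v \<in> tpow n \<Longrightarrow> u + v \<in> tpow n"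
  using tsum_add(1)[OF vector_space_tscale multilinear_tens] .

lemma tscale_in [simp]: "u \<in> tpow n \<Longrightarrow> 0 < n \<Longrightarrow> tscale c u \<in> tpow n"
  using tsum_scale(1)[OF vector_space_tscale multilinear_tens] .

lemma sum_list_in: "(\<And>x. x \<in> set l \<Longrightarrow> F x \<in> tpow n) \<Longrightarrow> (\<Sum>x\<leftarrow>l. F x) \<in> tpow n"
  by (induction l) (auto simp: zero_in add_in)

lemma tsum_in:
  assumes "u \<in> tpow n" "\<And>xs. length xs = n \<Longrightarrow> F xs \<in> tpow m"
  shows "tsum n F u \<in> tpow m"
  unfolding tsum_decomp using decomp(1)[OF assms(1)] by (intro sum_list_in assms(2)) auto

lemma tone_in [simp]: "tone n \<in> tpow n"
  by (simp add: tone_def)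


subsection \<open>Manipulating sums\<close>

lemma tsum_cong:
  assumes "u \<in> tpow n" "\<And>xs. length xs = n \<Longrightarrow> f xs = g xs"
  shows "tsum n f u = tsum n g u"
  unfolding tsum_decomp using decomp(1)[OF assms(1)] assms(2)
  by (metis (mono_tags, lifting) map_eq_conv)

text \<open>
  For use as a congruence rule: the tensor is simplified as well.
\<close>

lemma tsum_cong_strong:
  assumes "n = n'" "u = u'" "u' \<in> tpow n'" "\<And>xs. length xs = n' \<Longrightarrow> f xs = g xs"
  shows "tsum n f u = tsum n' g u'"
  using tsum_cong[OF assms(3,4)] assms(1,2) by simp

lemma tsum_tens_id [simp]: "u \<in> tpow n \<Longrightarrow> tsum n tens u = u"
  unfolding tsum_decomp by (rule decomp(2))

lemma tsum_additive:
  assumes "h 0 = 0" "\<And>x y. h (x + y) = h x + h y"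
  shows "h (tsum n f u) = tsum n (\<lambda>xs. h (f xs)) u"
proof -
  have "h (\<Sum>x\<leftarrow>l. f x) = (\<Sum>x\<leftarrow>l. h (f x))" for l
    by (induction l) (simp_all add: assms)
  then show ?thesis by (simp add: tsum_decomp)
qed

lemma tsum_swap:
  "tsum n (\<lambda>xs. tsum m (\<lambda>ys. f xs ys) v) u = tsum m (\<lambda>ys. tsum n (\<lambda>xs. f xs ys) u) v"
proof -
  have "(\<Sum>x\<leftarrow>l. \<Sum>y\<leftarrow>k. f x y) = (\<Sum>y\<leftarrow>k. \<Sum>x\<leftarrow>l. f x y)" for l k
    by (induction l) (simp_all add: sum_list_addf)
  then show ?thesis by (simp add: tsum_decomp)
qed

lemma tsum_sum_list:
  assumes f: "mlin sW m f" and W: "vector_space sW" and F: "\<And>x. x \<in> set l \<Longrightarrow> F x \<in> tpow m"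
  shows "tsum m f (\<Sum>x\<leftarrow>l. F x) = (\<Sum>x\<leftarrow>l. tsum m f (F x))"
  using F
proof (induction l)
  case Nil
  show ?case using tsum_eq[OF W f, of "[]"] by simp
next
  case (Cons a l)
  then have "tsum m f (F a + (\<Sum>x\<leftarrow>l. F x)) = tsum m f (F a) + tsum m f (\<Sum>x\<leftarrow>l. F x)"
    by (intro tsum_add(2)[OF W f] sum_list_in) auto
  with Cons show ?case by simp
qed

text \<open>
  The tensor \<open>\<Sum> F xs\<close> comes with a decomposition of its own, so \<open>f\<close> has to be multilinear for
  the two ways of summing to agree; \<open>F\<close> does not.
\<close>

lemma tsum_tsum:
  assumes "mlin sW m f" "vector_space sW" "u \<in> tpow n" "\<And>xs. length xs = n \<Longrightarrow> F xs \<in> tpow m"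
  shows "tsum m f (tsum n F u) = tsum n (\<lambda>xs. tsum m f (F xs)) u"
  unfolding tsum_decomp[of n] using decomp(1)[OF assms(3)]
  by (intro tsum_sum_list[OF assms(1,2)] assms(4)) auto

subsection \<open>Multilinear maps\<close>

lemma lin_id: "lin scale (\<lambda>x. x)"
  by (rule linI[OF vector_space_axioms]) auto

lemma lin_mult_left: "lin scale h \<Longrightarrow> lin scale (\<lambda>x. c * h x)"
  by (rule linI[OF vector_space_axioms]) (auto simp: lin_add lin_scale algebra_simps scale_mult_right)

lemma lin_mult_right: "lin scale h \<Longrightarrow> lin scale (\<lambda>x. h x * c)"
  by (rule linI[OF vector_space_axioms]) (auto simp: lin_add lin_scale algebra_simps scale_mult_left)

lemma lin_compose: "lin sW f \<Longrightarrow> lin scale h \<Longrightarrow> lin sW (\<lambda>x. f (h x))"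
  by (simp add: vs_linear_iff)

lemma lin_scalar: "lin (*) h \<Longrightarrow> vector_space sW \<Longrightarrow> lin sW (\<lambda>x. sW (h x) w)"
proof (rule linI)
  assume h: "lin (*) h" and W: "vector_space sW"
  interpret W: vector_space sW by (rule W)
  fix x y show "sW (h (x + y)) w = sW (h x) w + sW (h y) w"
    by (simp add: lin_add[OF h] W.scale_left_distrib)
next
  assume h: "lin (*) h" and W: "vector_space sW"
  interpret W: vector_space sW by (rule W)
  fix c x show "sW (h (c *s x)) w = sW c (sW (h x) w)"
    by (simp add: lin_scale[OF h])
qed

lemma lin_scale_value: "lin sW h \<Longrightarrow> lin sW (\<lambda>x. sW c (h x))"
proof (rule linI)
  assume h: "lin sW h"
  then show W: "vector_space sW" by (rule lin_vector_space)
  interpret W: vector_space sW by (rule W)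
  fix x y show "sW c (h (x + y)) = sW c (h x) + sW c (h y)"
    by (simp add: lin_add[OF h] W.scale_right_distrib)
  fix d show "sW c (h (d *s x)) = sW d (sW c (h x))"
    by (simp add: lin_scale[OF h] W.scale_left_commute)
qed

lemma lin_tsum:
  assumes "vector_space sW" "u \<in> tpow n" "\<And>ys. length ys = n \<Longrightarrow> lin sW (\<lambda>x. f x ys)"
  shows "lin sW (\<lambda>x. tsum n (f x) u)"
proof -
  interpret W: vector_space sW by (rule assms(1))
  have "(\<Sum>ys\<leftarrow>l. f (x + y) ys) = (\<Sum>ys\<leftarrow>l. f x ys) + (\<Sum>ys\<leftarrow>l. f y ys)"
    if "\<forall>ys\<in>set l. length ys = n" for l x y
    using that by (induction l) (simp_all add: lin_add[OF assms(3)])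
  moreover have "(\<Sum>ys\<leftarrow>l. f (c *s x) ys) = sW c (\<Sum>ys\<leftarrow>l. f x ys)"
    if "\<forall>ys\<in>set l. length ys = n" for l c x
    using that by (induction l) (simp_all add: lin_scale[OF assms(3)] W.scale_right_distrib)
  ultimately show ?thesis
    using decomp(1)[OF assms(2)] by (intro linI[OF assms(1)]) (simp_all add: tsum_decomp)
qed

lemma lin_tsum_arg:
  assumes "lin tscale h" "\<And>x. h x \<in> tpow n" "mlin sW n f" "n > 0"
  shows "lin sW (\<lambda>x. tsum n f (h x))"
proof -
  note W = mlin_vector_space[OF assms(3,4)]
  show ?thesis
    by (rule linI[OF W])
      (simp_all add: lin_add[OF assms(1)] lin_scale[OF assms(1)] tsum_add[OF W assms(3)]
        tsum_scale[OF W assms(3)] assms(2,4))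
qed

lemma mlinI:
  "(\<And>xs i. length xs = n \<Longrightarrow> i < n \<Longrightarrow> lin sW (\<lambda>a. f (xs[i := a]))) \<Longrightarrow> mlin sW n f"
  by (simp add: multilinear_def)

lemma mlinD: "mlin sW n f \<Longrightarrow> length xs = n \<Longrightarrow> i < n \<Longrightarrow> lin sW (\<lambda>a. f (xs[i := a]))"
  by (simp add: multilinear_def)

text \<open>
  Each coordinate of the argument may influence only one coordinate of \<open>\<phi> xs\<close>.  This covers
  the reindexings that occur below: products with a fixed list, concatenation, reversal.
\<close>

lemma mlin_subst:
  assumes "mlin sW m g"
    and "\<And>xs i. length xs = n \<Longrightarrow> i < n \<Longrightarrow>
      length (\<phi> xs) = m \<and> (\<exists>j<m. \<exists>L. lin scale L \<and> (\<forall>a. \<phi> (xs[i := a]) = (\<phi> xs)[j := L a]))"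
  shows "mlin sW n (\<lambda>xs. g (\<phi> xs))"
proof (rule mlinI)
  fix xs :: "'h list" and i assume xs: "length xs = n" "i < n"
  from assms(2)[OF this] obtain j L where l: "length (\<phi> xs) = m" and j: "j < m" and L: "lin scale L"
    and eq: "\<And>a. \<phi> (xs[i := a]) = (\<phi> xs)[j := L a]" by blast
  show "lin sW (\<lambda>a. g (\<phi> (xs[i := a])))"
    unfolding eq by (rule lin_compose[OF mlinD[OF assms(1) l j] L])
qed

lemma mlin_tsum:
  assumes "vector_space sW" "u \<in> tpow m" "\<And>ys. length ys = m \<Longrightarrow> mlin sW n (\<lambda>xs. f xs ys)"
  shows "mlin sW n (\<lambda>xs. tsum m (f xs) u)"
  by (intro mlinI lin_tsum[OF assms(1,2)] mlinD[OF assms(3)])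

lemma tsum_zero: "mlin sW n f \<Longrightarrow> vector_space sW \<Longrightarrow> tsum n f 0 = 0"
  using tsum_sum_list[of sW n f "[]"] by simp

lemma tpow_induct [consumes 1, case_names zero tens add]:
  assumes "u \<in> tpow n" "P 0" "\<And>xs. length xs = n \<Longrightarrow> P (tens xs)"
    and "\<And>u v. u \<in> tpow n \<Longrightarrow> v \<in> tpow n \<Longrightarrow> P u \<Longrightarrow> P v \<Longrightarrow> P (u + v)"
  shows "P u"
proof -
  have "P (\<Sum>xs\<leftarrow>l. tens xs)" if "\<forall>xs\<in>set l. length xs = n" for l
    using that
  proof (induction l)
    case Nil
    show ?case using assms(2) by (simp only: list.map sum_list.Nil)
  next
    case (Cons xs l)
    then show ?case
      unfolding list.map sum_list.Cons by (intro assms(3,4) sum_list_in) auto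
  qed
  from this[OF decomp(1)[OF assms(1)]] show ?thesis by (simp add: decomp(2)[OF assms(1)])
qed


subsection \<open>Operations on tensors\<close>

lemma mlin_map2_left: "mlin sW n f \<Longrightarrow> length ys = n \<Longrightarrow> mlin sW n (\<lambda>xs. f (map2 (*) xs ys))"
proof (rule mlin_subst, assumption, safe)
  fix xs :: "'h list" and i assume "length xs = length ys" "i < length ys"
  then show "\<exists>j<length ys. \<exists>L. lin scale L \<and>
      (\<forall>a. map2 (*) (xs[i := a]) ys = (map2 (*) xs ys)[j := L a])"
    by (intro exI[of _ i] exI[of _ "\<lambda>a. a * ys ! i"] conjI allI lin_mult_right lin_id nth_equalityI)
      (auto simp: nth_list_update)
qed simp

lemma mlin_map2_right: "mlin sW n f \<Longrightarrow> length xs = n \<Longrightarrow> mlin sW n (\<lambda>ys. f (map2 (*) xs ys))"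
proof (rule mlin_subst, assumption, safe)
  fix ys :: "'h list" and i assume "length ys = length xs" "i < length xs"
  then show "\<exists>j<length xs. \<exists>L. lin scale L \<and>
      (\<forall>a. map2 (*) xs (ys[i := a]) = (map2 (*) xs ys)[j := L a])"
    by (intro exI[of _ i] exI[of _ "\<lambda>a. xs ! i * a"] conjI allI lin_mult_left lin_id nth_equalityI)
      (auto simp: nth_list_update)
qed simp

lemma mlin_append_left: "mlin sW (m + n) f \<Longrightarrow> length ys = n \<Longrightarrow> mlin sW m (\<lambda>xs. f (xs @ ys))"
proof (rule mlin_subst, assumption, safe)
  fix xs :: "'h list" and i assume "i < length xs"
  then show "\<exists>j<length xs + length ys. \<exists>L. lin scale L \<and> (\<forall>a. xs[i := a] @ ys = (xs @ ys)[j := L a])"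
    by (intro exI[of _ i] exI[of _ "\<lambda>a. a"] conjI allI lin_id) (auto simp: list_update_append)
qed simp

lemma mlin_append_right: "mlin sW (m + n) f \<Longrightarrow> length xs = m \<Longrightarrow> mlin sW n (\<lambda>ys. f (xs @ ys))"
proof (rule mlin_subst, assumption, safe)
  fix ys :: "'h list" and i assume "i < length ys"
  then show "\<exists>j<length xs + length ys. \<exists>L. lin scale L \<and> (\<forall>a. xs @ ys[i := a] = (xs @ ys)[j := L a])"
    by (intro exI[of _ "length xs + i"] exI[of _ "\<lambda>a. a"] conjI allI lin_id)
      (auto simp: list_update_append)
qed simp

lemma mlin_map_rev:
  assumes f: "lin scale f"
  shows "mlin sW n g \<Longrightarrow> mlin sW n (\<lambda>xs. g (map f (rev xs)))"
proof (rule mlin_subst, assumption, safe)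
  fix xs :: "'h list" and i assume "i < length xs"
  then show "\<exists>j<length xs. \<exists>L. lin scale L \<and>
      (\<forall>a. map f (rev (xs[i := a])) = (map f (rev xs))[j := L a])"
    by (intro exI[of _ "length xs - i - 1"] exI[of _ f] conjI allI f) (auto simp: rev_update map_update)
qed simp

lemma mlin_map:
  assumes f: "lin scale f"
  shows "mlin sW n g \<Longrightarrow> mlin sW n (\<lambda>xs. g (map f xs))"
proof (rule mlin_subst, assumption, safe)
  fix xs :: "'h list" and i assume "i < length xs"
  then show "\<exists>j<length xs. \<exists>L. lin scale L \<and> (\<forall>a. map f (xs[i := a]) = (map f xs)[j := L a])"
    by (intro exI[of _ i] exI[of _ f] conjI allI f) (auto simp: map_update)
qed simp

lemma mlin_rev: "mlin sW n g \<Longrightarrow> mlin sW n (\<lambda>xs. g (rev xs))"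
  using mlin_map_rev[OF lin_id] by simp

text \<open>
  Changing a slot \<open>j \<noteq> i\<close> of \<open>xs\<close> changes one slot of the list in which slot \<open>i\<close> is replaced by \<open>ys\<close>.
\<close>

lemma mlin_replace:
  assumes f: "mlin sW (m + (n - 1)) f" and ys: "length ys = m" and xs: "length xs = n"
    and ij: "i < n" "j < n" "i \<noteq> j"
  shows "lin sW (\<lambda>a. f (take i (xs[j := a]) @ ys @ drop (Suc i) (xs[j := a])))"
proof (cases "j < i")
  case True
  then have "take i (xs[j := a]) @ ys @ drop (Suc i) (xs[j := a]) =
      (take i xs @ ys @ drop (Suc i) xs)[j := a]" for a
    using xs ij by (simp add: take_update_swap list_update_append)
  then show ?thesis using mlinD[OF f, of "take i xs @ ys @ drop (Suc i) xs" j] True xs ys ij by simp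
next
  case False
  define k where "k = j - Suc i"
  have j: "j = Suc i + k" using False ij by (simp add: k_def)
  have "take i (xs[j := a]) @ ys @ drop (Suc i) (xs[j := a]) =
      (take i xs @ ys @ drop (Suc i) xs)[i + m + k := a]" for a
    using xs ij ys unfolding j by (simp add: drop_update_swap list_update_append)
  then show ?thesis
    using mlinD[OF f, of "take i xs @ ys @ drop (Suc i) xs" "i + m + k"] xs ys ij j by simp
qed

lemma mlin_comult_at:
  assumes D: "lin tscale D" "\<And>a. D a \<in> tpow 2"
    and f: "mlin sW (Suc n) f" and i: "i < n"
  shows "mlin sW n (\<lambda>xs. tsum 2 (\<lambda>ys. f (take i xs @ ys @ drop (Suc i) xs)) (D (xs ! i)))"
proof (rule mlinI)
  fix xs :: "'h list" and j assume xs: "length xs = n" and j: "j < n"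
  have n: "Suc n = i + (2 + (n - Suc i))" "Suc n = 2 + (n - 1)" using i by auto
  note W = mlin_vector_space[OF f zero_less_Suc]
  show "lin sW (\<lambda>a. tsum 2 (\<lambda>ys. f (take i (xs[j := a]) @ ys @ drop (Suc i) (xs[j := a])))
      (D (xs[j := a] ! i)))"
  proof (cases "i = j")
    case True
    have "mlin sW 2 (\<lambda>ys. f (take i xs @ ys @ drop (Suc i) xs))"
      using mlin_append_left[OF mlin_append_right[OF f[unfolded n(1)]]] xs i by simp
    then have "lin sW (\<lambda>a. tsum 2 (\<lambda>ys. f (take i xs @ ys @ drop (Suc i) xs)) (D a))"
      by (intro lin_tsum_arg D) auto
    then show ?thesis using True xs j by simp
  next
    case False
    then show ?thesis
      using xs j by (simp, intro lin_tsum[OF W D(2)] mlin_replace[OF f[unfolded n(2)] _ xs i j False])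
  qed
qed

lemma mlin_counit_at:
  assumes e: "lin (*) e" and f: "mlin sW (n - 1) f" and i: "i < n" and n: "n > 1"
  shows "mlin sW n (\<lambda>xs. sW (e (xs ! i)) (f (take i xs @ drop (Suc i) xs)))"
proof (rule mlinI)
  fix xs :: "'h list" and j assume xs: "length xs = n" and j: "j < n"
  have W: "vector_space sW" using mlin_vector_space[OF f] n by simp
  show "lin sW (\<lambda>a. sW (e (xs[j := a] ! i)) (f (take i (xs[j := a]) @ drop (Suc i) (xs[j := a]))))"
  proof (cases "i = j")
    case True
    then show ?thesis using xs j by (simp add: lin_scalar[OF e W])
  next
    case False
    have "mlin sW (0 + (n - 1)) f" using f by simp
    from mlin_replace[OF this _ xs i j False, of "[]"]
    have "lin sW (\<lambda>a. f (take i (xs[j := a]) @ drop (Suc i) (xs[j := a])))" by simp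
    from lin_scale_value[OF this] show ?thesis using False by simp
  qed
qed

text \<open>
  \<open>f \<otimes> \<dots> \<otimes> f\<close> after the reversal of the factors.  For an antimultiplicative \<open>f\<close> this reverses products,
  see \<open>tanti_mult\<close>; for \<open>f = S\<close> it is \<open>(S \<otimes> S)T\<close> in degree \<open>2\<close> and \<open>u \<mapsto> (S \<otimes> S \<otimes> S)u\<^sub>3\<^sub>2\<^sub>1\<close> in degree \<open>3\<close>.
\<close>

definition tanti :: "nat \<Rightarrow> ('h \<Rightarrow> 'h) \<Rightarrow> ('k, 'h) tensor \<Rightarrow> ('k, 'h) tensor"
  where "tanti n f = tsum n (\<lambda>xs. tens (map f (rev xs)))"

lemma tmult_in [simp]: "u \<in> tpow n \<Longrightarrow> v \<in> tpow n \<Longrightarrow> tmult n u v \<in> tpow n"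
  by (simp add: tmult_def tsum_in)

lemma tcat_in [simp]: "u \<in> tpow m \<Longrightarrow> v \<in> tpow n \<Longrightarrow> k = m + n \<Longrightarrow> tcat m n u v \<in> tpow k"
  by (simp add: tcat_def tsum_in)

lemma tanti_in [simp]: "u \<in> tpow n \<Longrightarrow> tanti n f u \<in> tpow n"
  by (simp add: tanti_def tsum_in)

lemma comult_at_in [simp]:
  "(\<And>a. D a \<in> tpow 2) \<Longrightarrow> i < n \<Longrightarrow> u \<in> tpow n \<Longrightarrow> m = Suc n \<Longrightarrow> comult_at D n i u \<in> tpow m"
  by (auto simp: comult_at_def intro!: tsum_in)

lemma counit_at_in [simp]:
  "i < n \<Longrightarrow> 1 < n \<Longrightarrow> u \<in> tpow n \<Longrightarrow> m = n - 1 \<Longrightarrow> counit_at e n i u \<in> tpow m"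
  by (auto simp: counit_at_def intro!: tsum_in tscale_in)

lemma tsum_tmult:
  assumes f: "mlin sW n f" and u: "u \<in> tpow n" "v \<in> tpow n" and n: "n > 0"
  shows "tsum n f (tmult n u v) = tsum n (\<lambda>xs. tsum n (\<lambda>ys. f (map2 (*) xs ys)) v) u"
proof -
  note W = mlin_vector_space[OF f n]
  show ?thesis unfolding tmult_def
    by (simp add: tsum_tsum[OF f W] tsum_tens[OF W f] tsum_in u cong: tsum_cong_strong)
qed

lemma tsum_tcat:
  assumes f: "mlin sW (m + n) f" and u: "u \<in> tpow m" "v \<in> tpow n" and n: "m > 0"
  shows "tsum (m + n) f (tcat m n u v) = tsum m (\<lambda>xs. tsum n (\<lambda>ys. f (xs @ ys)) v) u"
proof -
  have W: "vector_space sW" using mlin_vector_space[OF f] n by simp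
  show ?thesis unfolding tcat_def
    by (simp add: tsum_tsum[OF f W] tsum_tens[OF W f] tsum_in u cong: tsum_cong_strong)
qed

lemma tsum_tanti:
  assumes f: "mlin sW n f" and u: "u \<in> tpow n" and n: "n > 0"
  shows "tsum n f (tanti n h u) = tsum n (\<lambda>xs. f (map h (rev xs))) u"
proof -
  note W = mlin_vector_space[OF f n]
  show ?thesis unfolding tanti_def
    by (simp add: tsum_tsum[OF f W] tsum_tens[OF W f] tsum_in u cong: tsum_cong_strong)
qed

lemma tsum_comult_at:
  assumes f: "mlin sW (Suc n) f" and u: "u \<in> tpow n" and D: "\<And>a. D a \<in> tpow 2" and i: "i < n"
  shows "tsum (Suc n) f (comult_at D n i u) =
    tsum n (\<lambda>xs. tsum 2 (\<lambda>ys. f (take i xs @ ys @ drop (Suc i) xs)) (D (xs ! i))) u"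
proof -
  note W = mlin_vector_space[OF f zero_less_Suc]
  show ?thesis unfolding comult_at_def
    using i by (simp add: tsum_tsum[OF f W] tsum_tens[OF W f] tsum_in u D cong: tsum_cong_strong)
qed

lemma tsum_counit_at:
  assumes f: "mlin sW (n - 1) f" and u: "u \<in> tpow n" and i: "i < n" and n: "n > 1"
  shows "tsum (n - 1) f (counit_at e n i u) =
    tsum n (\<lambda>xs. sW (e (xs ! i)) (f (take i xs @ drop (Suc i) xs))) u"
proof -
  have W: "vector_space sW" using mlin_vector_space[OF f] n by simp
  obtain m where m: "n = Suc m" "m > 0" using n by (cases n) auto
  have f: "mlin sW m f" using f m by simp
  show ?thesis using i u unfolding counit_at_def m(1) diff_Suc_1
    by (simp add: tsum_tsum[OF f W] tsum_tens[OF W f]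
      tsum_scale[OF W f] tsum_in m(2) cong: tsum_cong_strong)
qed

subsubsection \<open>Values on pure tensors\<close>

lemma tsum_tens_t [simp]:
  fixes f :: "'h list \<Rightarrow> ('k, 'h) tensor"
  shows "mlin tscale n f \<Longrightarrow> length xs = n \<Longrightarrow> tsum n f (tens xs) = f xs"
  by (rule tsum_tens[OF vector_space_tscale])

lemma tmult_tens [simp]:
  assumes "length xs = n" "length ys = n"
  shows "tmult n (tens xs) (tens ys) = tens (map2 (*) xs ys)"
  unfolding tmult_def using assms
  by (simp add: mlin_tsum[OF vector_space_tscale] mlin_map2_left mlin_map2_right multilinear_tens)

lemma tcat_tens [simp]:
  assumes "length xs = m" "length ys = n"
  shows "tcat m n (tens xs) (tens ys) = tens (xs @ ys)"
  unfolding tcat_def using assms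
  by (simp add: mlin_tsum[OF vector_space_tscale] mlin_append_left mlin_append_right multilinear_tens)

lemma tanti_tens [simp]:
  assumes "lin scale f" "length xs = n"
  shows "tanti n f (tens xs) = tens (map f (rev xs))"
  unfolding tanti_def using assms by (simp add: mlin_map_rev multilinear_tens)

lemma comult_at_tens:
  assumes "lin tscale D" "\<And>a. D a \<in> tpow 2" "length xs = n" "i < n"
  shows "comult_at D n i (tens xs) = tsum 2 (\<lambda>ys. tens (take i xs @ ys @ drop (Suc i) xs)) (D (xs ! i))"
  unfolding comult_at_def using assms by (simp add: mlin_comult_at multilinear_tens)

lemma counit_at_tens:
  assumes "lin (*) e" "length xs = n" "i < n" "n > 1"
  shows "counit_at e n i (tens xs) = tscale (e (xs ! i)) (tens (take i xs @ drop (Suc i) xs))"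
  unfolding counit_at_def using assms by (simp add: mlin_counit_at multilinear_tens)

subsubsection \<open>Additivity\<close>

lemma mlin_tmult_left: "v \<in> tpow n \<Longrightarrow> mlin tscale n (\<lambda>xs. tsum n (\<lambda>ys. tens (map2 (*) xs ys)) v)"
  by (intro mlin_tsum[OF vector_space_tscale] mlin_map2_left multilinear_tens)

lemma mlin_tmult_right: "length xs = n \<Longrightarrow> mlin tscale n (\<lambda>ys. tens (map2 (*) xs ys))"
  by (intro mlin_map2_right multilinear_tens)

lemma mlin_tcat_left: "v \<in> tpow n \<Longrightarrow> mlin tscale m (\<lambda>xs. tsum n (\<lambda>ys. tens (xs @ ys)) v)"
  by (intro mlin_tsum[OF vector_space_tscale] mlin_append_left multilinear_tens)

lemma mlin_tcat_right: "length xs = m \<Longrightarrow> mlin tscale n (\<lambda>ys. tens (xs @ ys))"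
  by (intro mlin_append_right multilinear_tens)

lemma tsum_add_fun: "tsum n (\<lambda>xs. f xs + g xs) u = tsum n f u + tsum n g u"
  by (simp add: tsum_decomp sum_list_addf)

lemma tsum_zero_fun [simp]: "tsum n (\<lambda>xs. 0) u = 0"
  by (simp add: tsum_decomp)

lemma tsum_scale_fun:
  fixes f :: "'h list \<Rightarrow> ('k, 'h) tensor"
  shows "tsum n (\<lambda>xs. tscale c (f xs)) u = tscale c (tsum n f u)"
proof -
  interpret T: vector_space "tscale :: 'k \<Rightarrow> ('k, 'h) tensor \<Rightarrow> _" by (rule vector_space_tscale)
  show ?thesis using tsum_additive[of "tscale c" n f u] by (simp add: T.scale_right_distrib)
qed

lemmas tsum_add_t = tsum_add(2)[OF vector_space_tscale]
lemmas tsum_zero_t = tsum_zero[OF _ vector_space_tscale]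
lemmas tsum_scale_t = tsum_scale(2)[OF vector_space_tscale]

lemma tmult_add_left:
    "u \<in> tpow n \<Longrightarrow> u' \<in> tpow n \<Longrightarrow> v \<in> tpow n \<Longrightarrow> tmult n (u + u') v = tmult n u v + tmult n u' v"
  and tmult_zero_left: "v \<in> tpow n \<Longrightarrow> tmult n 0 v = 0"
  and tmult_scale_left: "u \<in> tpow n \<Longrightarrow> v \<in> tpow n \<Longrightarrow> 0 < n \<Longrightarrow> tmult n (tscale c u) v = tscale c (tmult n u v)"
  by (simp_all add: tmult_def tsum_add_t tsum_zero_t tsum_scale_t mlin_tmult_left)

lemma tmult_add_right:
    "u \<in> tpow n \<Longrightarrow> v \<in> tpow n \<Longrightarrow> v' \<in> tpow n \<Longrightarrow> tmult n u (v + v') = tmult n u v + tmult n u v'"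
  and tmult_zero_right: "u \<in> tpow n \<Longrightarrow> tmult n u 0 = 0"
  and tmult_scale_right: "u \<in> tpow n \<Longrightarrow> v \<in> tpow n \<Longrightarrow> 0 < n \<Longrightarrow> tmult n u (tscale c v) = tscale c (tmult n u v)"
  by (simp_all add: tmult_def tsum_add_t tsum_zero_t tsum_scale_t mlin_tmult_right tsum_add_fun tsum_scale_fun
      cong: tsum_cong_strong)

lemma tcat_add_left: "u \<in> tpow m \<Longrightarrow> u' \<in> tpow m \<Longrightarrow> v \<in> tpow n \<Longrightarrow> tcat m n (u + u') v
    = tcat m n u v + tcat m n u' v"
  and tcat_zero_left: "v \<in> tpow n \<Longrightarrow> tcat m n 0 v = 0"
  and tcat_scale_left: "u \<in> tpow m \<Longrightarrow> v \<in> tpow n \<Longrightarrow> 0 < m \<Longrightarrow> tcat m n (tscale c u) v = tscale c (tcat m n u v)"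
  by (simp_all add: tcat_def tsum_add_t tsum_zero_t tsum_scale_t mlin_tcat_left)

lemma tcat_add_right:
    "u \<in> tpow m \<Longrightarrow> v \<in> tpow n \<Longrightarrow> v' \<in> tpow n \<Longrightarrow> tcat m n u (v + v') = tcat m n u v + tcat m n u v'"
  and tcat_zero_right: "u \<in> tpow m \<Longrightarrow> tcat m n u 0 = 0"
  and tcat_scale_right: "u \<in> tpow m \<Longrightarrow> v \<in> tpow n \<Longrightarrow> 0 < n \<Longrightarrow> tcat m n u (tscale c v) = tscale c (tcat m n u v)"
  by (simp_all add: tcat_def tsum_add_t tsum_zero_t tsum_scale_t mlin_tcat_right tsum_add_fun tsum_scale_fun
      cong: tsum_cong_strong)

lemma tanti_add: "lin scale f \<Longrightarrow> u \<in> tpow n \<Longrightarrow> v \<in> tpow n \<Longrightarrow> tanti n f (u + v) = tanti n f u + tanti n f v"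
  and tanti_zero: "lin scale f \<Longrightarrow> tanti n f 0 = 0"
  and tanti_scale: "lin scale f \<Longrightarrow> u \<in> tpow n \<Longrightarrow> 0 < n \<Longrightarrow> tanti n f (tscale c u) = tscale c (tanti n f u)"
  by (simp_all add: tanti_def tsum_add_t tsum_zero_t tsum_scale_t mlin_map_rev multilinear_tens)

lemma comult_at_add: "lin tscale D \<Longrightarrow> (\<And>a. D a \<in> tpow 2) \<Longrightarrow> i < n \<Longrightarrow> u \<in> tpow n \<Longrightarrow> v \<in> tpow n \<Longrightarrow>
    comult_at D n i (u + v) = comult_at D n i u + comult_at D n i v"
  and comult_at_zero: "lin tscale D \<Longrightarrow> (\<And>a. D a \<in> tpow 2) \<Longrightarrow> i < n \<Longrightarrow> comult_at D n i 0 = 0"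
  by (simp_all add: comult_at_def tsum_add_t tsum_zero_t mlin_comult_at multilinear_tens)

lemma counit_at_add: "lin (*) e \<Longrightarrow> i < n \<Longrightarrow> n > 1 \<Longrightarrow> u \<in> tpow n \<Longrightarrow> v \<in> tpow n \<Longrightarrow>
    counit_at e n i (u + v) = counit_at e n i u + counit_at e n i v"
  and counit_at_zero: "lin (*) e \<Longrightarrow> i < n \<Longrightarrow> n > 1 \<Longrightarrow> counit_at e n i 0 = 0"
  by (simp_all add: counit_at_def tsum_add_t tsum_zero_t mlin_counit_at multilinear_tens)


subsection \<open>The algebra structure on tensor powers\<close>

lemma tmult_assoc:
  assumes "u \<in> tpow n" "v \<in> tpow n" "w \<in> tpow n"
  shows "tmult n (tmult n u v) w = tmult n u (tmult n v w)"
  using assms(1)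
proof (induction u rule: tpow_induct)
  case (tens xs)
  show ?case using assms(2)
  proof (induction v rule: tpow_induct)
    case (tens ys)
    show ?case using assms(3)
    proof (induction w rule: tpow_induct)
      case (tens zs)
      have "map2 (*) (map2 (*) xs ys) zs = map2 (*) xs (map2 (*) ys zs)"
        by (rule nth_equalityI) (auto simp: mult.assoc)
      then show ?case using tens \<open>length xs = n\<close> \<open>length ys = n\<close> by simp
    qed (simp_all add: tens \<open>length xs = n\<close> tmult_add_right tmult_zero_right)
  qed (simp_all add: tens assms tmult_add_left tmult_add_right tmult_zero_left tmult_zero_right)
qed (simp_all add: assms tmult_add_left tmult_zero_left)

lemma tone_left [simp]: "u \<in> tpow n \<Longrightarrow> tmult n (tone n) u = u"
proof (induction u rule: tpow_induct)
  case (tens xs)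
  then show ?case by (auto simp: tone_def intro!: arg_cong[of _ _ tens] nth_equalityI)
qed (simp_all add: tmult_add_right tmult_zero_right)

lemma tone_right [simp]: "u \<in> tpow n \<Longrightarrow> tmult n u (tone n) = u"
proof (induction u rule: tpow_induct)
  case (tens xs)
  then show ?case by (auto simp: tone_def intro!: arg_cong[of _ _ tens] nth_equalityI)
qed (simp_all add: tmult_add_left tmult_zero_left)

lemma tinvI:
  assumes "u \<in> tpow n" "v \<in> tpow n" "tmult n u v = tone n" "tmult n v u = tone n"
  shows "tinvertible n u" "tinv n u = v"
proof -
  show "tinvertible n u" using assms by (auto simp: tinvertible_def)
  show "tinv n u = v" unfolding tinv_def
  proof (rule the_equality)
    fix w assume w: "w \<in> tpow n \<and> tmult n u w = tone n \<and> tmult n w u = tone n"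
    then have "w = tmult n w (tmult n u v)" using assms(3) by simp
    also have "\<dots> = tmult n (tmult n w u) v" by (rule tmult_assoc[symmetric]) (use w assms in auto)
    also have "\<dots> = v" using w assms(2) by simp
    finally show "w = v" .
  qed (use assms in simp)
qed

lemma tinv:
  assumes "tinvertible n u"
  shows "tinv n u \<in> tpow n" "tmult n u (tinv n u) = tone n" "tmult n (tinv n u) u = tone n"
  using assms tinvI(2) unfolding tinvertible_def by metis+

lemma tcat_mult:
  assumes "u \<in> tpow m" "u' \<in> tpow m" "v \<in> tpow n" "v' \<in> tpow n" "k = m + n"
  shows "tmult k (tcat m n u v) (tcat m n u' v') = tcat m n (tmult m u u') (tmult n v v')"
  unfolding assms(5) using assms(1)
proof (induction u rule: tpow_induct)
  case (tens xs)
  show ?case using assms(2)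
  proof (induction u' rule: tpow_induct)
    case (tens xs')
    show ?case using assms(3)
    proof (induction v rule: tpow_induct)
      case (tens ys)
      show ?case using assms(4)
      proof (induction v' rule: tpow_induct)
        case (tens ys')
        then show ?case using \<open>length xs = m\<close> \<open>length xs' = m\<close> \<open>length ys = n\<close> by simp
      qed (simp_all add: tens \<open>length xs = m\<close> \<open>length xs' = m\<close> tmult_add_right tmult_zero_right tcat_add_right
          tcat_zero_right)
    qed (simp_all add: assms tens \<open>length xs = m\<close> tmult_add_left tmult_zero_left tmult_zero_right
        tcat_add_right tcat_zero_right)
  qed (simp_all add: assms tens tmult_add_right tmult_zero_right tcat_add_left tcat_zero_left)
qed (simp_all add: assms tmult_add_left tmult_zero_left tcat_add_left tcat_zero_left)

lemma tcat_tone [simp]: "k = m + n \<Longrightarrow> tcat m n (tone m) (tone n) = tone k"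
  by (simp add: tone_def replicate_add)

subsection \<open>Maps of sums\<close>

lemma tsum_hom:
  assumes "h 0 = 0" "\<And>x y. x \<in> tpow m \<Longrightarrow> y \<in> tpow m \<Longrightarrow> h (x + y) = h x + h y"
    and "u \<in> tpow n" "\<And>xs. length xs = n \<Longrightarrow> F xs \<in> tpow m"
  shows "h (tsum n F u) = tsum n (\<lambda>xs. h (F xs)) u"
proof -
  have "h (\<Sum>x\<leftarrow>l. F x) = (\<Sum>x\<leftarrow>l. h (F x))" if "\<forall>xs\<in>set l. length xs = n" for l
    using that by (induction l) (simp_all add: assms sum_list_in)
  then show ?thesis using decomp(1)[OF assms(3)] by (simp add: tsum_decomp)
qed

lemma tmult_tsum_left:
  "u \<in> tpow n \<Longrightarrow> v \<in> tpow m \<Longrightarrow> (\<And>xs. length xs = n \<Longrightarrow> F xs \<in> tpow m) \<Longrightarrow>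
    tmult m (tsum n F u) v = tsum n (\<lambda>xs. tmult m (F xs) v) u"
  by (rule tsum_hom[where m = m]) (simp_all add: tmult_add_left tmult_zero_left)

lemma tmult_tsum_right:
  "u \<in> tpow n \<Longrightarrow> v \<in> tpow m \<Longrightarrow> (\<And>xs. length xs = n \<Longrightarrow> F xs \<in> tpow m) \<Longrightarrow>
    tmult m v (tsum n F u) = tsum n (\<lambda>xs. tmult m v (F xs)) u"
  by (rule tsum_hom[where m = m]) (simp_all add: tmult_add_right tmult_zero_right)

lemma tcat_tsum_left:
  "u \<in> tpow n \<Longrightarrow> v \<in> tpow k \<Longrightarrow> (\<And>xs. length xs = n \<Longrightarrow> F xs \<in> tpow m) \<Longrightarrow>
    tcat m k (tsum n F u) v = tsum n (\<lambda>xs. tcat m k (F xs) v) u"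
  by (rule tsum_hom[where m = m]) (simp_all add: tcat_add_left tcat_zero_left)

lemma tcat_tsum_right:
  "u \<in> tpow n \<Longrightarrow> v \<in> tpow k \<Longrightarrow> (\<And>xs. length xs = n \<Longrightarrow> F xs \<in> tpow m) \<Longrightarrow>
    tcat k m v (tsum n F u) = tsum n (\<lambda>xs. tcat k m v (F xs)) u"
  by (rule tsum_hom[where m = m]) (simp_all add: tcat_add_right tcat_zero_right)

lemma tanti_tsum:
  "lin scale f \<Longrightarrow> u \<in> tpow n \<Longrightarrow> (\<And>xs. length xs = n \<Longrightarrow> F xs \<in> tpow m) \<Longrightarrow>
    tanti m f (tsum n F u) = tsum n (\<lambda>xs. tanti m f (F xs)) u"
  by (rule tsum_hom[where m = m]) (simp_all add: tanti_add tanti_zero)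

lemma comult_at_tsum:
  "lin tscale D \<Longrightarrow> (\<And>a. D a \<in> tpow 2) \<Longrightarrow> i < m \<Longrightarrow> u \<in> tpow n \<Longrightarrow>
    (\<And>xs. length xs = n \<Longrightarrow> F xs \<in> tpow m) \<Longrightarrow>
    comult_at D m i (tsum n F u) = tsum n (\<lambda>xs. comult_at D m i (F xs)) u"
  by (rule tsum_hom[where m = m]) (simp_all add: comult_at_add comult_at_zero)

lemma counit_at_tsum:
  "lin (*) e \<Longrightarrow> i < m \<Longrightarrow> m > 1 \<Longrightarrow> u \<in> tpow n \<Longrightarrow>
    (\<And>xs. length xs = n \<Longrightarrow> F xs \<in> tpow m) \<Longrightarrow>
    counit_at e m i (tsum n F u) = tsum n (\<lambda>xs. counit_at e m i (F xs)) u"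
  by (rule tsum_hom[where m = m]) (simp_all add: counit_at_add counit_at_zero)

lemma mlin_insert: "Suc n = i + (2 + (n - Suc i)) \<Longrightarrow> length xs = n \<Longrightarrow> i < n \<Longrightarrow> mlin sW (Suc n) f \<Longrightarrow>
    mlin sW 2 (\<lambda>ys. f (take i xs @ ys @ drop (Suc i) xs))"
  using mlin_append_left[OF mlin_append_right[of sW i "2 + (n - Suc i)" f "take i xs"], of "drop (Suc i) xs"]
  by simp

lemma comult_at_mult:
  assumes D: "lin tscale D" "\<And>a. D a \<in> tpow 2" and m: "\<And>a b. D (a * b) = tmult 2 (D a) (D b)"
    and i: "i < n" and u: "u \<in> tpow n" "v \<in> tpow n" and k: "k = Suc n"
  shows "comult_at D n i (tmult n u v) = tmult k (comult_at D n i u) (comult_at D n i v)"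
  unfolding k using u(1)
proof (induction u rule: tpow_induct)
  case (tens xs)
  show ?case using u(2)
  proof (induction v rule: tpow_induct)
    case (tens ys)
    have n: "Suc n = i + (2 + (n - Suc i))" using i by simp
    have eq: "take i (map2 (*) xs ys) @ map2 (*) as bs @ drop (Suc i) (map2 (*) xs ys) =
      map2 (*) (take i xs @ as @ drop (Suc i) xs) (take i ys @ bs @ drop (Suc i) ys)"
      if "length as = 2" "length bs = 2" for as bs
      using that \<open>length xs = n\<close> \<open>length ys = n\<close> i by (simp add: take_map drop_map take_zip drop_zip)
    define ins where "ins zs as = tens (take i zs @ as @ drop (Suc i) zs)" for zs as
    have ins: "ins zs as \<in> tpow (Suc n)" if "length zs = n" "length as = 2" for zs as
      using that i by (simp add: ins_def)
    have "comult_at D n i (tmult n (tens xs) (tens ys)) =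
      tsum 2 (\<lambda>as. tsum 2 (\<lambda>bs. tmult (Suc n) (ins xs as) (ins ys bs)) (D (ys ! i))) (D (xs ! i))"
      using \<open>length xs = n\<close> \<open>length ys = n\<close> i
      by (simp add: comult_at_tens[OF D] m tsum_tmult[OF mlin_insert[OF n _ _ multilinear_tens]] D(2) eq
        ins_def cong: tsum_cong_strong)
    also have "\<dots> = tmult (Suc n) (tsum 2 (ins xs) (D (xs ! i))) (tsum 2 (ins ys) (D (ys ! i)))"
      using \<open>length xs = n\<close> \<open>length ys = n\<close>
      by (subst tmult_tsum_left) (simp_all add: D(2) ins tsum_in tmult_tsum_right cong: tsum_cong_strong)
    finally show ?case using \<open>length xs = n\<close> \<open>length ys = n\<close> i
      by (simp add: comult_at_tens[OF D] ins_def[abs_def])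
  qed (simp_all add: tens comult_at_add[OF D] comult_at_zero[OF D] tmult_add_right tmult_zero_right i D(2))
qed (simp_all add: u comult_at_add[OF D] comult_at_zero[OF D] tmult_add_left tmult_zero_left i D(2))

lemma comult_at_tone:
  assumes D: "lin tscale D" "\<And>a. D a \<in> tpow 2" "D 1 = tone 2" and i: "i < n"
  shows "comult_at D n i (tone n) = tone (Suc n)"
proof -
  have n: "Suc n = i + (2 + (n - Suc i))" using i by simp
  have r: "take i (replicate n 1) @ replicate 2 1 @ drop (Suc i) (replicate n 1) = replicate (Suc n) (1::'h)"
    using i by (subst n) (simp only: replicate_add take_replicate drop_replicate min.absorb1 less_imp_le)
  show ?thesis unfolding tone_def using i
    by (simp only: comult_at_tens[OF D(1,2)] length_replicate nth_replicate D(3))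
      (simp only: tone_def tsum_tens_t[OF mlin_insert[OF n _ i multilinear_tens]] length_replicate r)
qed

lemma tanti_mult:
  assumes f: "lin scale f" "\<And>a b. f (a * b) = f b * f a" and u: "u \<in> tpow n" "v \<in> tpow n"
  shows "tanti n f (tmult n u v) = tmult n (tanti n f v) (tanti n f u)"
  using u(1)
proof (induction u rule: tpow_induct)
  case (tens xs)
  show ?case using u(2)
  proof (induction v rule: tpow_induct)
    case (tens ys)
    have "map f (rev (map2 (*) xs ys)) = map2 (*) (map f (rev ys)) (map f (rev xs))"
      using \<open>length xs = n\<close> \<open>length ys = n\<close>
      by (intro nth_equalityI) (auto simp: f(2) rev_nth)
    then show ?case using \<open>length xs = n\<close> \<open>length ys = n\<close> by (simp add: f(1))
  qed (simp_all add: tens tanti_add[OF f(1)] tanti_zero[OF f(1)] tmult_add_right tmult_zero_right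
      tmult_add_left tmult_zero_left)
qed (simp_all add: u tanti_add[OF f(1)] tanti_zero[OF f(1)] tmult_add_right tmult_zero_right
      tmult_add_left tmult_zero_left)

lemma tanti_tone: "lin scale f \<Longrightarrow> f 1 = 1 \<Longrightarrow> tanti n f (tone n) = tone n"
  by (simp add: tone_def)

lemma tanti_tanti:
  assumes f: "lin scale f" "lin scale g" "\<And>a. f (g a) = a" and u: "u \<in> tpow n"
  shows "tanti n f (tanti n g u) = u"
  using u by (induction u rule: tpow_induct)
    (simp_all add: tanti_add f tanti_zero rev_map comp_def)

lemma tanti_tcat:
  assumes f: "lin scale f" and u: "u \<in> tpow m" "v \<in> tpow n" and k: "k = m + n"
  shows "tanti k f (tcat m n u v) = tcat n m (tanti n f v) (tanti m f u)"
  unfolding k using u(1)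
proof (induction u rule: tpow_induct)
  case (tens xs)
  show ?case using u(2)
    by (induction v rule: tpow_induct)
      (simp_all add: tens tcat_add_left tcat_zero_left tcat_add_right tcat_zero_right f tanti_add tanti_zero)
qed (simp_all add: u tcat_add_left tcat_zero_left tcat_add_right tcat_zero_right f tanti_add tanti_zero)

text \<open>
  The reversal sends slot \<open>i\<close> to slot \<open>n - 1 - i\<close>, and \<open>D'\<close> is the coproduct that \<open>D\<close> becomes
  under transport along \<open>f\<close>.
\<close>

lemma tanti_comult_at:
  assumes f: "lin scale f" and D: "lin tscale D" "\<And>a. D a \<in> tpow 2" 
    and D': "lin tscale D'" "\<And>a. D' a \<in> tpow 2" "\<And>a. D' (f a) = tanti 2 f (D a)"
    and u: "u \<in> tpow n" and i: "i < n" and j: "j = n - Suc i" and k: "k = Suc n"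
  shows "tanti k f (comult_at D n i u) = comult_at D' n j (tanti n f u)"
  unfolding k using u(1)
proof (induction u rule: tpow_induct)
  case (tens xs)
  have n: "Suc n = j + (2 + (n - Suc j))" "j < n" using i j by auto
  have "map f (rev (take i xs @ ys @ drop (Suc i) xs)) =
      take j (map f (rev xs)) @ map f (rev ys) @ drop (Suc j) (map f (rev xs))" if "length ys = 2" for ys
    using tens i that by (simp add: j rev_take rev_drop take_map drop_map Suc_diff_Suc)
  moreover have "map f (rev xs) ! j = f (xs ! i)" using tens i j by (simp add: rev_nth)
  ultimately show ?case using i n tens
    by (simp add: comult_at_tens[OF D] comult_at_tens[OF D'(1,2)] f D'(3) tanti_tsum D(2)
      tsum_tanti[OF mlin_insert[OF n(1) _ _ multilinear_tens]] cong: tsum_cong_strong)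
qed (use i j in \<open>simp_all add: tanti_add tanti_zero f comult_at_add[OF D] comult_at_zero[OF D]
   comult_at_add[OF D'(1,2)] comult_at_zero[OF D'(1,2)] D\<close>)

lemma tanti_counit_at:
  assumes f: "lin scale f" and e: "lin (*) e" "\<And>a. e (f a) = e a"
    and u: "u \<in> tpow n" and i: "i < n" and n: "n > 1" and j: "j = n - Suc i" and k: "k = n - 1"
  shows "tanti k f (counit_at e n i u) = counit_at e n j (tanti n f u)"
  unfolding k using u(1)
proof (induction u rule: tpow_induct)
  case (tens xs)
  have "map f (rev (take i xs @ drop (Suc i) xs)) =
      take j (map f (rev xs)) @ drop (Suc j) (map f (rev xs))"
    using tens i by (simp add: j rev_take rev_drop take_map drop_map Suc_diff_Suc)
  moreover have "map f (rev xs) ! j = f (xs ! i)" using tens i j by (simp add: rev_nth)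
  ultimately show ?case using i n j tens
    by (simp add: counit_at_tens e f tanti_scale)
qed (use i j n in \<open>simp_all add: tanti_add tanti_zero f counit_at_add e counit_at_zero\<close>)

lemma tmap_trev:
  assumes f: "lin scale f" and u: "u \<in> tpow n"
  shows "tmap n f (trev n u) = tanti n f u"
  using u
proof (induction u rule: tpow_induct)
  case zero
  then show ?case by (simp add: tmap_def trev_def f tanti_zero tsum_zero_t mlin_map mlin_rev multilinear_tens)
next
  case (tens xs)
  then show ?case by (simp add: tmap_def trev_def f mlin_map mlin_rev multilinear_tens)
next
  case (add u v)
  then show ?case by (simp add: tmap_def trev_def f tanti_add tsum_add_t tsum_in mlin_map mlin_rev
      multilinear_tens)
qed

end

section \<open>Sums in Sweedler notation\<close>

text \<open>
  The tensor degrees below are numerals, and \<open>1\<close> has to remain one of them.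
\<close>
declare One_nat_def [simp del]

lemma nth_one [simp]: "(x # xs) ! 1 = xs ! 0"
  by (simp add: One_nat_def)

lemma take_one [simp]: "take 1 (x # xs) = [x]"
  by (simp add: One_nat_def)

context k_algebra
begin

definition multilin2 :: "('k \<Rightarrow> 'w::ab_group_add \<Rightarrow> 'w) \<Rightarrow> ('h \<Rightarrow> 'h \<Rightarrow> 'w) \<Rightarrow> bool"
  where "multilin2 sW f \<longleftrightarrow> (\<forall>b. lin sW (\<lambda>a. f a b)) \<and> (\<forall>a. lin sW (\<lambda>b. f a b))"

definition multilin3 :: "('k \<Rightarrow> 'w::ab_group_add \<Rightarrow> 'w) \<Rightarrow> ('h \<Rightarrow> 'h \<Rightarrow> 'h \<Rightarrow> 'w) \<Rightarrow> bool"
  where "multilin3 sW f \<longleftrightarrow> (\<forall>b c. lin sW (\<lambda>a. f a b c)) \<and> (\<forall>a c. lin sW (\<lambda>b. f a b c)) \<and>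
    (\<forall>a b. lin sW (\<lambda>c. f a b c))"

definition multilin4 :: "('k \<Rightarrow> 'w::ab_group_add \<Rightarrow> 'w) \<Rightarrow> ('h \<Rightarrow> 'h \<Rightarrow> 'h \<Rightarrow> 'h \<Rightarrow> 'w) \<Rightarrow> bool"
  where "multilin4 sW f \<longleftrightarrow> (\<forall>b c d. lin sW (\<lambda>a. f a b c d)) \<and> (\<forall>a c d. lin sW (\<lambda>b. f a b c d)) \<and>
    (\<forall>a b d. lin sW (\<lambda>c. f a b c d)) \<and> (\<forall>a b c. lin sW (\<lambda>d. f a b c d))"

lemma less_4: "i < 4 \<longleftrightarrow> i = 0 \<or> i = 1 \<or> i = 2 \<or> i = (3::nat)" by auto
lemma less_3: "i < 3 \<longleftrightarrow> i = 0 \<or> i = 1 \<or> i = (2::nat)" by auto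

lemma multilin2_mlin: "multilin2 sW f \<Longrightarrow> mlin sW 2 (\<lambda>xs. f (xs ! 0) (xs ! 1))"
  by (rule mlinI) (auto simp: multilin2_def less_2_cases_iff One_nat_def)

lemma multilin3_mlin: "multilin3 sW f \<Longrightarrow> mlin sW 3 (\<lambda>xs. f (xs ! 0) (xs ! 1) (xs ! 2))"
  by (rule mlinI) (auto simp: multilin3_def less_3)

lemma multilin4_mlin: "multilin4 sW f \<Longrightarrow> mlin sW 4 (\<lambda>xs. f (xs ! 0) (xs ! 1) (xs ! 2) (xs ! 3))"
  by (rule mlinI) (auto simp: multilin4_def less_4)

lemma multilin2I: "(\<And>b. lin sW (\<lambda>a. f a b)) \<Longrightarrow> (\<And>a. lin sW (\<lambda>b. f a b)) \<Longrightarrow> multilin2 sW f"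
  by (simp add: multilin2_def)

lemma multilin3I: "(\<And>b c. lin sW (\<lambda>a. f a b c)) \<Longrightarrow> (\<And>a c. lin sW (\<lambda>b. f a b c)) \<Longrightarrow>
    (\<And>a b. lin sW (\<lambda>c. f a b c)) \<Longrightarrow> multilin3 sW f"
  by (simp add: multilin3_def)

lemma multilin4I: "(\<And>b c d. lin sW (\<lambda>a. f a b c d)) \<Longrightarrow> (\<And>a c d. lin sW (\<lambda>b. f a b c d)) \<Longrightarrow>
    (\<And>a b d. lin sW (\<lambda>c. f a b c d)) \<Longrightarrow> (\<And>a b c. lin sW (\<lambda>d. f a b c d)) \<Longrightarrow> multilin4 sW f"
  by (simp add: multilin4_def)

lemma multilin3_lin:
  assumes "multilin3 sW f" "lin scale h"
  shows "lin sW (\<lambda>x. f (h x) b c)" "lin sW (\<lambda>x. f a (h x) c)" "lin sW (\<lambda>x. f a b (h x))"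
  using assms lin_compose[OF _ assms(2), of sW "\<lambda>a. f a b c"] lin_compose[OF _ assms(2), of sW "\<lambda>b. f a b c"]
    lin_compose[OF _ assms(2), of sW "\<lambda>c. f a b c"] by (auto simp: multilin3_def)

lemma multilin4_lin:
  assumes "multilin4 sW f" "lin scale h"
  shows "lin sW (\<lambda>x. f (h x) b c d)" "lin sW (\<lambda>x. f a (h x) c d)" "lin sW (\<lambda>x. f a b (h x) d)"
    "lin sW (\<lambda>x. f a b c (h x))"
  using assms lin_compose[OF _ assms(2), of sW "\<lambda>a. f a b c d"] lin_compose[OF _ assms(2), of sW
      "\<lambda>b. f a b c d"]
    lin_compose[OF _ assms(2), of sW "\<lambda>c. f a b c d"] lin_compose[OF _ assms(2), of sW "\<lambda>d. f a b c d"]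
  by (auto simp: multilin4_def)

lemma multilin2_space: "multilin2 sW f \<Longrightarrow> vector_space sW"
  by (auto simp: multilin2_def dest: lin_vector_space)

lemma multilin3_space: "multilin3 sW f \<Longrightarrow> vector_space sW"
  by (auto simp: multilin3_def dest: lin_vector_space)

lemma multilin4_space: "multilin4 sW f \<Longrightarrow> vector_space sW"
  by (auto simp: multilin4_def dest: lin_vector_space)

lemma length_2: "length xs = 2 \<longleftrightarrow> (\<exists>a b. xs = [a, b])"
  by (auto simp: numeral_eq_Suc length_Suc_conv)
lemma length_3: "length xs = 3 \<longleftrightarrow> (\<exists>a b c. xs = [a, b, c])"
  by (auto simp: numeral_eq_Suc length_Suc_conv)
lemma length_4: "length xs = 4 \<longleftrightarrow> (\<exists>a b c d. xs = [a, b, c, d])"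
  by (auto simp: numeral_eq_Suc length_Suc_conv)

lemma tsum_2: "u \<in> tpow 2 \<Longrightarrow> tsum 2 F u = tsum2 (\<lambda>a b. F [a, b]) u"
  unfolding tsum2_def by (rule tsum_cong) (auto simp: length_2)
lemma tsum_3: "u \<in> tpow 3 \<Longrightarrow> tsum 3 F u = tsum3 (\<lambda>a b c. F [a, b, c]) u"
  unfolding tsum3_def by (rule tsum_cong) (auto simp: length_3)
lemma tsum_4: "u \<in> tpow 4 \<Longrightarrow> tsum 4 F u = tsum4 (\<lambda>a b c d. F [a, b, c, d]) u"
  unfolding tsum4_def by (rule tsum_cong) (auto simp: length_4)

lemma tsum2_in: "u \<in> tpow 2 \<Longrightarrow> (\<And>a b. F a b \<in> tpow m) \<Longrightarrow> tsum2 F u \<in> tpow m"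
  and tsum3_in: "v \<in> tpow 3 \<Longrightarrow> (\<And>a b c. G a b c \<in> tpow m) \<Longrightarrow> tsum3 G v \<in> tpow m"
  and tsum4_in: "w \<in> tpow 4 \<Longrightarrow> (\<And>a b c d. H a b c d \<in> tpow m) \<Longrightarrow> tsum4 H w \<in> tpow m"
  by (simp_all add: tsum2_def tsum3_def tsum4_def tsum_in)

lemma tsum2_tens [simp]: "u \<in> tpow 2 \<Longrightarrow> tsum2 (\<lambda>a b. tens [a, b]) u = u"
  using tsum_2[of u tens] by simp
lemma tsum3_tens [simp]: "u \<in> tpow 3 \<Longrightarrow> tsum3 (\<lambda>a b c. tens [a, b, c]) u = u"
  using tsum_3[of u tens] by simp

lemma tsum2_pure [simp]: "multilin2 sW f \<Longrightarrow> tsum2 f (tens [a, b]) = f a b"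
  unfolding tsum2_def by (subst tsum_tens[OF multilin2_space multilin2_mlin]) simp_all
lemma tsum3_pure [simp]: "multilin3 sW f \<Longrightarrow> tsum3 f (tens [a, b, c]) = f a b c"
  unfolding tsum3_def by (subst tsum_tens[OF multilin3_space multilin3_mlin]) simp_all

lemma tsum2_additive:
  "h 0 = 0 \<Longrightarrow> (\<And>x y. h (x + y) = h x + h y) \<Longrightarrow> tsum2 (\<lambda>a b. h (f a b)) u = h (tsum2 f u)"
  unfolding tsum2_def by (simp add: tsum_additive)
lemma tsum3_additive:
  "h 0 = 0 \<Longrightarrow> (\<And>x y. h (x + y) = h x + h y) \<Longrightarrow> tsum3 (\<lambda>a b c. h (f a b c)) u = h (tsum3 f u)"
  unfolding tsum3_def by (simp add: tsum_additive)

lemma lin_zero: "lin sW h \<Longrightarrow> h 0 = 0"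
proof -
  assume h: "lin sW h"
  have "h (0 + 0) = h 0 + h 0" by (rule lin_add[OF h])
  then show ?thesis by simp
qed

lemma tsum2_lin: "lin sW h \<Longrightarrow> tsum2 (\<lambda>a b. h (f a b)) u = h (tsum2 f u)"
  by (rule tsum2_additive) (simp_all add: lin_zero lin_add)
lemma tsum3_lin: "lin sW h \<Longrightarrow> tsum3 (\<lambda>a b c. h (f a b c)) u = h (tsum3 f u)"
  by (rule tsum3_additive) (simp_all add: lin_zero lin_add)

text \<open>
  The first and the fourth equation permute two sums of the same kind; the others move the sums over
  coassociators outwards.
\<close>

lemma tsum_swap_curried:
  "tsum2 (\<lambda>a b. tsum2 (\<lambda>c d. f a b c d) v) u = tsum2 (\<lambda>c d. tsum2 (\<lambda>a b. f a b c d) u) v"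
  "tsum2 (\<lambda>a b. tsum3 (\<lambda>c d e. g a b c d e) w) u = tsum3 (\<lambda>c d e. tsum2 (\<lambda>a b. g a b c d e) u) w"
  "tsum2 (\<lambda>a b. tsum4 (\<lambda>c d e f. k a b c d e f) x) u = tsum4 (\<lambda>c d e f. tsum2 (\<lambda>a b. k a b c d e f) u) x"
  "tsum3 (\<lambda>a b c. tsum3 (\<lambda>d e f. l a b c d e f) w) w' = tsum3 (\<lambda>d e f. tsum3 (\<lambda>a b c. l a b c d e f) w') w"
  "tsum3 (\<lambda>a b c. tsum4 (\<lambda>d e f g. m a b c d e f g) x) w
      = tsum4 (\<lambda>d e f g. tsum3 (\<lambda>a b c. m a b c d e f g) w) x"
  unfolding tsum2_def tsum3_def tsum4_def by (rule tsum_swap)+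

lemma lin_tsum2: "vector_space sW \<Longrightarrow> u \<in> tpow 2 \<Longrightarrow> (\<And>a b. lin sW (\<lambda>x. f x a b)) \<Longrightarrow> lin sW (\<lambda>x. tsum2 (f x) u)"
  and lin_tsum3: "vector_space sW \<Longrightarrow> v \<in> tpow 3 \<Longrightarrow> (\<And>a b c. lin sW (\<lambda>x. g x a b c))
      \<Longrightarrow> lin sW (\<lambda>x. tsum3 (g x) v)"
  and lin_tsum4: "vector_space sW \<Longrightarrow> w \<in> tpow 4 \<Longrightarrow> (\<And>a b c d. lin sW (\<lambda>x. k x a b c d))
      \<Longrightarrow> lin sW (\<lambda>x. tsum4 (k x) w)"
  unfolding tsum2_def tsum3_def tsum4_def by (auto intro!: lin_tsum)

lemma lin_tens:
  assumes "lin scale h" "i < length xs"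
  shows "lin tscale (\<lambda>x. tens (xs[i := h x]))"
  using lin_compose[OF mlinD[OF multilinear_tens refl assms(2)] assms(1)] .

lemma lin_tens1: "lin scale h \<Longrightarrow> lin tscale (\<lambda>x. tens [h x])"
  using lin_tens[of h 0 "[undefined]"] by simp

lemma lin_tens2:
  assumes "lin scale h"
  shows "lin tscale (\<lambda>x. tens [h x, b])" "lin tscale (\<lambda>x. tens [a, h x])"
  using lin_tens[OF assms, of 0 "[undefined, b]"] lin_tens[OF assms, of 1 "[a, undefined]"]
    by (simp_all add: One_nat_def)

lemma lin_tens3:
  assumes "lin scale h"
  shows "lin tscale (\<lambda>x. tens [h x, b, c])" "lin tscale (\<lambda>x. tens [a, h x, c])"
      "lin tscale (\<lambda>x. tens [a, b, h x])"
  using lin_tens[OF assms, of 0 "[undefined, b, c]"] lin_tens[OF assms, of 1 "[a, undefined, c]"]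
    lin_tens[OF assms, of 2 "[a, b, undefined]"] by (simp_all add: eval_nat_numeral One_nat_def)

lemma lin_tmult:
  assumes "lin tscale h" "\<And>x. h x \<in> tpow n" "v \<in> tpow n" "0 < n"
  shows "lin tscale (\<lambda>x. tmult n (h x) v)" "lin tscale (\<lambda>x. tmult n v (h x))"
  using assms by (auto intro!: linI[OF vector_space_tscale] simp: lin_add[OF assms(1)] lin_scale[OF assms(1)]
    tmult_add_left tmult_add_right tmult_scale_left tmult_scale_right)

lemma lin_tcat:
  assumes "lin tscale h" "\<And>x. h x \<in> tpow n" "v \<in> tpow m" "0 < n"
  shows "lin tscale (\<lambda>x. tcat n m (h x) v)" "lin tscale (\<lambda>x. tcat m n v (h x))"
  using assms by (auto intro!: linI[OF vector_space_tscale] simp: lin_add[OF assms(1)] lin_scale[OF assms(1)]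
    tcat_add_left tcat_add_right tcat_scale_left tcat_scale_right)

lemma lin_tanti:
  assumes "lin scale f" "lin tscale h" "\<And>x. h x \<in> tpow n" "0 < n"
  shows "lin tscale (\<lambda>x. tanti n f (h x))"
  using assms by (auto intro!: linI[OF vector_space_tscale] simp: lin_add[OF assms(2)] lin_scale[OF assms(2)]
    tanti_add tanti_scale)

lemmas lin_intros = lin_id lin_mult_left lin_mult_right lin_tens1 lin_tens2 lin_tens3 lin_tmult

lemma tmult_tsum2:
  "u \<in> tpow 2 \<Longrightarrow> v \<in> tpow m \<Longrightarrow> (\<And>a b. F a b \<in> tpow m) \<Longrightarrow> tmult m (tsum2 F u) v
      = tsum2 (\<lambda>a b. tmult m (F a b) v) u"
  "u \<in> tpow 2 \<Longrightarrow> v \<in> tpow m \<Longrightarrow> (\<And>a b. F a b \<in> tpow m) \<Longrightarrow> tmult m v (tsum2 F u)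
      = tsum2 (\<lambda>a b. tmult m v (F a b)) u"
  by (simp_all add: tsum2_def tmult_tsum_left tmult_tsum_right)

lemma tmult_tsum3:
  "u \<in> tpow 3 \<Longrightarrow> v \<in> tpow m \<Longrightarrow> (\<And>a b c. F a b c \<in> tpow m) \<Longrightarrow> tmult m (tsum3 F u) v
      = tsum3 (\<lambda>a b c. tmult m (F a b c) v) u"
  "u \<in> tpow 3 \<Longrightarrow> v \<in> tpow m \<Longrightarrow> (\<And>a b c. F a b c \<in> tpow m) \<Longrightarrow> tmult m v (tsum3 F u)
      = tsum3 (\<lambda>a b c. tmult m v (F a b c)) u"
  by (simp_all add: tsum3_def tmult_tsum_left tmult_tsum_right)

subsection \<open>Evaluating multilinear maps on products\<close>

lemma tsum2_tmult:
  assumes "multilin2 sW f" "u \<in> tpow 2" "v \<in> tpow 2"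
  shows "tsum2 f (u \<cdot>\<^sub>2 v) = tsum2 (\<lambda>a b. tsum2 (\<lambda>c d. f (a * c) (b * d)) v) u"
  using tsum_tmult[OF multilin2_mlin[OF assms(1)] assms(2,3)] assms by (simp add: tsum_2)

lemma tsum3_tmult:
  assumes "multilin3 sW f" "u \<in> tpow 3" "v \<in> tpow 3"
  shows "tsum3 f (u \<cdot>\<^sub>3 v) = tsum3 (\<lambda>a b c. tsum3 (\<lambda>a' b' c'. f (a * a') (b * b') (c * c')) v) u"
  using tsum_tmult[OF multilin3_mlin[OF assms(1)] assms(2,3)] assms by (simp add: tsum_3)

lemma tsum4_tmult:
  assumes "multilin4 sW f" "u \<in> tpow 4" "v \<in> tpow 4"
  shows "tsum4 f (u \<cdot>\<^sub>4 v) = tsum4 (\<lambda>a b c d. tsum4 (\<lambda>a' b' c' d'. f (a * a') (b * b') (c * c') (d * d')) v) u"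
  using tsum_tmult[OF multilin4_mlin[OF assms(1)] assms(2,3)] assms by (simp add: tsum_4)

lemma tsum2_tanti:
  assumes "multilin2 sW f" "u \<in> tpow 2"
  shows "tsum2 f (tanti 2 h u) = tsum2 (\<lambda>a b. f (h b) (h a)) u"
  using tsum_tanti[OF multilin2_mlin[OF assms(1)] assms(2)] assms by (simp add: tsum_2)

lemma tsum3_tanti:
  assumes "multilin3 sW f" "u \<in> tpow 3"
  shows "tsum3 f (tanti 3 h u) = tsum3 (\<lambda>a b c. f (h c) (h b) (h a)) u"
  using tsum_tanti[OF multilin3_mlin[OF assms(1)] assms(2)] assms by (simp add: tsum_3)

lemma tsum3_comult:
  assumes "multilin3 sW f" "u \<in> tpow 2" "\<And>a. D a \<in> tpow 2"
  shows "tsum3 f (comult_at D 2 0 u) = tsum2 (\<lambda>a b. tsum2 (\<lambda>x y. f x y b) (D a)) u"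
    "tsum3 f (comult_at D 2 1 u) = tsum2 (\<lambda>a b. tsum2 (\<lambda>x y. f a x y) (D b)) u"
proof -
  have "mlin sW (Suc 2) (\<lambda>xs. f (xs ! 0) (xs ! 1) (xs ! 2))" using multilin3_mlin[OF assms(1)] by simp
  from tsum_comult_at[OF this assms(2,3), of 0] tsum_comult_at[OF this assms(2,3), of 1]
  show "tsum3 f (comult_at D 2 0 u) = tsum2 (\<lambda>a b. tsum2 (\<lambda>x y. f x y b) (D a)) u"
    "tsum3 f (comult_at D 2 1 u) = tsum2 (\<lambda>a b. tsum2 (\<lambda>x y. f a x y) (D b)) u"
    using assms by (simp_all add: tsum_2 tsum_3)
qed

lemma tsum4_comult:
  assumes "multilin4 sW f" "u \<in> tpow 3" "\<And>a. D a \<in> tpow 2"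
  shows "tsum4 f (comult_at D 3 0 u) = tsum3 (\<lambda>a b c. tsum2 (\<lambda>x y. f x y b c) (D a)) u"
    "tsum4 f (comult_at D 3 1 u) = tsum3 (\<lambda>a b c. tsum2 (\<lambda>x y. f a x y c) (D b)) u"
    "tsum4 f (comult_at D 3 2 u) = tsum3 (\<lambda>a b c. tsum2 (\<lambda>x y. f a b x y) (D c)) u"
proof -
  have "mlin sW (Suc 3) (\<lambda>xs. f (xs ! 0) (xs ! 1) (xs ! 2) (xs ! 3))" using multilin4_mlin[OF assms(1)]
    by simp
  from tsum_comult_at[OF this assms(2,3), of 0] tsum_comult_at[OF this assms(2,3), of 1]
    tsum_comult_at[OF this assms(2,3), of 2]
  show "tsum4 f (comult_at D 3 0 u) = tsum3 (\<lambda>a b c. tsum2 (\<lambda>x y. f x y b c) (D a)) u"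
    "tsum4 f (comult_at D 3 1 u) = tsum3 (\<lambda>a b c. tsum2 (\<lambda>x y. f a x y c) (D b)) u"
    "tsum4 f (comult_at D 3 2 u) = tsum3 (\<lambda>a b c. tsum2 (\<lambda>x y. f a b x y) (D c)) u"
    using assms by (simp_all add: tsum_2 tsum_3 tsum_4)
qed

lemma tsum_tcat_tens:
  assumes "mlin sW k f" "u \<in> tpow m" "k = m + length ys" "m > 0"
  shows "tsum k f (tcat m (length ys) u (tens ys)) = tsum m (\<lambda>xs. f (xs @ ys)) u"
    and "tsum k f (tcat (length ys) m (tens ys) u) = tsum m (\<lambda>xs. f (ys @ xs)) u"
proof -
  have W: "vector_space sW" using assms mlin_vector_space by auto
  have f: "mlin sW (m + length ys) f" using assms by simp
  show "tsum k f (tcat m (length ys) u (tens ys)) = tsum m (\<lambda>xs. f (xs @ ys)) u"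
    unfolding assms(3) tsum_tcat[OF f assms(2) tens_in[OF refl] assms(4)]
    by (intro tsum_cong assms tsum_tens[OF W] refl mlin_append_right[OF f])
  have f: "mlin sW (length ys + m) f" using assms by (simp add: add.commute)
  have "tcat (length ys) m (tens ys) u = tsum m (\<lambda>xs. tens (ys @ xs)) u"
    unfolding tcat_def using assms(2) by (simp add: mlin_tcat_left)
  moreover
  have "tens (ys @ xs) \<in> tpow k" "tsum k f (tens (ys @ xs)) = f (ys @ xs)" if "length xs = m" for xs
    using that tsum_tens[OF W assms(1)] by (simp_all add: assms(3))
  then have "tsum k f (tsum m (\<lambda>xs. tens (ys @ xs)) u) = tsum m (\<lambda>xs. f (ys @ xs)) u"
    by (simp add: tsum_tsum[OF assms(1) W assms(2)] assms(2) cong: tsum_cong)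
  ultimately show "tsum k f (tcat (length ys) m (tens ys) u) = tsum m (\<lambda>xs. f (ys @ xs)) u" by simp
qed

lemma tsum4_tcat:
  assumes "multilin4 sW f" "u \<in> tpow 3"
  shows "tsum4 f (tcat 3 1 u (tone 1)) = tsum3 (\<lambda>a b c. f a b c 1) u"
    "tsum4 f (tcat 1 3 (tone 1) u) = tsum3 (\<lambda>a b c. f 1 a b c) u"
  using tsum_tcat_tens[OF multilin4_mlin[OF assms(1)] assms(2), of "[1]"] assms
  by (simp_all add: tsum_4 tsum_3 tone_def One_nat_def)

lemma tsum3_tcat:
  assumes "multilin3 sW f" "u \<in> tpow 2"
  shows "tsum3 f (tcat 2 1 u (tens [z])) = tsum2 (\<lambda>a b. f a b z) u"
    "tsum3 f (tcat 1 2 (tens [z]) u) = tsum2 (\<lambda>a b. f z a b) u"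
  using tsum_tcat_tens[OF multilin3_mlin[OF assms(1)] assms(2), of "[z]"] assms
  by (simp_all add: tsum_2 tsum_3 One_nat_def)

lemma multilin4_shift:
  assumes "multilin4 sW f"
  shows "multilin4 sW (\<lambda>a b c d. f (x * a) (y * b) (z * c) (w * d))"
  by (intro multilin4I multilin4_lin[OF assms] lin_intros)

lemma multilin4_tsum4:
  assumes "multilin4 sW f" "v \<in> tpow 4"
  shows "multilin4 sW (\<lambda>a b c d. tsum4 (\<lambda>a' b' c' d'. f (a * a') (b * b') (c * c') (d * d')) v)"
  by (intro multilin4I lin_tsum4 multilin4_lin[OF assms(1)] lin_intros assms multilin4_space[OF assms(1)])

text \<open>
  The five kinds of factors that occur in the pentagon, each split off at the left of a product.
\<close>

lemma tsum4_comult_tmult: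
  assumes "multilin4 sW f" "u \<in> tpow 3" "\<And>a. D a \<in> tpow 2" "v \<in> tpow 4"
  shows "tsum4 f (comult_at D 3 0 u \<cdot>\<^sub>4 v) = tsum3 (\<lambda>a b c. tsum2 (\<lambda>x y. 
      tsum4 (\<lambda>a' b' c' d'. f (x * a') (y * b') (b * c') (c * d')) v) (D a)) u"
    "tsum4 f (comult_at D 3 1 u \<cdot>\<^sub>4 v) = tsum3 (\<lambda>a b c. tsum2 (\<lambda>x y. 
      tsum4 (\<lambda>a' b' c' d'. f (a * a') (x * b') (y * c') (c * d')) v) (D b)) u"
    "tsum4 f (comult_at D 3 2 u \<cdot>\<^sub>4 v) = tsum3 (\<lambda>a b c. tsum2 (\<lambda>x y. 
      tsum4 (\<lambda>a' b' c' d'. f (a * a') (b * b') (x * c') (y * d')) v) (D c)) u"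
  using assms by (simp_all add: tsum4_tmult[OF assms(1)] tsum4_comult[OF multilin4_tsum4[OF assms(1)]])

lemma tsum4_tcat_tmult:
  assumes "multilin4 sW f" "u \<in> tpow 3" "v \<in> tpow 4"
  shows "tsum4 f (tcat 3 1 u (tone 1) \<cdot>\<^sub>4 v) =
      tsum3 (\<lambda>a b c. tsum4 (\<lambda>a' b' c' d'. f (a * a') (b * b') (c * c') d') v) u"
    "tsum4 f (tcat 1 3 (tone 1) u \<cdot>\<^sub>4 v) =
      tsum3 (\<lambda>a b c. tsum4 (\<lambda>a' b' c' d'. f a' (a * b') (b * c') (c * d')) v) u"
  using assms by (simp_all add: tsum4_tmult[OF assms(1)] tsum4_tcat[OF multilin4_tsum4[OF assms(1)]])

lemma tsum2_counit_at:
  assumes "multilin2 sW f" "u \<in> tpow 3"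
  shows "tsum2 f (counit_at e 3 0 u) = tsum3 (\<lambda>a b c. sW (e a) (f b c)) u"
    "tsum2 f (counit_at e 3 1 u) = tsum3 (\<lambda>a b c. sW (e b) (f a c)) u"
    "tsum2 f (counit_at e 3 2 u) = tsum3 (\<lambda>a b c. sW (e c) (f a b)) u"
proof -
  have "mlin sW (3 - 1) (\<lambda>xs. f (xs ! 0) (xs ! 1))" using multilin2_mlin[OF assms(1)] by simp
  from tsum_counit_at[OF this assms(2), of 0] tsum_counit_at[OF this assms(2), of 1]
    tsum_counit_at[OF this assms(2), of 2]
  show "tsum2 f (counit_at e 3 0 u) = tsum3 (\<lambda>a b c. sW (e a) (f b c)) u"
    "tsum2 f (counit_at e 3 1 u) = tsum3 (\<lambda>a b c. sW (e b) (f a c)) u"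
    "tsum2 f (counit_at e 3 2 u) = tsum3 (\<lambda>a b c. sW (e c) (f a b)) u"
    using assms by (simp_all add: tsum_2 tsum_3)
qed


lemma tone_tens: "tone 1 = tens [1]" "tone 2 = tens [1, 1]" "tone 3 = tens [1, 1, 1]"
    "tone 4 = tens [1, 1, 1, 1]"
  by (simp_all add: tone_def eval_nat_numeral One_nat_def)

text \<open>
  What is left of a coassociator once a coproduct in one of its slots has been absorbed: the
  counit in that slot makes the coassociator trivial.
\<close>

lemma tsum4_counit:
  assumes f: "multilin4 sW f" "lin (*) e" and u: "u \<in> tpow 3" and v: "v \<in> tpow 4"
  shows "counit_at e 3 0 u = tone 2 \<Longrightarrow>
      tsum3 (\<lambda>a b c. tsum4 (\<lambda>a' b' c' d'. sW (e a) (f a' b' (b * c') (c * d'))) v) u = tsum4 f v" (is "PROP ?A")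
    "counit_at e 3 1 u = tone 2 \<Longrightarrow>
      tsum3 (\<lambda>a b c. tsum4 (\<lambda>a' b' c' d'. sW (e b) (f (a * a') b' c' (c * d'))) v) u = tsum4 f v" (is "PROP ?B")
    "counit_at e 3 2 u = tone 2 \<Longrightarrow>
      tsum3 (\<lambda>a b c. tsum4 (\<lambda>a' b' c' d'. sW (e c) (f (a * a') (b * b') c' d')) v) u = tsum4 f v" (is "PROP ?C")
    "counit_at e 3 0 u = tone 2 \<Longrightarrow>
      tsum4 (\<lambda>a' b' c' d'. tsum3 (\<lambda>a b c. sW (e a) (f a' b' (c' * b) (d' * c))) u) v = tsum4 f v" (is "PROP ?D")
    "counit_at e 3 1 u = tone 2 \<Longrightarrow>
      tsum4 (\<lambda>a' b' c' d'. tsum3 (\<lambda>a b c. sW (e b) (f (a' * a) b' c' (d' * c))) u) v = tsum4 f v" (is "PROP ?E")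
    "counit_at e 3 2 u = tone 2 \<Longrightarrow>
      tsum4 (\<lambda>a' b' c' d'. tsum3 (\<lambda>a b c. sW (e c) (f (a' * a) (b' * b) c' d')) u) v = tsum4 f v" (is "PROP ?F")
proof -
  have ev: "counit_at e 3 0 u = tone 2 \<Longrightarrow> tsum3 (\<lambda>a b c. sW (e a) (g b c)) u = g 1 1"
    "counit_at e 3 1 u = tone 2 \<Longrightarrow> tsum3 (\<lambda>a b c. sW (e b) (g a c)) u = g 1 1"
    "counit_at e 3 2 u = tone 2 \<Longrightarrow> tsum3 (\<lambda>a b c. sW (e c) (g a b)) u = g 1 1"
    if "multilin2 sW g" for g
    using tsum2_counit_at[OF that u, of e] by (simp_all add: tone_tens tsum2_pure[OF that])
  have m: "multilin2 sW (\<lambda>b c. f (x * b) y z (w * c))"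
    "multilin2 sW (\<lambda>b c. f x y (b * z) (c * w))" "multilin2 sW (\<lambda>b c. f (b * x) y z (c * w))"
    "multilin2 sW (\<lambda>b c. f (b * x) (c * y) z w)" "multilin2 sW (\<lambda>b c. f x y (z * b) (w * c))" 
    "multilin2 sW (\<lambda>b c. f (x * b) (y * c) z w)"
    for x y z w by (intro multilin2I multilin4_lin[OF f(1)] lin_id lin_mult_left lin_mult_right)+
  note evs = ev(1)[OF m(2)] ev(2)[OF m(3)] ev(3)[OF m(4)] ev(1)[OF m(5)] ev(2)[OF m(1)] ev(3)[OF m(6)]
  show "PROP ?A" "PROP ?B" "PROP ?C" "PROP ?D" "PROP ?E" "PROP ?F"
    by (simp_all only: tsum_swap_curried(5) evs mult_1_left mult_1_right)
qed

end

context quasi_bialgebra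
begin

abbreviation "\<Phi>i \<equiv> tinv 3 \<Phi>"

lemma coassoc_in [simp]: "\<Phi> \<in> tpow 3" "\<Phi>i \<in> tpow 3"
  using coassoc_invertible tinv(1) by (auto simp: tinvertible_def)

lemma coassoc_inv [simp]: "\<Phi> \<cdot>\<^sub>3 \<Phi>i = tone 3" "\<Phi>i \<cdot>\<^sub>3 \<Phi> = tone 3"
  using tinv[OF coassoc_invertible] by auto

declare comult_in [simp]

lemmas comult_hom = comult_linear comult_in comult_mult

text \<open>
  The axioms \<open>\<Sum> S(a\<^sub>1) \<alpha> a\<^sub>2 = \<epsilon>(a) \<alpha>\<close> and \<open>\<Sum> a\<^sub>1 \<beta> S(a\<^sub>2) = \<epsilon>(a) \<beta>\<close> say that the forms evaluated
  below turn a factor \<open>\<Delta>(h)\<close> in two adjacent slots into \<open>\<epsilon>(h)\<close>.  Such a form does not see a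
  coassociator whose slot has been comultiplied there, provided that it stands at the outer end of
  the product.  All simplifications of pentagon expressions rest on this.
\<close>

lemma absorb_left:
  assumes f: "multilin4 sW f" and u: "u \<in> tpow 3" and v: "v \<in> tpow 4"
  shows "(\<And>h a b c d. tsum2 (\<lambda>x y. f (x * a) (y * b) c d) (\<Delta> h) = sW (\<epsilon> h) (f a b c d)) \<Longrightarrow>
      counit_at \<epsilon> 3 0 u = tone 2 \<Longrightarrow> tsum4 f (comult_at \<Delta> 3 0 u \<cdot>\<^sub>4 v) = tsum4 f v"
    "(\<And>h a b c d. tsum2 (\<lambda>x y. f a (x * b) (y * c) d) (\<Delta> h) = sW (\<epsilon> h) (f a b c d)) \<Longrightarrow>
      counit_at \<epsilon> 3 1 u = tone 2 \<Longrightarrow> tsum4 f (comult_at \<Delta> 3 1 u \<cdot>\<^sub>4 v) = tsum4 f v"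
    "(\<And>h a b c d. tsum2 (\<lambda>x y. f a b (x * c) (y * d)) (\<Delta> h) = sW (\<epsilon> h) (f a b c d)) \<Longrightarrow>
      counit_at \<epsilon> 3 2 u = tone 2 \<Longrightarrow> tsum4 f (comult_at \<Delta> 3 2 u \<cdot>\<^sub>4 v) = tsum4 f v"
  by (simp_all add: tsum4_comult_tmult[OF f u _ v] tsum_swap_curried(3) tsum4_counit[OF f counit_linear u v])

lemma absorb_right:
  assumes f: "multilin4 sW f" and u: "u \<in> tpow 3" and v: "v \<in> tpow 4"
  shows "(\<And>h a b c d. tsum2 (\<lambda>x y. f (a * x) (b * y) c d) (\<Delta> h) = sW (\<epsilon> h) (f a b c d)) \<Longrightarrow>
      counit_at \<epsilon> 3 0 u = tone 2 \<Longrightarrow> tsum4 f (v \<cdot>\<^sub>4 comult_at \<Delta> 3 0 u) = tsum4 f v"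
    "(\<And>h a b c d. tsum2 (\<lambda>x y. f a (b * x) (c * y) d) (\<Delta> h) = sW (\<epsilon> h) (f a b c d)) \<Longrightarrow>
      counit_at \<epsilon> 3 1 u = tone 2 \<Longrightarrow> tsum4 f (v \<cdot>\<^sub>4 comult_at \<Delta> 3 1 u) = tsum4 f v"
    "(\<And>h a b c d. tsum2 (\<lambda>x y. f a b (c * x) (d * y)) (\<Delta> h) = sW (\<epsilon> h) (f a b c d)) \<Longrightarrow>
      counit_at \<epsilon> 3 2 u = tone 2 \<Longrightarrow> tsum4 f (v \<cdot>\<^sub>4 comult_at \<Delta> 3 2 u) = tsum4 f v"
  by (simp_all add: tsum4_tmult[OF f v] tsum4_comult[OF multilin4_shift[OF f] u] u tsum4_counit[OF f
      counit_linear u v])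

end

section \<open>The pentagon and the counit\<close>

lemma drop_one [simp]: "drop 1 (x # xs) = xs"
  by (simp add: One_nat_def)

context k_algebra
begin

lemma tscale_zero_right: "tscale c (0 :: ('k, 'h) tensor) = 0"
  and tscale_add: "tscale c ((u :: ('k, 'h) tensor) + v) = tscale c u + tscale c v"
  and tscale_one [simp]: "tscale 1 (u :: ('k, 'h) tensor) = u"
  and tscale_tscale: "tscale c (tscale d (u :: ('k, 'h) tensor)) = tscale (c * d) u"
proof -
  interpret T: vector_space "tscale :: 'k \<Rightarrow> ('k, 'h) tensor \<Rightarrow> _" by (rule vector_space_tscale)
  show "tscale c (0 :: ('k, 'h) tensor) = 0" "tscale c (u + v) = tscale c u + tscale c v"
    "tscale 1 u = u" "tscale c (tscale d u) = tscale (c * d) u"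
    by (simp_all add: T.scale_right_distrib)
qed

end

context quasi_bialgebra
begin

declare counit_one [simp]

lemma tsum2_counit:
  assumes h: "lin sW h"
  shows "tsum2 (\<lambda>x y. sW (\<epsilon> x) (h y)) (\<Delta> a) = h a"
    and "tsum2 (\<lambda>x y. sW (\<epsilon> y) (h x)) (\<Delta> a) = h a"
proof -
  note W = lin_vector_space[OF h]
  have m: "mlin sW 1 (\<lambda>xs. h (xs ! 0))" by (rule mlinI) (simp add: h)
  have m': "mlin sW (2 - 1) (\<lambda>xs. h (xs ! 0))" using m by (simp add: One_nat_def)
  show "tsum2 (\<lambda>x y. sW (\<epsilon> x) (h y)) (\<Delta> a) = h a"
    using tsum_counit_at[OF m', of "\<Delta> a" 0 \<epsilon>] counit_left[of a] tsum_tens[OF W m, of "[a]"]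
      by (simp add: tsum_2 One_nat_def)
  show "tsum2 (\<lambda>x y. sW (\<epsilon> y) (h x)) (\<Delta> a) = h a"
    using tsum_counit_at[OF m', of "\<Delta> a" 1 \<epsilon>] counit_right[of a] tsum_tens[OF W m, of "[a]"]
      by (simp add: tsum_2 One_nat_def)
qed

lemma lin_counit: "lin scale h \<Longrightarrow> lin (*) (\<lambda>x. \<epsilon> (h x))"
  by (rule lin_compose[OF counit_linear])

lemma counit_at_mult:
  assumes "u \<in> tpow n" "v \<in> tpow n" "i < n" "n > 1" "m = n - 1"
  shows "counit_at \<epsilon> n i (tmult n u v) = tmult m (counit_at \<epsilon> n i u) (counit_at \<epsilon> n i v)"
  unfolding assms(5) using assms(1)
proof (induction u rule: tpow_induct)
  case (tens xs)
  show ?case using assms(2)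
  proof (induction v rule: tpow_induct)
    case (tens ys)
    have "take i (map2 (*) xs ys) @ drop (Suc i) (map2 (*) xs ys) =
      map2 (*) (take i xs @ drop (Suc i) xs) (take i ys @ drop (Suc i) ys)"
      using \<open>length xs = n\<close> \<open>length ys = n\<close> assms(3) by (simp add: take_map drop_map take_zip drop_zip)
    then show ?case using \<open>length xs = n\<close> \<open>length ys = n\<close> assms(3,4)
      by (simp add: counit_at_tens counit_linear counit_mult tmult_scale_left tmult_scale_right tscale_tscale
          mult.commute)
  qed (use assms(3,4) in \<open>simp_all add: tens counit_at_add counit_at_zero counit_linear tmult_add_right
      tmult_zero_right\<close>)
qed (use assms(2-4) in \<open>simp_all add: counit_at_add counit_at_zero counit_linear tmult_add_left
    tmult_zero_left\<close>)

lemma counit_at_eval: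
  "u \<in> tpow 3 \<Longrightarrow> counit_at \<epsilon> 3 0 u = tsum3 (\<lambda>a b c. tscale (\<epsilon> a) (tens [b, c])) u"
  "u \<in> tpow 3 \<Longrightarrow> counit_at \<epsilon> 3 1 u = tsum3 (\<lambda>a b c. tscale (\<epsilon> b) (tens [a, c])) u"
  "u \<in> tpow 3 \<Longrightarrow> counit_at \<epsilon> 3 2 u = tsum3 (\<lambda>a b c. tscale (\<epsilon> c) (tens [a, b])) u"
  "v \<in> tpow 4 \<Longrightarrow> counit_at \<epsilon> 4 1 v = tsum4 (\<lambda>a b c d. tscale (\<epsilon> b) (tens [a, c, d])) v"
  "v \<in> tpow 4 \<Longrightarrow> counit_at \<epsilon> 4 2 v = tsum4 (\<lambda>a b c d. tscale (\<epsilon> c) (tens [a, b, d])) v"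
  by (simp_all add: counit_at_def tsum_3 tsum_4)

lemma ml_counit:
  "multilin4 tscale (\<lambda>a b c d. tscale (\<epsilon> b) (tens [a, c, d]))"
  "multilin4 tscale (\<lambda>a b c d. tscale (\<epsilon> c) (tens [a, b, d]))"
  by (intro multilin4I lin_scalar lin_counit lin_scale_value lin_intros vector_space_tscale)+

lemma ml_pad:
  "multilin2 tscale (\<lambda>a b. tens [1, a, b])" "multilin2 tscale (\<lambda>a b. tens [a, b, 1])"
  "multilin2 tscale (\<lambda>a c. tens [a, 1, c])"
  by (intro multilin2I lin_intros)+

lemma counit_of_comult:
  assumes u: "u \<in> tpow 3"
  shows "counit_at \<epsilon> 4 1 (comult_at \<Delta> 3 0 u) = u" "counit_at \<epsilon> 4 1 (comult_at \<Delta> 3 1 u) = u"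
    "counit_at \<epsilon> 4 2 (comult_at \<Delta> 3 1 u) = u" "counit_at \<epsilon> 4 2 (comult_at \<Delta> 3 2 u) = u"
  using u by (simp_all add: counit_at_eval tsum4_comult[where sW=tscale] ml_counit
    tsum2_counit[where sW=tscale] lin_tens3 lin_id)


abbreviation padr where "padr u \<equiv> tcat 3 1 u (tone 1)"
abbreviation padl where "padl u \<equiv> tcat 1 3 (tone 1) u"
abbreviation "\<Delta>0 \<equiv> comult_at \<Delta> 3 0"
abbreviation "\<Delta>1 \<equiv> comult_at \<Delta> 3 1"
abbreviation "\<Delta>2 \<equiv> comult_at \<Delta> 3 2"

lemma pentagon_factors_in [simp]: "u \<in> tpow 3 \<Longrightarrow> padr u \<in> tpow 4" "u \<in> tpow 3 \<Longrightarrow> padl u \<in> tpow 4"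
  "u \<in> tpow 3 \<Longrightarrow> \<Delta>0 u \<in> tpow 4" "u \<in> tpow 3 \<Longrightarrow> \<Delta>1 u \<in> tpow 4" "u \<in> tpow 3 \<Longrightarrow> \<Delta>2 u \<in> tpow 4"
  by simp_all

lemma pentagon_factors_mult:
  assumes "u \<in> tpow 3" "v \<in> tpow 3"
  shows "padr (u \<cdot>\<^sub>3 v) = padr u \<cdot>\<^sub>4 padr v" "padl (u \<cdot>\<^sub>3 v) = padl u \<cdot>\<^sub>4 padl v"
    "\<Delta>0 (u \<cdot>\<^sub>3 v) = \<Delta>0 u \<cdot>\<^sub>4 \<Delta>0 v" "\<Delta>1 (u \<cdot>\<^sub>3 v) = \<Delta>1 u \<cdot>\<^sub>4 \<Delta>1 v" "\<Delta>2 (u \<cdot>\<^sub>3 v) = \<Delta>2 u \<cdot>\<^sub>4 \<Delta>2 v"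
  using assms by (simp_all add: comult_at_mult[OF comult_hom] tcat_mult)

lemma pentagon_factors_one: "padr (tone 3) = tone 4" "padl (tone 3) = tone 4"
  "\<Delta>0 (tone 3) = tone 4" "\<Delta>1 (tone 3) = tone 4" "\<Delta>2 (tone 3) = tone 4"
  by (simp_all add: comult_at_tone[OF comult_linear comult_in comult_one])

lemma counit_of_pentagon_factors:
  assumes u: "u \<in> tpow 3"
  shows "counit_at \<epsilon> 4 1 (padr u) = tsum2 (\<lambda>a c. tens [a, c, 1]) (counit_at \<epsilon> 3 1 u)"
    "counit_at \<epsilon> 4 1 (padl u) = tsum2 (\<lambda>b c. tens [1, b, c]) (counit_at \<epsilon> 3 0 u)"
    "counit_at \<epsilon> 4 2 (padr u) = tsum2 (\<lambda>a b. tens [a, b, 1]) (counit_at \<epsilon> 3 2 u)"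
    "counit_at \<epsilon> 4 2 (padl u) = tsum2 (\<lambda>a c. tens [1, a, c]) (counit_at \<epsilon> 3 1 u)"
    "counit_at \<epsilon> 3 1 u = tone 2 \<Longrightarrow> counit_at \<epsilon> 4 1 (\<Delta>2 u) = tone 3"
    "counit_at \<epsilon> 3 1 u = tone 2 \<Longrightarrow> counit_at \<epsilon> 4 2 (\<Delta>0 u) = tone 3"
proof -
  have m: "multilin2 tscale (\<lambda>a c. tsum2 (\<lambda>x y. tens [a, x, y]) (\<Delta> c))"
    "multilin2 tscale (\<lambda>a c. tsum2 (\<lambda>x y. tens [x, y, c]) (\<Delta> a))"
    unfolding tsum2_def by (rule multilin2I; 
      auto intro!: lin_tsum lin_tsum_arg comult_linear lin_intros vector_space_tscale
          multilin2_mlin[of _ "\<lambda>x y. tens [_, x, y]", simplified]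
          multilin2_mlin[of _ "\<lambda>x y. tens [x, y, _]", simplified]
          multilin2I)+
  have p: "tsum2 (\<lambda>x y. tscale c (F x y)) v = tscale c (tsum2 F v)"
      for c v and F :: "'h \<Rightarrow> 'h \<Rightarrow> ('k, 'h) tensor"
    using tsum2_additive[of "tscale c" F v] by (simp add: tscale_add tscale_zero_right)
  show "counit_at \<epsilon> 3 1 u = tone 2 \<Longrightarrow> counit_at \<epsilon> 4 1 (\<Delta>2 u) = tone 3"
    "counit_at \<epsilon> 3 1 u = tone 2 \<Longrightarrow> counit_at \<epsilon> 4 2 (\<Delta>0 u) = tone 3"
    using u tsum2_counit_at(2)[OF m(1) u, of \<epsilon>] tsum2_counit_at(2)[OF m(2) u, of \<epsilon>]
    by (simp_all add: counit_at_eval tsum4_comult[where sW=tscale] ml_counit p tone_tens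
      m[THEN tsum2_pure] comult_one[unfolded tone_tens] ml_pad[THEN tsum2_pure])
qed (use u in \<open>simp_all add: counit_at_eval(4,5) tsum4_tcat[where sW=tscale] ml_counit
    tsum2_counit_at[where sW=tscale] ml_pad\<close>)

lemma pentagon_right_assoc: "\<Delta>0 \<Phi> \<cdot>\<^sub>4 \<Delta>2 \<Phi> = padr \<Phi> \<cdot>\<^sub>4 (\<Delta>1 \<Phi> \<cdot>\<^sub>4 padl \<Phi>)"
  using pentagon by (simp add: tmult_assoc)

text \<open>
  Apply the counit to the second factor of the pentagon.  Every term but \<open>(\<Delta> \<otimes> 1 \<otimes> 1)\<Phi>\<close>,
  \<open>(1 \<otimes> \<Delta> \<otimes> 1)\<Phi>\<close> and \<open>1 \<otimes> \<Phi>\<close> becomes trivial, which leaves \<open>\<Phi> = \<Phi> (1 \<otimes> (\<epsilon> \<otimes> 1 \<otimes> 1)\<Phi>)\<close>; cancel \<open>\<Phi>\<close>.  The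
  third factor gives the other equation.
\<close>

lemma counit_outer: "counit_at \<epsilon> 3 0 \<Phi> = tone 2" "counit_at \<epsilon> 3 2 \<Phi> = tone 2"
proof -
  \<comment> \<open>The map \<open>u \<mapsto> 1 \<otimes> u\<close> is injective, since the counit of the first factor undoes it.\<close>
  have l: "u = tone 2" if "u \<in> tpow 2" "tsum2 (\<lambda>b c. tens [1, b, c]) u = tone 3" for u
  proof -
    have m: "multilin3 tscale (\<lambda>a b c. tscale (\<epsilon> a) (tens [b, c]))"
      by (intro multilin3I lin_scalar lin_counit lin_scale_value lin_intros vector_space_tscale)
    have "tcat 1 2 (tens [1]) u = tsum2 (\<lambda>b c. tens [1, b, c]) u"
      using tsum3_tcat(2)[of tscale "\<lambda>a b c. tens [a, b, c]" u 1] that(1)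
        by (simp add: multilin3I lin_tens3 lin_id)
    then have "tsum3 (\<lambda>a b c. tscale (\<epsilon> a) (tens [b, c])) (tcat 1 2 (tens [1]) u) = tone 2"
      using that(2) m by (simp add: tone_tens, simp)
    then show ?thesis using that(1) m by (simp add: tsum3_tcat counit_one)
  qed
  have r: "u = tone 2" if "u \<in> tpow 2" "tsum2 (\<lambda>b c. tens [b, c, 1]) u = tone 3" for u
  proof -
    have m: "multilin3 tscale (\<lambda>a b c. tscale (\<epsilon> c) (tens [a, b]))"
      by (intro multilin3I lin_scalar lin_counit lin_scale_value lin_intros vector_space_tscale)
    have "tcat 2 1 u (tens [1]) = tsum2 (\<lambda>b c. tens [b, c, 1]) u"
      using tsum3_tcat(1)[of tscale "\<lambda>a b c. tens [a, b, c]" u 1] that(1)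
        by (simp add: multilin3I lin_tens3 lin_id)
    then have "tsum3 (\<lambda>a b c. tscale (\<epsilon> c) (tens [a, b])) (tcat 2 1 u (tens [1])) = tone 2"
      using that(2) m by (simp add: tone_tens, simp)
    then show ?thesis using that(1) m by (simp add: tsum3_tcat counit_one)
  qed
  have t: "tsum2 (\<lambda>a c. tens [a, c, 1]) (tone 2) = tone 3" "tsum2 (\<lambda>a c. tens [1, a, c]) (tone 2) = tone 3"
    by (simp_all add: tone_tens tsum2_pure[OF ml_pad(1)] tsum2_pure[OF ml_pad(2)])
  let ?l = "tsum2 (\<lambda>b c. tens [1, b, c]) (counit_at \<epsilon> 3 0 \<Phi>)"
  let ?r = "tsum2 (\<lambda>b c. tens [b, c, 1]) (counit_at \<epsilon> 3 2 \<Phi>)"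
  have in3: "?l \<in> tpow 3" "?r \<in> tpow 3" by (auto intro!: tsum2_in)
  have "\<Phi> = \<Phi> \<cdot>\<^sub>3 ?l" using arg_cong[OF pentagon_right_assoc, of "counit_at \<epsilon> 4 1"] in3
    by (simp add: counit_at_mult counit_of_comult counit_of_pentagon_factors counit_coassoc t)
  then have "\<Phi>i \<cdot>\<^sub>3 \<Phi> = \<Phi>i \<cdot>\<^sub>3 (\<Phi> \<cdot>\<^sub>3 ?l)" by simp
  then have "?l = tone 3" using in3 by (simp flip: tmult_assoc)
  then show "counit_at \<epsilon> 3 0 \<Phi> = tone 2" by (intro l) auto
  have "\<Phi> = ?r \<cdot>\<^sub>3 \<Phi>" using arg_cong[OF pentagon_right_assoc, of "counit_at \<epsilon> 4 2"] in3
    by (simp add: counit_at_mult counit_of_comult counit_of_pentagon_factors counit_coassoc t)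
  then have "\<Phi> \<cdot>\<^sub>3 \<Phi>i = (?r \<cdot>\<^sub>3 \<Phi>) \<cdot>\<^sub>3 \<Phi>i" by simp
  then have "?r = tone 3" using in3 by (simp add: tmult_assoc)
  then show "counit_at \<epsilon> 3 2 \<Phi> = tone 2" by (intro r) auto
qed

lemma counit_coassoc_all [simp]:
  "counit_at \<epsilon> 3 0 \<Phi> = tone 2" "counit_at \<epsilon> 3 1 \<Phi> = tone 2" "counit_at \<epsilon> 3 2 \<Phi> = tone 2"
  by (simp_all add: counit_outer counit_coassoc)

lemma counit_coassoc_inv [simp]:
  "counit_at \<epsilon> 3 0 \<Phi>i = tone 2" "counit_at \<epsilon> 3 1 \<Phi>i = tone 2" "counit_at \<epsilon> 3 2 \<Phi>i = tone 2"
proof -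
  have "counit_at \<epsilon> 3 i (tone 3) = tone 2" if "i < 3" for i
    using that by (auto simp: tone_tens counit_at_tens[OF counit_linear] less_3)
  then have "counit_at \<epsilon> 3 i (\<Phi> \<cdot>\<^sub>3 \<Phi>i) = tone 2" if "i < 3" for i using that by simp
  from this[of 0] this[of 1] this[of 2] 
  show "counit_at \<epsilon> 3 0 \<Phi>i = tone 2" "counit_at \<epsilon> 3 1 \<Phi>i = tone 2" "counit_at \<epsilon> 3 2 \<Phi>i = tone 2"
    by (simp_all add: counit_at_mult del: coassoc_inv)
qed

lemma pentagon_factors_inv:
  "padr \<Phi> \<cdot>\<^sub>4 padr \<Phi>i = tone 4" "padr \<Phi>i \<cdot>\<^sub>4 padr \<Phi> = tone 4"
  "padl \<Phi> \<cdot>\<^sub>4 padl \<Phi>i = tone 4" "padl \<Phi>i \<cdot>\<^sub>4 padl \<Phi> = tone 4"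
  "\<Delta>0 \<Phi> \<cdot>\<^sub>4 \<Delta>0 \<Phi>i = tone 4" "\<Delta>0 \<Phi>i \<cdot>\<^sub>4 \<Delta>0 \<Phi> = tone 4"
  "\<Delta>1 \<Phi> \<cdot>\<^sub>4 \<Delta>1 \<Phi>i = tone 4" "\<Delta>1 \<Phi>i \<cdot>\<^sub>4 \<Delta>1 \<Phi> = tone 4"
  "\<Delta>2 \<Phi> \<cdot>\<^sub>4 \<Delta>2 \<Phi>i = tone 4" "\<Delta>2 \<Phi>i \<cdot>\<^sub>4 \<Delta>2 \<Phi> = tone 4"
  by (simp_all only: pentagon_factors_mult[symmetric] coassoc_in coassoc_inv pentagon_factors_one)

lemma pentagon_factors_cancel:
  assumes "x \<in> tpow 4"
  shows "padr \<Phi> \<cdot>\<^sub>4 (padr \<Phi>i \<cdot>\<^sub>4 x) = x" "padr \<Phi>i \<cdot>\<^sub>4 (padr \<Phi> \<cdot>\<^sub>4 x) = x"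
  "padl \<Phi> \<cdot>\<^sub>4 (padl \<Phi>i \<cdot>\<^sub>4 x) = x" "padl \<Phi>i \<cdot>\<^sub>4 (padl \<Phi> \<cdot>\<^sub>4 x) = x"
  "\<Delta>0 \<Phi> \<cdot>\<^sub>4 (\<Delta>0 \<Phi>i \<cdot>\<^sub>4 x) = x" "\<Delta>0 \<Phi>i \<cdot>\<^sub>4 (\<Delta>0 \<Phi> \<cdot>\<^sub>4 x) = x"
  "\<Delta>1 \<Phi> \<cdot>\<^sub>4 (\<Delta>1 \<Phi>i \<cdot>\<^sub>4 x) = x" "\<Delta>1 \<Phi>i \<cdot>\<^sub>4 (\<Delta>1 \<Phi> \<cdot>\<^sub>4 x) = x"
  "\<Delta>2 \<Phi> \<cdot>\<^sub>4 (\<Delta>2 \<Phi>i \<cdot>\<^sub>4 x) = x" "\<Delta>2 \<Phi>i \<cdot>\<^sub>4 (\<Delta>2 \<Phi> \<cdot>\<^sub>4 x) = x"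
  using assms by (simp_all add: pentagon_factors_inv flip: tmult_assoc)

lemma pentagon_inv: "\<Delta>2 \<Phi>i \<cdot>\<^sub>4 \<Delta>0 \<Phi>i = padl \<Phi>i \<cdot>\<^sub>4 (\<Delta>1 \<Phi>i \<cdot>\<^sub>4 padr \<Phi>i)"
proof -
  have "(padl \<Phi>i \<cdot>\<^sub>4 (\<Delta>1 \<Phi>i \<cdot>\<^sub>4 padr \<Phi>i)) \<cdot>\<^sub>4 (\<Delta>0 \<Phi> \<cdot>\<^sub>4 \<Delta>2 \<Phi>) \<cdot>\<^sub>4 (\<Delta>2 \<Phi>i \<cdot>\<^sub>4 \<Delta>0 \<Phi>i)
    = (padl \<Phi>i \<cdot>\<^sub>4 (\<Delta>1 \<Phi>i \<cdot>\<^sub>4 padr \<Phi>i)) \<cdot>\<^sub>4 (padr \<Phi> \<cdot>\<^sub>4 (\<Delta>1 \<Phi> \<cdot>\<^sub>4 padl \<Phi>)) \<cdot>\<^sub>4 (\<Delta>2 \<Phi>i \<cdot>\<^sub>4 \<Delta>0 \<Phi>i)"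
    by (simp only: pentagon_right_assoc)
  then show ?thesis by (simp add: tmult_assoc pentagon_factors_cancel pentagon_factors_inv)
qed

text \<open>
  Solving the pentagon for different factors.  Which form is needed is dictated by the evaluation:
  the factors that can be absorbed must stand at the ends.
\<close>

lemma pentagon_variants:
  "padr \<Phi>i \<cdot>\<^sub>4 \<Delta>0 \<Phi> = \<Delta>1 \<Phi> \<cdot>\<^sub>4 (padl \<Phi> \<cdot>\<^sub>4 \<Delta>2 \<Phi>i)"
  "padl \<Phi> \<cdot>\<^sub>4 \<Delta>2 \<Phi>i = \<Delta>1 \<Phi>i \<cdot>\<^sub>4 (padr \<Phi>i \<cdot>\<^sub>4 \<Delta>0 \<Phi>)"
  "\<Delta>0 \<Phi>i \<cdot>\<^sub>4 padr \<Phi> = \<Delta>2 \<Phi> \<cdot>\<^sub>4 (padl \<Phi>i \<cdot>\<^sub>4 \<Delta>1 \<Phi>i)"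
  "\<Delta>2 \<Phi> \<cdot>\<^sub>4 padl \<Phi>i = \<Delta>0 \<Phi>i \<cdot>\<^sub>4 (padr \<Phi> \<cdot>\<^sub>4 \<Delta>1 \<Phi>)"
  "padr \<Phi> = \<Delta>0 \<Phi> \<cdot>\<^sub>4 (\<Delta>2 \<Phi> \<cdot>\<^sub>4 (padl \<Phi>i \<cdot>\<^sub>4 \<Delta>1 \<Phi>i))"
  "padl \<Phi> = \<Delta>1 \<Phi>i \<cdot>\<^sub>4 (padr \<Phi>i \<cdot>\<^sub>4 (\<Delta>0 \<Phi> \<cdot>\<^sub>4 \<Delta>2 \<Phi>))"
  "\<Delta>1 \<Phi> \<cdot>\<^sub>4 padl \<Phi> = padr \<Phi>i \<cdot>\<^sub>4 (\<Delta>0 \<Phi> \<cdot>\<^sub>4 \<Delta>2 \<Phi>)"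
  "padl \<Phi>i \<cdot>\<^sub>4 \<Delta>1 \<Phi>i = \<Delta>2 \<Phi>i \<cdot>\<^sub>4 (\<Delta>0 \<Phi>i \<cdot>\<^sub>4 padr \<Phi>)"
proof -
  have *: "\<Delta>0 \<Phi> = padr \<Phi> \<cdot>\<^sub>4 (\<Delta>1 \<Phi> \<cdot>\<^sub>4 (padl \<Phi> \<cdot>\<^sub>4 \<Delta>2 \<Phi>i))"
    using arg_cong[OF pentagon_right_assoc, of "\<lambda>x. x \<cdot>\<^sub>4 \<Delta>2 \<Phi>i"]
      by (simp add: tmult_assoc pentagon_factors_cancel pentagon_factors_inv)
  have **: "\<Delta>0 \<Phi>i = \<Delta>2 \<Phi> \<cdot>\<^sub>4 (padl \<Phi>i \<cdot>\<^sub>4 (\<Delta>1 \<Phi>i \<cdot>\<^sub>4 padr \<Phi>i))"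
    using arg_cong[OF pentagon_inv, of "\<lambda>x. \<Delta>2 \<Phi> \<cdot>\<^sub>4 x"]
      by (simp add: tmult_assoc pentagon_factors_cancel pentagon_factors_inv)
  show "padr \<Phi>i \<cdot>\<^sub>4 \<Delta>0 \<Phi> = \<Delta>1 \<Phi> \<cdot>\<^sub>4 (padl \<Phi> \<cdot>\<^sub>4 \<Delta>2 \<Phi>i)"
    "padl \<Phi> \<cdot>\<^sub>4 \<Delta>2 \<Phi>i = \<Delta>1 \<Phi>i \<cdot>\<^sub>4 (padr \<Phi>i \<cdot>\<^sub>4 \<Delta>0 \<Phi>)"
    "\<Delta>0 \<Phi>i \<cdot>\<^sub>4 padr \<Phi> = \<Delta>2 \<Phi> \<cdot>\<^sub>4 (padl \<Phi>i \<cdot>\<^sub>4 \<Delta>1 \<Phi>i)"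
    "\<Delta>2 \<Phi> \<cdot>\<^sub>4 padl \<Phi>i = \<Delta>0 \<Phi>i \<cdot>\<^sub>4 (padr \<Phi> \<cdot>\<^sub>4 \<Delta>1 \<Phi>)"
    "padr \<Phi> = \<Delta>0 \<Phi> \<cdot>\<^sub>4 (\<Delta>2 \<Phi> \<cdot>\<^sub>4 (padl \<Phi>i \<cdot>\<^sub>4 \<Delta>1 \<Phi>i))"
    "padl \<Phi> = \<Delta>1 \<Phi>i \<cdot>\<^sub>4 (padr \<Phi>i \<cdot>\<^sub>4 (\<Delta>0 \<Phi> \<cdot>\<^sub>4 \<Delta>2 \<Phi>))"
    "\<Delta>1 \<Phi> \<cdot>\<^sub>4 padl \<Phi> = padr \<Phi>i \<cdot>\<^sub>4 (\<Delta>0 \<Phi> \<cdot>\<^sub>4 \<Delta>2 \<Phi>)"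
    "padl \<Phi>i \<cdot>\<^sub>4 \<Delta>1 \<Phi>i = \<Delta>2 \<Phi>i \<cdot>\<^sub>4 (\<Delta>0 \<Phi>i \<cdot>\<^sub>4 padr \<Phi>)"
    by (simp_all add: * ** tmult_assoc pentagon_factors_cancel pentagon_factors_inv)
qed

end

section \<open>Four elements that move one leg of a coproduct\<close>

context k_algebra
begin

lemma tmult2_expand:
  "u \<in> tpow 2 \<Longrightarrow> v \<in> tpow 2 \<Longrightarrow> u \<cdot>\<^sub>2 v = tsum2 (\<lambda>a b. u \<cdot>\<^sub>2 tens [a, b]) v"
  "u \<in> tpow 2 \<Longrightarrow> v \<in> tpow 2 \<Longrightarrow> u \<cdot>\<^sub>2 v = tsum2 (\<lambda>a b. tens [a, b] \<cdot>\<^sub>2 v) u"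
  using tmult_tsum2(2)[where F = "\<lambda>a b. tens [a, b]" and u = v and v = u and m = 2]
    tmult_tsum2(1)[where F = "\<lambda>a b. tens [a, b]" and u = u and v = v and m = 2] by simp_all

lemma tmult2_tens [simp]: "tens [a, b] \<cdot>\<^sub>2 tens [c, d] = tens [a * c, b * d]"
  by simp

lemma tmult2_tens' [simp]: "w \<in> tpow 2 \<Longrightarrow> tens [a, b] \<cdot>\<^sub>2 (tens [c, d] \<cdot>\<^sub>2 w) = tens [a * c, b * d] \<cdot>\<^sub>2 w"
  by (simp flip: tmult_assoc)

lemma tsum2_sandwich:
  assumes "A \<in> tpow m" "B \<in> tpow m" "u \<in> tpow 2" "\<And>c d. G c d \<in> tpow m"
  shows "tsum2 (\<lambda>c d. tmult m A (tmult m (G c d) B)) u = tmult m A (tmult m (tsum2 G u) B)"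
  using assms by (simp add: tmult_tsum2)

lemmas tsum_in_simps = tsum2_in tsum3_in tsum4_in

end

context quasi_bialgebra
begin

lemma coassoc_comult: "\<Phi> \<cdot>\<^sub>3 comult_at \<Delta> 2 1 (\<Delta> a) = comult_at \<Delta> 2 0 (\<Delta> a) \<cdot>\<^sub>3 \<Phi>"
  and coassoc_inv_comult: "\<Phi>i \<cdot>\<^sub>3 comult_at \<Delta> 2 0 (\<Delta> a) = comult_at \<Delta> 2 1 (\<Delta> a) \<cdot>\<^sub>3 \<Phi>i"
proof -
  have "\<Phi> \<cdot>\<^sub>3 (\<Phi>i \<cdot>\<^sub>3 x) = x" if "x \<in> tpow 3" for x using that by (simp flip: tmult_assoc)
  then show "\<Phi> \<cdot>\<^sub>3 comult_at \<Delta> 2 1 (\<Delta> a) = comult_at \<Delta> 2 0 (\<Delta> a) \<cdot>\<^sub>3 \<Phi>"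
    "\<Phi>i \<cdot>\<^sub>3 comult_at \<Delta> 2 0 (\<Delta> a) = comult_at \<Delta> 2 1 (\<Delta> a) \<cdot>\<^sub>3 \<Phi>i"
    by (simp_all add: quasi_coassoc tmult_assoc)
qed

lemma coassoc_eval:
  assumes f: "multilin3 sW f"
  shows "tsum3 (\<lambda>X Y Z. tsum2 (\<lambda>a b. tsum2 (\<lambda>c d. f (X * a) (Y * c) (Z * d)) (\<Delta> b)) (\<Delta> h)) \<Phi> =
      tsum2 (\<lambda>a b. tsum2 (\<lambda>c d. tsum3 (\<lambda>X Y Z. f (c * X) (d * Y) (b * Z)) \<Phi>) (\<Delta> a)) (\<Delta> h)"
    and "tsum3 (\<lambda>X Y Z. tsum2 (\<lambda>a b. tsum2 (\<lambda>c d. f (X * c) (Y * d) (Z * b)) (\<Delta> a)) (\<Delta> h)) \<Phi>i =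
      tsum2 (\<lambda>a b. tsum2 (\<lambda>c d. tsum3 (\<lambda>X Y Z. f (a * X) (c * Y) (d * Z)) \<Phi>i) (\<Delta> b)) (\<Delta> h)"
proof -
  have m: "multilin3 sW (\<lambda>a b c. f (x * a) (y * b) (z * c))" for x y z
    by (intro multilin3I multilin3_lin[OF f] lin_intros)
  have m': "multilin3 sW (\<lambda>a b c. tsum3 (\<lambda>a' b' c'. f (a * a') (b * b') (c * c')) u)" if "u \<in> tpow 3" for u
    by (intro multilin3I lin_tsum3 multilin3_lin[OF f] multilin3_space[OF f] lin_intros that)
  show "tsum3 (\<lambda>X Y Z. tsum2 (\<lambda>a b. tsum2 (\<lambda>c d. f (X * a) (Y * c) (Z * d)) (\<Delta> b)) (\<Delta> h)) \<Phi> =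
      tsum2 (\<lambda>a b. tsum2 (\<lambda>c d. tsum3 (\<lambda>X Y Z. f (c * X) (d * Y) (b * Z)) \<Phi>) (\<Delta> a)) (\<Delta> h)"
    using arg_cong[OF coassoc_comult, of "tsum3 f" h]
    by (simp add: tsum3_tmult[OF f] tsum3_comult[OF m] tsum3_comult[OF m'])
  show "tsum3 (\<lambda>X Y Z. tsum2 (\<lambda>a b. tsum2 (\<lambda>c d. f (X * c) (Y * d) (Z * b)) (\<Delta> a)) (\<Delta> h)) \<Phi>i =
      tsum2 (\<lambda>a b. tsum2 (\<lambda>c d. tsum3 (\<lambda>X Y Z. f (a * X) (c * Y) (d * Z)) \<Phi>i) (\<Delta> b)) (\<Delta> h)"
    using arg_cong[OF coassoc_inv_comult, of "tsum3 f" h]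
    by (simp add: tsum3_tmult[OF f] tsum3_comult[OF m] tsum3_comult[OF m'])
qed

end

context quasi_hopf_algebra
begin

lemma lin_S: "lin scale h \<Longrightarrow> lin scale (\<lambda>x. S (h x))"
  by (rule lin_compose[OF antipode_linear])

lemma lin_\<Delta>: "lin scale h \<Longrightarrow> lin tscale (\<lambda>x. \<Delta> (h x))"
  by (rule lin_compose[OF comult_linear])

text \<open>
  \<open>\<Theta> = (S \<otimes> S) \<circ> \<Delta>\<^sup>T\<close> is the antipode of \<open>H \<otimes> H\<close> along \<open>\<Delta>\<close> that the Drinfeld twist compares with \<open>\<Delta> \<circ> S\<close>.
\<close>

definition \<Theta> :: "'h \<Rightarrow> ('k, 'h) tensor" where "\<Theta> a = tanti 2 S (\<Delta> a)"

lemma \<Theta>_in [simp]: "\<Theta> a \<in> tpow 2"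
  by (simp add: \<Theta>_def)

lemma \<Theta>_mult: "\<Theta> (a * b) = \<Theta> b \<cdot>\<^sub>2 \<Theta> a"
  by (simp add: \<Theta>_def comult_mult tanti_mult[OF antipode_linear antipode_mult])

lemma \<Theta>_one [simp]: "\<Theta> 1 = tone 2"
  by (simp add: \<Theta>_def comult_one tanti_tone antipode_linear antipode_one)

lemma \<Theta>_expand: "\<Theta> a = tsum2 (\<lambda>x y. tens [S y, S x]) (\<Delta> a)"
  by (simp add: \<Theta>_def tanti_def tsum_2)

lemma lin_\<Theta>: "lin scale h \<Longrightarrow> lin tscale (\<lambda>x. \<Theta> (h x))"
  unfolding \<Theta>_def by (intro lin_tanti antipode_linear lin_\<Delta>) auto

declare antipode_mult [simp] antipode_one [simp] comult_one [simp]

lemmas lins = lin_intros lin_S lin_\<Delta> lin_\<Theta>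

lemma antipode_alpha_lin:
  "lin sW h \<Longrightarrow> tsum2 (\<lambda>b c. h (S b * \<alpha> * c)) (\<Delta> a) = sW (\<epsilon> a) (h \<alpha>)"
  using tsum2_lin[of sW h "\<lambda>b c. S b * \<alpha> * c" "\<Delta> a"] by (simp add: antipode_alpha lin_scale)

lemma antipode_beta_lin:
  "lin sW h \<Longrightarrow> tsum2 (\<lambda>b c. h (b * \<beta> * S c)) (\<Delta> a) = sW (\<epsilon> a) (h \<beta>)"
  using tsum2_lin[of sW h "\<lambda>b c. b * \<beta> * S c" "\<Delta> a"] by (simp add: antipode_beta lin_scale)

lemma antipode_coassoc_lin:
  "lin sW h \<Longrightarrow> tsum3 (\<lambda>X Y Z. h (S X * \<alpha> * Y * \<beta> * S Z)) \<Phi> = h 1"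
  "lin sW h \<Longrightarrow> tsum3 (\<lambda>X Y Z. h (X * \<beta> * S Y * \<alpha> * Z)) \<Phi>i = h 1"
  using tsum3_lin[of sW h "\<lambda>X Y Z. S X * \<alpha> * Y * \<beta> * S Z" \<Phi>]
    tsum3_lin[of sW h "\<lambda>X Y Z. X * \<beta> * S Y * \<alpha> * Z" \<Phi>i]
  by (simp_all add: antipode_coassoc antipode_coassoc_inv)

text \<open>
  Partial evaluations of the coassociator: one of the two pairings \<open>S(x) \<alpha> y\<close> and \<open>x \<beta> S(y)\<close> is applied to
  two adjacent factors.  They are the building blocks of \<open>\<gamma>\<close> and of its counterpart for \<open>\<beta>\<close>,
  see \<open>gamma_eq_q\<^sub>L\<close> and \<open>gamma'_eq_p\<^sub>R\<close>.
\<close>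

definition "q\<^sub>L = tsum3 (\<lambda>X Y Z. tens [S X * \<alpha> * Y, Z]) \<Phi>"
definition "p\<^sub>R = tsum3 (\<lambda>X Y Z. tens [X, Y * \<beta> * S Z]) \<Phi>"
definition "q' = tsum3 (\<lambda>X Y Z. tens [S Y * \<alpha> * Z, S X]) \<Phi>i"
definition "p' = tsum3 (\<lambda>X Y Z. tens [S Z, X * \<beta> * S Y]) \<Phi>i"

lemma pq_in [simp]: "q\<^sub>L \<in> tpow 2" "p\<^sub>R \<in> tpow 2" "q' \<in> tpow 2" "p' \<in> tpow 2"
  by (simp_all add: q\<^sub>L_def p\<^sub>R_def q'_def p'_def tsum3_in)

lemma q\<^sub>L_\<Delta>: "q\<^sub>L \<cdot>\<^sub>2 \<Delta> z = tsum3 (\<lambda>X Y Z. tsum2 (\<lambda>b c. tens [S X * \<alpha> * Y * b, Z * c]) (\<Delta> z)) \<Phi>"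
  by (simp add: q\<^sub>L_def tmult_tsum3 tmult2_expand(1)[of _ "\<Delta> z"])

lemma \<Delta>_p\<^sub>R: "\<Delta> x \<cdot>\<^sub>2 p\<^sub>R = tsum3 (\<lambda>X Y Z. tsum2 (\<lambda>b c. tens [b * X, c * (Y * \<beta> * S Z)]) (\<Delta> x)) \<Phi>"
  by (simp add: p\<^sub>R_def tmult_tsum3 tmult2_expand(2)[of "\<Delta> x"])

lemma \<Theta>_q': "\<Theta> a \<cdot>\<^sub>2 q' = tsum3 (\<lambda>X Y Z. tsum2 (\<lambda>b c. tens [S c * (S Y * \<alpha> * Z), S b * S X]) (\<Delta> a)) \<Phi>i"
  by (simp add: q'_def tmult_tsum3 tmult_tsum2 \<Theta>_expand tsum_in_simps)

lemma p'_\<Theta>: "p' \<cdot>\<^sub>2 \<Theta> a = tsum3 (\<lambda>X Y Z. tsum2 (\<lambda>b c. tens [S Z * S c, X * \<beta> * S Y * S b]) (\<Delta> a)) \<Phi>i"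
  by (simp add: p'_def tmult_tsum3 tmult_tsum2 \<Theta>_expand tsum_in_simps tsum_swap_curried(2))

text \<open>
  Evaluate \<open>\<Phi> (1 \<otimes> \<Delta>)\<Delta>(h) = (\<Delta> \<otimes> 1)\<Delta>(h) \<Phi>\<close> with the form that defines \<open>q\<^sub>L\<close>: on the right-hand side the inner
  coproduct is absorbed.  The three lemmas that follow hold for the same reason.
\<close>

lemma q\<^sub>L_comult: "tsum2 (\<lambda>a b. tens [S a, 1] \<cdot>\<^sub>2 (q\<^sub>L \<cdot>\<^sub>2 \<Delta> b)) (\<Delta> h) = tens [1, h] \<cdot>\<^sub>2 q\<^sub>L"
proof -
  define f where "f a b c = tens [S a * \<alpha> * b, c]" for a b c
  have f: "multilin3 tscale f" unfolding f_def by (intro multilin3I lins)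
  have absorb: "tsum2 (\<lambda>c d. f (c * X) (d * Y) Z) (\<Delta> a) = tscale (\<epsilon> a) (f X Y Z)" for a X Y Z
    using antipode_alpha_lin[of tscale "\<lambda>t. tens [S X * t * Y, Z]" a]
    by (simp add: f_def lins mult.assoc)
  have counit: "tsum2 (\<lambda>a b. tscale (\<epsilon> a) (f X Y (b * Z))) (\<Delta> h) = f X Y (h * Z)" for X Y Z
    by (rule tsum2_counit(1)) (intro multilin3_lin[OF f] lins)
  have "tsum2 (\<lambda>a b. tens [S a, 1] \<cdot>\<^sub>2 (q\<^sub>L \<cdot>\<^sub>2 \<Delta> b)) (\<Delta> h) =
    tsum2 (\<lambda>a b. tsum3 (\<lambda>X Y Z. tsum2 (\<lambda>c d. f (X * a) (Y * c) (Z * d)) (\<Delta> b)) \<Phi>) (\<Delta> h)"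
    by (simp add: q\<^sub>L_\<Delta> tmult_tsum3 tmult_tsum2 tsum_in_simps f_def mult.assoc)
  also have "\<dots> = tsum2 (\<lambda>a b. tsum3 (\<lambda>X Y Z. tscale (\<epsilon> a) (f X Y (b * Z))) \<Phi>) (\<Delta> h)"
    by (simp add: coassoc_eval[OF f] tsum_swap_curried(2) absorb)
  also have "\<dots> = tsum3 (\<lambda>X Y Z. f X Y (h * Z)) \<Phi>"
    by (simp add: tsum_swap_curried(2) counit)
  also have "\<dots> = tens [1, h] \<cdot>\<^sub>2 q\<^sub>L"
    by (simp add: f_def q\<^sub>L_def tmult_tsum3)
  finally show ?thesis .
qed


lemma p\<^sub>R_comult: "tsum2 (\<lambda>a b. \<Delta> a \<cdot>\<^sub>2 (p\<^sub>R \<cdot>\<^sub>2 tens [1, S b])) (\<Delta> h) = p\<^sub>R \<cdot>\<^sub>2 tens [h, 1]"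
proof -
  define f where "f a b c = tens [a, b * \<beta> * S c]" for a b c
  have f: "multilin3 tscale f" unfolding f_def by (intro multilin3I lins)
  have absorb: "tsum2 (\<lambda>c d. f X (Y * c) (Z * d)) (\<Delta> a) = tscale (\<epsilon> a) (f X Y Z)" for a X Y Z
    using antipode_beta_lin[of tscale "\<lambda>t. tens [X, Y * t * S Z]" a]
    by (simp add: f_def lins mult.assoc)
  have counit: "tsum2 (\<lambda>a b. tscale (\<epsilon> b) (f (X * a) Y Z)) (\<Delta> h) = f (X * h) Y Z" for X Y Z
    by (rule tsum2_counit(2)) (intro multilin3_lin[OF f] lins)
  have "tsum2 (\<lambda>a b. \<Delta> a \<cdot>\<^sub>2 (p\<^sub>R \<cdot>\<^sub>2 tens [1, S b])) (\<Delta> h) =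
    tsum2 (\<lambda>a b. tsum2 (\<lambda>c d. tsum3 (\<lambda>X Y Z. f (c * X) (d * Y) (b * Z)) \<Phi>) (\<Delta> a)) (\<Delta> h)"
    by (simp add: tmult_assoc[symmetric] \<Delta>_p\<^sub>R tmult_tsum3 tmult_tsum2 tsum_in_simps f_def mult.assoc
        tsum_swap_curried(2))
  also have "\<dots> = tsum3 (\<lambda>X Y Z. f (X * h) Y Z) \<Phi>"
    by (simp add: coassoc_eval(1)[OF f, symmetric] absorb counit tsum_swap_curried(2)[of _ "\<Phi>", symmetric])
  also have "\<dots> = p\<^sub>R \<cdot>\<^sub>2 tens [h, 1]"
    by (simp add: f_def p\<^sub>R_def tmult_tsum3)
  finally show ?thesis .
qed

lemma q'_comult: "tsum2 (\<lambda>a b. \<Theta> a \<cdot>\<^sub>2 (q' \<cdot>\<^sub>2 tens [b, 1])) (\<Delta> h) = q' \<cdot>\<^sub>2 tens [1, S h]"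
proof -
  define f where "f a b c = tens [S b * \<alpha> * c, S a]" for a b c
  have f: "multilin3 tscale f" unfolding f_def by (intro multilin3I lins)
  have absorb: "tsum2 (\<lambda>c d. f X (c * Y) (d * Z)) (\<Delta> a) = tscale (\<epsilon> a) (f X Y Z)" for a X Y Z
    using antipode_alpha_lin[of tscale "\<lambda>t. tens [S Y * t * Z, S X]" a]
    by (simp add: f_def lins mult.assoc)
  have counit: "tsum2 (\<lambda>a b. tscale (\<epsilon> b) (f (a * X) Y Z)) (\<Delta> h) = f (h * X) Y Z" for X Y Z
    by (rule tsum2_counit(2)) (intro multilin3_lin[OF f] lins)
  have "tsum2 (\<lambda>a b. \<Theta> a \<cdot>\<^sub>2 (q' \<cdot>\<^sub>2 tens [b, 1])) (\<Delta> h) =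
    tsum2 (\<lambda>a b. tsum3 (\<lambda>X Y Z. tsum2 (\<lambda>c d. f (X * c) (Y * d) (Z * b)) (\<Delta> a)) \<Phi>i) (\<Delta> h)"
    by (simp add: tmult_assoc[symmetric] \<Theta>_q' tmult_tsum3 tmult_tsum2 tsum_in_simps f_def mult.assoc)
  also have "\<dots> = tsum3 (\<lambda>X Y Z. f (h * X) Y Z) \<Phi>i"
    by (simp add: tsum_swap_curried(2) coassoc_eval(2)[OF f] absorb counit)
  also have "\<dots> = q' \<cdot>\<^sub>2 tens [1, S h]"
    by (simp add: f_def q'_def tmult_tsum3)
  finally show ?thesis .
qed

lemma p'_comult: "tsum2 (\<lambda>a b. tens [1, a] \<cdot>\<^sub>2 (p' \<cdot>\<^sub>2 \<Theta> b)) (\<Delta> h) = tens [S h, 1] \<cdot>\<^sub>2 p'"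
proof -
  define f where "f a b c = tens [S c, a * \<beta> * S b]" for a b c
  have f: "multilin3 tscale f" unfolding f_def by (intro multilin3I lins)
  have absorb: "tsum2 (\<lambda>c d. f (X * c) (Y * d) Z) (\<Delta> a) = tscale (\<epsilon> a) (f X Y Z)" for a X Y Z
    using antipode_beta_lin[of tscale "\<lambda>t. tens [S Z, X * t * S Y]" a]
    by (simp add: f_def lins mult.assoc)
  have counit: "tsum2 (\<lambda>a b. tscale (\<epsilon> a) (f X Y (Z * b))) (\<Delta> h) = f X Y (Z * h)" for X Y Z
    by (rule tsum2_counit(1)) (intro multilin3_lin[OF f] lins)
  have "tsum2 (\<lambda>a b. tens [1, a] \<cdot>\<^sub>2 (p' \<cdot>\<^sub>2 \<Theta> b)) (\<Delta> h) =
    tsum2 (\<lambda>a b. tsum2 (\<lambda>c d. tsum3 (\<lambda>X Y Z. f (a * X) (c * Y) (d * Z)) \<Phi>i) (\<Delta> b)) (\<Delta> h)"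
    by (simp add: p'_\<Theta> tmult_tsum3 tmult_tsum2 tsum_in_simps f_def mult.assoc tsum_swap_curried(2))
  also have "\<dots> = tsum3 (\<lambda>X Y Z. f X Y (Z * h)) \<Phi>i"
    by (simp add: coassoc_eval(2)[OF f, symmetric] absorb counit)
  also have "\<dots> = tens [S h, 1] \<cdot>\<^sub>2 p'"
    by (simp add: f_def p'_def tmult_tsum3)
  finally show ?thesis .
qed

text \<open>
  Each of the four sums is an evaluation of one side of a form of the pentagon in \<open>H\<^sup>\<otimes>\<^sup>4\<close>.  On the other
  side two of the three factors are absorbed, and what remains is one of the two antipode axioms
  for \<open>\<Phi>\<close>.
\<close>

lemma pq_unit:
  "tsum3 (\<lambda>x y z. tens [x * \<beta> * S y, 1] \<cdot>\<^sub>2 (q\<^sub>L \<cdot>\<^sub>2 \<Delta> z)) \<Phi>i = tone 2"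
  "tsum3 (\<lambda>x y z. \<Delta> x \<cdot>\<^sub>2 (p\<^sub>R \<cdot>\<^sub>2 tens [1, S y * \<alpha> * z])) \<Phi>i = tone 2"
  "tsum3 (\<lambda>X Y Z. \<Theta> X \<cdot>\<^sub>2 (q' \<cdot>\<^sub>2 tens [Y * \<beta> * S Z, 1])) \<Phi> = tone 2"
  "tsum3 (\<lambda>X Y Z. tens [1, S X * \<alpha> * Y] \<cdot>\<^sub>2 (p' \<cdot>\<^sub>2 \<Theta> Z)) \<Phi> = tone 2"
proof -
  define f where "f a b c d = tens [a * \<beta> * S b * \<alpha> * c, d]" for a b c d
  have f: "multilin4 tscale f" unfolding f_def by (intro multilin4I lins)
  have l: "tsum2 (\<lambda>x y. f a (x * b) (y * c) d) (\<Delta> h) = tscale (\<epsilon> h) (f a b c d)" for a b c d h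
    using antipode_alpha_lin[of tscale "\<lambda>t. tens [a * \<beta> * S b * t * c, d]" h]
      by (simp add: f_def lins mult.assoc)
  have r: "tsum2 (\<lambda>x y. f (a * x) (b * y) c d) (\<Delta> h) = tscale (\<epsilon> h) (f a b c d)" for a b c d h
    using antipode_beta_lin[of tscale "\<lambda>t. tens [a * t * S b * \<alpha> * c, d]" h]
      by (simp add: f_def lins mult.assoc)
  have "tsum3 (\<lambda>x y z. tens [x * \<beta> * S y, 1] \<cdot>\<^sub>2 (q\<^sub>L \<cdot>\<^sub>2 \<Delta> z)) \<Phi>i =
    tsum3 (\<lambda>x y z. tsum3 (\<lambda>X Y Z. tsum2 (\<lambda>b c. f x (X * y) (Y * b) (Z * c)) (\<Delta> z)) \<Phi>) \<Phi>i"
    by (simp add: q\<^sub>L_\<Delta> tmult_tsum3 tmult_tsum2 tsum_in_simps f_def mult.assoc)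
  also have "\<dots> = tsum4 f (padl \<Phi> \<cdot>\<^sub>4 \<Delta>2 \<Phi>i)"
    by (subst tsum_swap_curried(4)) (simp add: tsum4_tcat_tmult[OF f] tsum4_comult[where sW = tscale] f_def
        lins multilin4I)
  also have "\<dots> = tsum4 f (padr \<Phi>i)"
    by (simp add: pentagon_variants(2) absorb_left(2)[OF f _ _ l] absorb_right(1)[OF f _ _ r])
  also have "\<dots> = tone 2"
    using antipode_coassoc_lin(2)[of tscale "\<lambda>t. tens [t, 1]"] 
    by (simp add: tsum4_tcat[OF f] f_def lins tone_tens(2))
  finally show "tsum3 (\<lambda>x y z. tens [x * \<beta> * S y, 1] \<cdot>\<^sub>2 (q\<^sub>L \<cdot>\<^sub>2 \<Delta> z)) \<Phi>i = tone 2" .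
next
  define f where "f a b c d = tens [a, b * \<beta> * S c * \<alpha> * d]" for a b c d
  have f: "multilin4 tscale f" unfolding f_def by (intro multilin4I lins)
  have l: "tsum2 (\<lambda>x y. f a b (x * c) (y * d)) (\<Delta> h) = tscale (\<epsilon> h) (f a b c d)" for a b c d h
    using antipode_alpha_lin[of tscale "\<lambda>t. tens [a, b * \<beta> * S c * t * d]" h]
      by (simp add: f_def lins mult.assoc)
  have r: "tsum2 (\<lambda>x y. f a (b * x) (c * y) d) (\<Delta> h) = tscale (\<epsilon> h) (f a b c d)" for a b c d h
    using antipode_beta_lin[of tscale "\<lambda>t. tens [a, b * t * S c * \<alpha> * d]" h]
      by (simp add: f_def lins mult.assoc)
  have "tsum3 (\<lambda>x y z. \<Delta> x \<cdot>\<^sub>2 (p\<^sub>R \<cdot>\<^sub>2 tens [1, S y * \<alpha> * z])) \<Phi>i =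
    tsum3 (\<lambda>x y z. tsum2 (\<lambda>b c. tsum3 (\<lambda>X Y Z. f (b * X) (c * Y) (y * Z) z) \<Phi>) (\<Delta> x)) \<Phi>i"
    by (simp add: tmult_assoc[symmetric] \<Delta>_p\<^sub>R tmult_tsum3 tmult_tsum2 tsum_in_simps f_def mult.assoc
        tsum_swap_curried(2))
  also have "\<dots> = tsum4 f (\<Delta>0 \<Phi>i \<cdot>\<^sub>4 padr \<Phi>)"
    by (simp add: tsum4_comult_tmult[OF f] tsum4_tcat[where sW = tscale] f_def lins multilin4I)
  also have "\<dots> = tsum4 f (padl \<Phi>i)"
    by (simp add: pentagon_variants(3) absorb_left(3)[OF f _ _ l] absorb_right(2)[OF f _ _ r])
  also have "\<dots> = tone 2"
    using antipode_coassoc_lin(2)[of tscale "\<lambda>t. tens [1, t]"] 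
    by (simp add: tsum4_tcat[OF f] f_def lins tone_tens(2))
  finally show "tsum3 (\<lambda>x y z. \<Delta> x \<cdot>\<^sub>2 (p\<^sub>R \<cdot>\<^sub>2 tens [1, S y * \<alpha> * z])) \<Phi>i = tone 2" .
next
  define f where "f a b c d = tens [S b * \<alpha> * c * \<beta> * S d, S a]" for a b c d
  have f: "multilin4 tscale f" unfolding f_def by (intro multilin4I lins)
  have l: "tsum2 (\<lambda>x y. f a (x * b) (y * c) d) (\<Delta> h) = tscale (\<epsilon> h) (f a b c d)" for a b c d h
    using antipode_alpha_lin[of tscale "\<lambda>t. tens [S b * t * c * \<beta> * S d, S a]" h]
      by (simp add: f_def lins mult.assoc)
  have r: "tsum2 (\<lambda>x y. f a b (c * x) (d * y)) (\<Delta> h) = tscale (\<epsilon> h) (f a b c d)" for a b c d h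
    using antipode_beta_lin[of tscale "\<lambda>t. tens [S b * \<alpha> * c * t * S d, S a]" h]
      by (simp add: f_def lins mult.assoc)
  have "tsum3 (\<lambda>X Y Z. \<Theta> X \<cdot>\<^sub>2 (q' \<cdot>\<^sub>2 tens [Y * \<beta> * S Z, 1])) \<Phi> =
    tsum3 (\<lambda>X Y Z. tsum3 (\<lambda>x y z. tsum2 (\<lambda>b c. f (x * b) (y * c) (z * Y) Z) (\<Delta> X)) \<Phi>i) \<Phi>"
    by (simp add: tmult_assoc[symmetric] \<Theta>_q' tmult_tsum3 tmult_tsum2 tsum_in_simps f_def mult.assoc)
  also have "\<dots> = tsum4 f (padr \<Phi>i \<cdot>\<^sub>4 \<Delta>0 \<Phi>)"
    by (subst tsum_swap_curried(4)) (simp add: tsum4_tcat_tmult[OF f] tsum4_comult[where sW = tscale] f_def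
        lins multilin4I)
  also have "\<dots> = tsum4 f (padl \<Phi>)"
    by (simp add: pentagon_variants(1) absorb_left(2)[OF f _ _ l] absorb_right(3)[OF f _ _ r])
  also have "\<dots> = tone 2"
    using antipode_coassoc_lin(1)[of tscale "\<lambda>t. tens [t, 1]"] 
    by (simp add: tsum4_tcat[OF f] f_def lins tone_tens(2))
  finally show "tsum3 (\<lambda>X Y Z. \<Theta> X \<cdot>\<^sub>2 (q' \<cdot>\<^sub>2 tens [Y * \<beta> * S Z, 1])) \<Phi> = tone 2" .
next
  define f where "f a b c d = tens [S d, S a * \<alpha> * b * \<beta> * S c]" for a b c d
  have f: "multilin4 tscale f" unfolding f_def by (intro multilin4I lins)
  have l: "tsum2 (\<lambda>x y. f (x * a) (y * b) c d) (\<Delta> h) = tscale (\<epsilon> h) (f a b c d)" for a b c d h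
    using antipode_alpha_lin[of tscale "\<lambda>t. tens [S d, S a * t * b * \<beta> * S c]" h]
      by (simp add: f_def lins mult.assoc)
  have r: "tsum2 (\<lambda>x y. f a (b * x) (c * y) d) (\<Delta> h) = tscale (\<epsilon> h) (f a b c d)" for a b c d h
    using antipode_beta_lin[of tscale "\<lambda>t. tens [S d, S a * \<alpha> * b * t * S c]" h]
      by (simp add: f_def lins mult.assoc)
  have "tsum3 (\<lambda>X Y Z. tens [1, S X * \<alpha> * Y] \<cdot>\<^sub>2 (p' \<cdot>\<^sub>2 \<Theta> Z)) \<Phi> =
    tsum3 (\<lambda>X Y Z. tsum2 (\<lambda>b c. tsum3 (\<lambda>x y z. f X (Y * x) (b * y) (c * z)) \<Phi>i) (\<Delta> Z)) \<Phi>"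
    by (simp add: p'_\<Theta> tmult_tsum3 tmult_tsum2 tsum_in_simps f_def mult.assoc tsum_swap_curried(2))
  also have "\<dots> = tsum4 f (\<Delta>2 \<Phi> \<cdot>\<^sub>4 padl \<Phi>i)"
    by (simp add: tsum4_comult_tmult[OF f] tsum4_tcat[where sW = tscale] f_def lins multilin4I)
  also have "\<dots> = tsum4 f (padr \<Phi>)"
    by (simp add: pentagon_variants(4) absorb_left(1)[OF f _ _ l] absorb_right(2)[OF f _ _ r])
  also have "\<dots> = tone 2"
    using antipode_coassoc_lin(1)[of tscale "\<lambda>t. tens [1, t]"] 
    by (simp add: tsum4_tcat[OF f] f_def lins tone_tens(2))
  finally show "tsum3 (\<lambda>X Y Z. tens [1, S X * \<alpha> * Y] \<cdot>\<^sub>2 (p' \<cdot>\<^sub>2 \<Theta> Z)) \<Phi> = tone 2" .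
qed

end

section \<open>The antipode on \<open>H \<otimes> H\<close> along the coproduct\<close>

context k_algebra
begin

lemma tsum_swap_323:
  "tsum3 (\<lambda>a b c. tsum2 (\<lambda>d e. tsum3 (\<lambda>f g h. F a b c d e f g h) u) v) w =
    tsum3 (\<lambda>f g h. tsum2 (\<lambda>d e. tsum3 (\<lambda>a b c. F a b c d e f g h) w) v) u"
  unfolding tsum_swap_curried(2) by (rule tsum_swap_curried(4))

end

context quasi_hopf_algebra
begin

abbreviation "\<gamma> \<equiv> drinfeld_gamma"

text \<open>
  The element that plays the role of \<open>\<beta>\<close> for the antipode \<open>\<Theta>\<close>, as \<open>\<gamma>\<close> plays that of \<open>\<alpha>\<close>.
\<close>

definition "\<gamma>' = tsum4 (\<lambda>a b c d. tens [a * \<beta> * S d, b * \<beta> * S c]) (\<Delta>0 \<Phi>i \<cdot>\<^sub>4 padr \<Phi>)"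

lemma gammas_in [simp]: "\<gamma> \<in> tpow 2" "\<gamma>' \<in> tpow 2"
  by (auto simp: drinfeld_gamma_def \<gamma>'_def intro!: tsum4_in)

text \<open>
  The form that defines \<open>\<gamma>\<close> absorbs a coproduct in its two inner slots, so any bracketing of the four factors
  may be used in its definition.
\<close>

lemma gamma_eq_tsum4:
  "\<gamma> = tsum4 (\<lambda>a b c d. tens [S b * \<alpha> * c, S a * \<alpha> * d]) (padr \<Phi>i \<cdot>\<^sub>4 \<Delta>0 \<Phi>)"
  "\<gamma> = tsum4 (\<lambda>a b c d. tens [S b * \<alpha> * c, S a * \<alpha> * d]) (padl \<Phi> \<cdot>\<^sub>4 \<Delta>2 \<Phi>i)"
proof -
  define f where "f a b c d = tens [S b * \<alpha> * c, S a * \<alpha> * d]" for a b c d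
  have f: "multilin4 tscale f" unfolding f_def by (intro multilin4I lins)
  have l: "tsum2 (\<lambda>x y. f a (x * b) (y * c) d) (\<Delta> h) = tscale (\<epsilon> h) (f a b c d)" for a b c d h
    using antipode_alpha_lin[of tscale "\<lambda>t. tens [S b * t * c, S a * \<alpha> * d]" h]
      by (simp add: f_def lins mult.assoc)
  have g: "\<gamma> = tsum4 f (padr \<Phi>i \<cdot>\<^sub>4 \<Delta>0 \<Phi>)" by (simp add: drinfeld_gamma_def f_def[abs_def])
  also have "\<dots> = tsum4 f (padl \<Phi> \<cdot>\<^sub>4 \<Delta>2 \<Phi>i)"
    by (simp add: pentagon_variants(1) absorb_left(2)[OF f _ _ l])
  finally show "\<gamma> = tsum4 (\<lambda>a b c d. tens [S b * \<alpha> * c, S a * \<alpha> * d]) (padl \<Phi> \<cdot>\<^sub>4 \<Delta>2 \<Phi>i)"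
    by (simp add: f_def[abs_def])
  show "\<gamma> = tsum4 (\<lambda>a b c d. tens [S b * \<alpha> * c, S a * \<alpha> * d]) (padr \<Phi>i \<cdot>\<^sub>4 \<Delta>0 \<Phi>)"
    using g by (simp add: f_def[abs_def])
qed

lemma gamma_eq_q\<^sub>L: "\<gamma> = tsum3 (\<lambda>x y z. tens [S y, S x * \<alpha>] \<cdot>\<^sub>2 (q\<^sub>L \<cdot>\<^sub>2 \<Delta> z)) \<Phi>i"
  and gamma_eq_q': "\<gamma> = tsum3 (\<lambda>X Y Z. \<Theta> X \<cdot>\<^sub>2 (q' \<cdot>\<^sub>2 tens [Y, \<alpha> * Z])) \<Phi>"
proof -
  define f where "f a b c d = tens [S b * \<alpha> * c, S a * \<alpha> * d]" for a b c d
  have f: "multilin4 tscale f" unfolding f_def by (intro multilin4I lins)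
  have "\<gamma> = tsum4 f (padl \<Phi> \<cdot>\<^sub>4 \<Delta>2 \<Phi>i)" by (simp add: gamma_eq_tsum4(2) f_def[abs_def])
  also have "\<dots> = tsum3 (\<lambda>x y z. tsum3 (\<lambda>X Y Z. tsum2 (\<lambda>b c. f x (X * y) (Y * b) (Z * c)) (\<Delta> z)) \<Phi>) \<Phi>i"
    by (subst tsum_swap_curried(4)) (simp add: tsum4_tcat_tmult[OF f] tsum4_comult[where sW = tscale] f_def
        lins multilin4I)
  also have "\<dots> = tsum3 (\<lambda>x y z. tens [S y, S x * \<alpha>] \<cdot>\<^sub>2 (q\<^sub>L \<cdot>\<^sub>2 \<Delta> z)) \<Phi>i"
    by (simp add: q\<^sub>L_\<Delta> tmult_tsum3 tmult_tsum2 tsum_in_simps f_def mult.assoc)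
  finally show "\<gamma> = tsum3 (\<lambda>x y z. tens [S y, S x * \<alpha>] \<cdot>\<^sub>2 (q\<^sub>L \<cdot>\<^sub>2 \<Delta> z)) \<Phi>i" .
  have "tsum4 f (padr \<Phi>i \<cdot>\<^sub>4 \<Delta>0 \<Phi>) =
    tsum3 (\<lambda>X Y Z. tsum3 (\<lambda>x y z. tsum2 (\<lambda>b c. f (x * b) (y * c) (z * Y) Z) (\<Delta> X)) \<Phi>i) \<Phi>"
    by (subst tsum_swap_curried(4)) (simp add: tsum4_tcat_tmult[OF f] tsum4_comult[where sW = tscale] f_def
        lins multilin4I)
  also have "\<dots> = tsum3 (\<lambda>X Y Z. \<Theta> X \<cdot>\<^sub>2 (q' \<cdot>\<^sub>2 tens [Y, \<alpha> * Z])) \<Phi>"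
    by (simp add: tmult_assoc[symmetric] \<Theta>_q' tmult_tsum3 tmult_tsum2 tsum_in_simps f_def mult.assoc)
  finally show "\<gamma> = tsum3 (\<lambda>X Y Z. \<Theta> X \<cdot>\<^sub>2 (q' \<cdot>\<^sub>2 tens [Y, \<alpha> * Z])) \<Phi>"
    by (simp add: gamma_eq_tsum4(1) f_def[abs_def])
qed

lemma gamma'_eq_p\<^sub>R: "\<gamma>' = tsum3 (\<lambda>x y z. \<Delta> x \<cdot>\<^sub>2 (p\<^sub>R \<cdot>\<^sub>2 tens [\<beta> * S z, S y])) \<Phi>i"
  and gamma'_eq_p': "\<gamma>' = tsum3 (\<lambda>X Y Z. tens [X * \<beta>, Y] \<cdot>\<^sub>2 (p' \<cdot>\<^sub>2 \<Theta> Z)) \<Phi>"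
proof -
  define f where "f a b c d = tens [a * \<beta> * S d, b * \<beta> * S c]" for a b c d
  have f: "multilin4 tscale f" unfolding f_def by (intro multilin4I lins)
  have r: "tsum2 (\<lambda>x y. f a (b * x) (c * y) d) (\<Delta> h) = tscale (\<epsilon> h) (f a b c d)" for a b c d h
    using antipode_beta_lin[of tscale "\<lambda>t. tens [a * \<beta> * S d, b * t * S c]" h]
      by (simp add: f_def lins mult.assoc)
  have g: "\<gamma>' = tsum4 f (\<Delta>0 \<Phi>i \<cdot>\<^sub>4 padr \<Phi>)" by (simp add: \<gamma>'_def f_def[abs_def])
  also have "\<dots> = tsum4 f (\<Delta>2 \<Phi> \<cdot>\<^sub>4 padl \<Phi>i)"
    by (simp add: pentagon_variants(3) tmult_assoc[symmetric] absorb_right(2)[OF f _ _ r])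
  also have "\<dots> = tsum3 (\<lambda>X Y Z. tsum2 (\<lambda>b c. tsum3 (\<lambda>x y z. f X (Y * x) (b * y) (c * z)) \<Phi>i) (\<Delta> Z)) \<Phi>"
    by (simp add: tsum4_comult_tmult[OF f] tsum4_tcat[where sW = tscale] f_def lins multilin4I)
  also have "\<dots> = tsum3 (\<lambda>X Y Z. tens [X * \<beta>, Y] \<cdot>\<^sub>2 (p' \<cdot>\<^sub>2 \<Theta> Z)) \<Phi>"
    by (simp add: p'_\<Theta> tmult_tsum3 tmult_tsum2 tsum_in_simps f_def mult.assoc tsum_swap_curried(2))
  finally show "\<gamma>' = tsum3 (\<lambda>X Y Z. tens [X * \<beta>, Y] \<cdot>\<^sub>2 (p' \<cdot>\<^sub>2 \<Theta> Z)) \<Phi>" .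
  have "tsum4 f (\<Delta>0 \<Phi>i \<cdot>\<^sub>4 padr \<Phi>) =
    tsum3 (\<lambda>x y z. tsum2 (\<lambda>b c. tsum3 (\<lambda>X Y Z. f (b * X) (c * Y) (y * Z) z) \<Phi>) (\<Delta> x)) \<Phi>i"
    by (simp add: tsum4_comult_tmult[OF f] tsum4_tcat[where sW = tscale] f_def lins multilin4I)
  also have "\<dots> = tsum3 (\<lambda>x y z. \<Delta> x \<cdot>\<^sub>2 (p\<^sub>R \<cdot>\<^sub>2 tens [\<beta> * S z, S y])) \<Phi>i"
    by (simp add: tmult_assoc[symmetric] \<Delta>_p\<^sub>R tmult_tsum3 tmult_tsum2 tsum_in_simps f_def mult.assoc
        tsum_swap_curried(2))
  finally show "\<gamma>' = tsum3 (\<lambda>x y z. \<Delta> x \<cdot>\<^sub>2 (p\<^sub>R \<cdot>\<^sub>2 tens [\<beta> * S z, S y])) \<Phi>i" using g by simp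
qed

text \<open>
  In the expression of \<open>\<gamma>\<close> by \<open>q\<^sub>L\<close>, quasi-coassociativity moves the coproduct of \<open>h\<close> past \<open>\<Phi>\<^sup>-\<^sup>1\<close>; then
  \<open>q\<^sub>L_comult\<close> turns two of the three legs into one, and \<open>\<alpha>\<close> absorbs the remaining two.
\<close>

lemma gamma_invariant: "tsum2 (\<lambda>a b. \<Theta> a \<cdot>\<^sub>2 (\<gamma> \<cdot>\<^sub>2 \<Delta> b)) (\<Delta> h) = tscale (\<epsilon> h) \<gamma>"
proof -
  define f where "f x y z = tens [S y, S x * \<alpha>] \<cdot>\<^sub>2 (q\<^sub>L \<cdot>\<^sub>2 \<Delta> z)" for x y z
  have f_in [simp]: "f x y z \<in> tpow 2" for x y z by (simp add: f_def)
  have f: "multilin3 tscale f" unfolding f_def by (rule multilin3I; intro lins; simp)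
  have "\<Theta> a \<cdot>\<^sub>2 (f X Y Z \<cdot>\<^sub>2 \<Delta> b) = tsum2 (\<lambda>c d. f (X * c) (Y * d) (Z * b)) (\<Delta> a)" for a b X Y Z
    by (simp add: \<Theta>_expand tmult_tsum2 f_def comult_mult tmult_assoc mult.assoc)
  then have "tsum2 (\<lambda>a b. \<Theta> a \<cdot>\<^sub>2 (\<gamma> \<cdot>\<^sub>2 \<Delta> b)) (\<Delta> h) =
    tsum2 (\<lambda>a b. tsum3 (\<lambda>X Y Z. tsum2 (\<lambda>c d. f (X * c) (Y * d) (Z * b)) (\<Delta> a)) \<Phi>i) (\<Delta> h)"
    by (simp add: gamma_eq_q\<^sub>L f_def[symmetric] tmult_tsum3)
  also have "\<dots> = tsum2 (\<lambda>a b. tsum2 (\<lambda>c d. tsum3 (\<lambda>X Y Z. f (a * X) (c * Y) (d * Z)) \<Phi>i) (\<Delta> b)) (\<Delta> h)"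
    by (simp only: tsum_swap_curried(2)) (simp only: coassoc_eval(2)[OF f] tsum_swap_curried(2))
  also have "\<dots> = tsum2 (\<lambda>a b. tsum3 (\<lambda>X Y Z. tens [S Y, S X * (S a * \<alpha> * b)] \<cdot>\<^sub>2 (q\<^sub>L \<cdot>\<^sub>2 \<Delta> Z)) \<Phi>i) (\<Delta> h)"
  proof -
    have "tsum2 (\<lambda>c d. f (a * X) (c * Y) (d * Z)) (\<Delta> b) =
      tsum2 (\<lambda>c d. tens [S Y, S X * S a * \<alpha>] \<cdot>\<^sub>2 ((tens [S c, 1] \<cdot>\<^sub>2 (q\<^sub>L \<cdot>\<^sub>2 \<Delta> d)) \<cdot>\<^sub>2 \<Delta> Z)) (\<Delta> b)" for a b X Y Z
      by (simp add: f_def comult_mult tmult_assoc)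
    also have "\<dots> a b X Y Z = tens [S Y, S X * (S a * \<alpha> * b)] \<cdot>\<^sub>2 (q\<^sub>L \<cdot>\<^sub>2 \<Delta> Z)" for a b X Y Z
      by (subst tsum2_sandwich) (simp_all add: q\<^sub>L_comult tmult_assoc mult.assoc)
    finally show ?thesis by (simp add: tsum_swap_curried(2))
  qed
  also have "\<dots> = tsum3 (\<lambda>X Y Z. tscale (\<epsilon> h) (f X Y Z)) \<Phi>i"
    unfolding tsum_swap_curried(2) f_def
    by (subst antipode_alpha_lin[of tscale]) ((intro lins; simp), simp)
  also have "\<dots> = tscale (\<epsilon> h) \<gamma>"
    using tsum3_additive[of "tscale (\<epsilon> h)" f \<Phi>i]
      by (simp add: tscale_add tscale_zero_right gamma_eq_q\<^sub>L f_def[abs_def])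
  finally show ?thesis .
qed


lemma gamma'_invariant: "tsum2 (\<lambda>a b. \<Delta> a \<cdot>\<^sub>2 (\<gamma>' \<cdot>\<^sub>2 \<Theta> b)) (\<Delta> h) = tscale (\<epsilon> h) \<gamma>'"
proof -
  define f where "f x y z = \<Delta> x \<cdot>\<^sub>2 (p\<^sub>R \<cdot>\<^sub>2 tens [\<beta> * S z, S y])" for x y z
  have f_in [simp]: "f x y z \<in> tpow 2" for x y z by (simp add: f_def)
  have f: "multilin3 tscale f" unfolding f_def by (rule multilin3I; intro lins; simp)
  have "\<Delta> a \<cdot>\<^sub>2 (f X Y Z \<cdot>\<^sub>2 \<Theta> b) = tsum2 (\<lambda>c d. f (a * X) (c * Y) (d * Z)) (\<Delta> b)" for a b X Y Z
    by (simp add: \<Theta>_expand tmult_tsum2 f_def comult_mult tmult_assoc mult.assoc)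
  then have "tsum2 (\<lambda>a b. \<Delta> a \<cdot>\<^sub>2 (\<gamma>' \<cdot>\<^sub>2 \<Theta> b)) (\<Delta> h) =
    tsum2 (\<lambda>a b. tsum3 (\<lambda>X Y Z. tsum2 (\<lambda>c d. f (a * X) (c * Y) (d * Z)) (\<Delta> b)) \<Phi>i) (\<Delta> h)"
    by (simp add: gamma'_eq_p\<^sub>R f_def[symmetric] tmult_tsum3)
  also have "\<dots> = tsum3 (\<lambda>X Y Z. tsum2 (\<lambda>a b. tsum2 (\<lambda>c d. f (X * c) (Y * d) (Z * b)) (\<Delta> a)) (\<Delta> h)) \<Phi>i"
    by (simp only: coassoc_eval(2)[OF f] tsum_swap_curried(2))
  also have "\<dots> = tsum3 (\<lambda>X Y Z. tsum2 (\<lambda>a b. \<Delta> X \<cdot>\<^sub>2 (p\<^sub>R \<cdot>\<^sub>2 tens [(a * \<beta> * S b) * S Z, S Y])) (\<Delta> h)) \<Phi>i"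
  proof -
    have "tsum2 (\<lambda>c d. f (X * c) (Y * d) (Z * b)) (\<Delta> a) =
      tsum2 (\<lambda>c d. \<Delta> X \<cdot>\<^sub>2 ((\<Delta> c \<cdot>\<^sub>2 (p\<^sub>R \<cdot>\<^sub>2 tens [1, S d])) \<cdot>\<^sub>2 tens [\<beta> * S b * S Z, S Y])) (\<Delta> a)" for a b X Y Z
      by (simp add: f_def comult_mult tmult_assoc mult.assoc)
    also have "\<dots> a b X Y Z = \<Delta> X \<cdot>\<^sub>2 (p\<^sub>R \<cdot>\<^sub>2 tens [(a * \<beta> * S b) * S Z, S Y])" for a b X Y Z
      by (subst tsum2_sandwich) (simp_all add: p\<^sub>R_comult tmult_assoc mult.assoc)
    finally show ?thesis by simp
  qed
  also have "\<dots> = tsum3 (\<lambda>X Y Z. tscale (\<epsilon> h) (f X Y Z)) \<Phi>i"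
    unfolding f_def by (subst antipode_beta_lin[of tscale]) ((intro lins; simp), simp)
  also have "\<dots> = tscale (\<epsilon> h) \<gamma>'"
    using tsum3_additive[of "tscale (\<epsilon> h)" f \<Phi>i]
      by (simp add: tscale_add tscale_zero_right gamma'_eq_p\<^sub>R f_def[abs_def])
  finally show ?thesis .
qed

lemma \<Theta>_tens: "w \<in> tpow 2 \<Longrightarrow> \<Theta> y \<cdot>\<^sub>2 (tens [a, b] \<cdot>\<^sub>2 w) = tsum2 (\<lambda>c d. tens [S d * a, S c * b] \<cdot>\<^sub>2 w) (\<Delta> y)"
  by (simp add: \<Theta>_expand tmult_tsum2)

lemma \<Delta>_tens: "w \<in> tpow 2 \<Longrightarrow> \<Delta> y \<cdot>\<^sub>2 (tens [a, b] \<cdot>\<^sub>2 w) = tsum2 (\<lambda>c d. tens [c * a, d * b] \<cdot>\<^sub>2 w) (\<Delta> y)"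
  by (simp add: tmult2_expand(2)[of "\<Delta> y"])

lemma gamma_expansions:
  "\<gamma> \<cdot>\<^sub>2 \<Delta> z = tsum3 (\<lambda>U V W. tens [S V, S U * \<alpha>] \<cdot>\<^sub>2 (q\<^sub>L \<cdot>\<^sub>2 \<Delta> (W * z))) \<Phi>i"
  "\<gamma>' \<cdot>\<^sub>2 \<Theta> z = tsum3 (\<lambda>U V W. tens [U * \<beta>, V] \<cdot>\<^sub>2 (p' \<cdot>\<^sub>2 \<Theta> (z * W))) \<Phi>"
  by (simp_all add: gamma_eq_q\<^sub>L gamma'_eq_p' tmult_tsum3 comult_mult \<Theta>_mult tmult_assoc)

lemma gamma_tens:
  "w \<in> tpow 2 \<Longrightarrow> \<gamma>' \<cdot>\<^sub>2 (tens [a, b] \<cdot>\<^sub>2 w)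
      = tsum3 (\<lambda>U V W. \<Delta> U \<cdot>\<^sub>2 (p\<^sub>R \<cdot>\<^sub>2 (tens [\<beta> * S W * a, S V * b] \<cdot>\<^sub>2 w))) \<Phi>i"
  "w \<in> tpow 2 \<Longrightarrow> \<gamma> \<cdot>\<^sub>2 (tens [a, b] \<cdot>\<^sub>2 w) = tsum3 (\<lambda>U V W. \<Theta> U \<cdot>\<^sub>2 (q' \<cdot>\<^sub>2 (tens [V * a, \<alpha> * W * b] \<cdot>\<^sub>2 w))) \<Phi>"
  by (simp_all add: gamma'_eq_p\<^sub>R gamma_eq_q' tmult_tsum3 tmult_assoc)

text \<open>
  Written with \<open>p\<^sub>R\<close> and \<open>q\<^sub>L\<close>, the left-hand side is a form evaluated at the product
  \<open>(1 \<otimes> \<Phi>\<^sup>-\<^sup>1)(1 \<otimes> \<Delta> \<otimes> 1)\<Phi>\<^sup>-\<^sup>1(\<Phi>\<^sup>-\<^sup>1 \<otimes> 1)\<close>, which the pentagon replaces by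
  \<open>(1 \<otimes> 1 \<otimes> \<Delta>)\<Phi>\<^sup>-\<^sup>1(\<Delta> \<otimes> 1 \<otimes> 1)\<Phi>\<^sup>-\<^sup>1\<close>.  Now \<open>p\<^sub>R\<close> and \<open>q\<^sub>L\<close> consume one coproduct each, and the
  two remaining sums over \<open>\<Phi>\<^sup>-\<^sup>1\<close> separate into a product of two units from \<open>pq_unit\<close>.
\<close>

lemma snake1: "tsum3 (\<lambda>x y z. \<Delta> x \<cdot>\<^sub>2 (\<gamma>' \<cdot>\<^sub>2 (\<Theta> y \<cdot>\<^sub>2 (\<gamma> \<cdot>\<^sub>2 \<Delta> z)))) \<Phi>i = tone 2"
proof -
  define f where "f a b c d = \<Delta> a \<cdot>\<^sub>2 (p\<^sub>R \<cdot>\<^sub>2 (tens [\<beta> * S c, S b * \<alpha>] \<cdot>\<^sub>2 (q\<^sub>L \<cdot>\<^sub>2 \<Delta> d)))" for a b c d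
  have f_in [simp]: "f a b c d \<in> tpow 2" for a b c d by (simp add: f_def)
  have f: "multilin4 tscale f" unfolding f_def by (rule multilin4I; intro lins; simp)
  have s: "multilin4 tscale (\<lambda>a b c d. f (x * a) (y * b) (z * c) (w * d))" for x y z w
    by (rule multilin4_shift[OF f])
  have s': "multilin4 tscale (\<lambda>a b c d. f a (y * b) (z * c) (w * d))" for y z w
    using s[of 1] by simp
  have "\<Delta> x \<cdot>\<^sub>2 (\<gamma>' \<cdot>\<^sub>2 (\<Theta> y \<cdot>\<^sub>2 (\<gamma> \<cdot>\<^sub>2 \<Delta> z))) =
    tsum3 (\<lambda>U V W. tsum2 (\<lambda>b c. tsum3 (\<lambda>U' V' W'. f (x * U') (U * (b * V')) (V * (c * W')) (W * z)) \<Phi>i) (\<Delta> y))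
        \<Phi>i" for x y z
    by (simp add: gamma_expansions(1) tmult_tsum3 tmult_tsum2 tsum_in_simps \<Theta>_tens gamma_tens(1) f_def
        comult_mult tmult_assoc mult.assoc)
  then have "tsum3 (\<lambda>x y z. \<Delta> x \<cdot>\<^sub>2 (\<gamma>' \<cdot>\<^sub>2 (\<Theta> y \<cdot>\<^sub>2 (\<gamma> \<cdot>\<^sub>2 \<Delta> z)))) \<Phi>i = 
    tsum3 (\<lambda>x y z. tsum3 (\<lambda>U V W. tsum2 (\<lambda>b c. tsum3 (\<lambda>U' V' W'. f (x * U') (U * (b * V')) (V * (c * W'))
        (W * z)) \<Phi>i) (\<Delta> y)) \<Phi>i) \<Phi>i"
    by simp
  also have "\<dots> = tsum4 f (padl \<Phi>i \<cdot>\<^sub>4 (\<Delta>1 \<Phi>i \<cdot>\<^sub>4 padr \<Phi>i))"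
    by (subst tsum_swap_curried(4))
      (simp add: tsum4_tcat_tmult[OF f] tsum4_comult_tmult[OF s'] tsum4_tcat[OF multilin4_shift[OF s']])
  also have "\<dots> = tsum4 f (\<Delta>2 \<Phi>i \<cdot>\<^sub>4 \<Delta>0 \<Phi>i)" by (simp add: pentagon_inv)
  also have "\<dots> = tsum3 (\<lambda>x y z. tsum3 (\<lambda>U V W. tsum2 (\<lambda>c d. tsum2 (\<lambda>a b. f (x * a) (y * b) (c * V) (d * W))
      (\<Delta> U)) (\<Delta> z)) \<Phi>i) \<Phi>i"
    by (simp add: tsum4_comult_tmult[OF f] tsum4_comult[OF s] tsum_swap_curried(2))
  also have "\<dots> = tsum3 (\<lambda>x y z. tsum3 (\<lambda>U V W.
      (\<Delta> x \<cdot>\<^sub>2 (p\<^sub>R \<cdot>\<^sub>2 tens [1, S y * \<alpha> * z])) \<cdot>\<^sub>2 (tens [U * \<beta> * S V, 1] \<cdot>\<^sub>2 (q\<^sub>L \<cdot>\<^sub>2 \<Delta> W))) \<Phi>i) \<Phi>i"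
  proof -
    have "tsum2 (\<lambda>a b. f (x * a) (y * b) (c * V) (d * W)) (\<Delta> U) =
      tsum2 (\<lambda>a b. \<Delta> x \<cdot>\<^sub>2 ((\<Delta> a \<cdot>\<^sub>2 (p\<^sub>R \<cdot>\<^sub>2 tens [1, S b])) \<cdot>\<^sub>2
        (tens [\<beta> * S V * S c, S y * \<alpha>] \<cdot>\<^sub>2 (q\<^sub>L \<cdot>\<^sub>2 \<Delta> (d * W))))) (\<Delta> U)" for x y c d U V W
      by (simp add: f_def comult_mult tmult_assoc mult.assoc)
    also have "\<dots> x y c d U V W = (\<Delta> x \<cdot>\<^sub>2 (p\<^sub>R \<cdot>\<^sub>2 tens [U * \<beta> * S V, S y * \<alpha>])) \<cdot>\<^sub>2
        ((tens [S c, 1] \<cdot>\<^sub>2 (q\<^sub>L \<cdot>\<^sub>2 \<Delta> d)) \<cdot>\<^sub>2 \<Delta> W)" for x y c d U V W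
      by (subst tsum2_sandwich) (simp_all add: p\<^sub>R_comult tmult_assoc comult_mult mult.assoc)
    finally have "tsum2 (\<lambda>c d. tsum2 (\<lambda>a b. f (x * a) (y * b) (c * V) (d * W)) (\<Delta> U)) (\<Delta> z) =
      (\<Delta> x \<cdot>\<^sub>2 (p\<^sub>R \<cdot>\<^sub>2 tens [U * \<beta> * S V, S y * \<alpha>])) \<cdot>\<^sub>2 ((tens [1, z] \<cdot>\<^sub>2 q\<^sub>L) \<cdot>\<^sub>2 \<Delta> W)" for x y z U V W
      by (simp only: ) (subst tsum2_sandwich, simp_all add: q\<^sub>L_comult)
    then show ?thesis by (simp add: tmult_assoc mult.assoc)
  qed
  also have "\<dots> = tsum3 (\<lambda>x y z. (\<Delta> x \<cdot>\<^sub>2 (p\<^sub>R \<cdot>\<^sub>2 tens [1, S y * \<alpha> * z])) \<cdot>\<^sub>2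
      tsum3 (\<lambda>U V W. tens [U * \<beta> * S V, 1] \<cdot>\<^sub>2 (q\<^sub>L \<cdot>\<^sub>2 \<Delta> W)) \<Phi>i) \<Phi>i"
    by (subst tmult_tsum3(2)) simp_all
  also have "\<dots> = tone 2" by (simp add: pq_unit)
  finally show ?thesis .
qed

text \<open>
  As for \<open>snake1\<close>, with \<open>q'\<close> and \<open>p'\<close> and with the pentagon for \<open>\<Phi>\<close> itself.
\<close>

lemma snake2: "tsum3 (\<lambda>X Y Z. \<Theta> X \<cdot>\<^sub>2 (\<gamma> \<cdot>\<^sub>2 (\<Delta> Y \<cdot>\<^sub>2 (\<gamma>' \<cdot>\<^sub>2 \<Theta> Z)))) \<Phi> = tone 2"
proof -
  define f where "f a b c d = \<Theta> a \<cdot>\<^sub>2 (q' \<cdot>\<^sub>2 (tens [b * \<beta>, \<alpha> * c] \<cdot>\<^sub>2 (p' \<cdot>\<^sub>2 \<Theta> d)))" for a b c d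
  have f_in [simp]: "f a b c d \<in> tpow 2" for a b c d by (simp add: f_def)
  have f: "multilin4 tscale f" unfolding f_def by (rule multilin4I; intro lins; simp)
  have s: "multilin4 tscale (\<lambda>a b c d. f (x * a) (y * b) (z * c) (w * d))" for x y z w
    by (rule multilin4_shift[OF f])
  have s': "multilin4 tscale (\<lambda>a b c d. f (x * a) (y * b) (z * c) d)" for x y z
    using s[of _ _ _ 1] by simp
  have "\<Theta> X \<cdot>\<^sub>2 (\<gamma> \<cdot>\<^sub>2 (\<Delta> Y \<cdot>\<^sub>2 (\<gamma>' \<cdot>\<^sub>2 \<Theta> Z))) =
    tsum3 (\<lambda>U' V' W'. tsum2 (\<lambda>b c. tsum3 (\<lambda>U V W. f (U * X) (V * (b * U')) (W * (c * V')) (Z * W')) \<Phi>) (\<Delta> Y))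
        \<Phi>" for X Y Z
    by (simp add: gamma_expansions(2) tmult_tsum3 tmult_tsum2 tsum_in_simps \<Delta>_tens gamma_tens(2) f_def \<Theta>_mult
        tmult_assoc mult.assoc)
  then have "tsum3 (\<lambda>X Y Z. \<Theta> X \<cdot>\<^sub>2 (\<gamma> \<cdot>\<^sub>2 (\<Delta> Y \<cdot>\<^sub>2 (\<gamma>' \<cdot>\<^sub>2 \<Theta> Z)))) \<Phi> =
    tsum3 (\<lambda>X Y Z. tsum3 (\<lambda>U V W. tsum2 (\<lambda>b c. tsum3 (\<lambda>U' V' W'. f (U * X) (V * (b * U')) (W * (c * V'))
        (Z * W')) \<Phi>) (\<Delta> Y)) \<Phi>) \<Phi>"
    by (subst tsum_swap_323) simp
  also have "\<dots> = tsum4 f (padr \<Phi> \<cdot>\<^sub>4 (\<Delta>1 \<Phi> \<cdot>\<^sub>4 padl \<Phi>))"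
    by (subst tsum_swap_curried(4))
      (simp add: tsum4_tcat_tmult[OF f] tsum4_comult_tmult[OF s'] tsum4_tcat[OF multilin4_shift[OF s']])
  also have "\<dots> = tsum4 f (\<Delta>0 \<Phi> \<cdot>\<^sub>4 \<Delta>2 \<Phi>)" by (simp add: pentagon_right_assoc)
  also have "\<dots> = tsum3 (\<lambda>U V W. tsum3 (\<lambda>X Y Z. tsum2 (\<lambda>a b. tsum2 (\<lambda>c d. f (a * U) (b * V) (Y * c) (Z * d))
      (\<Delta> W)) (\<Delta> X)) \<Phi>) \<Phi>"
    by (subst tsum_swap_curried(4)) (simp add: tsum4_comult_tmult[OF f] tsum4_comult[OF s]
        tsum_swap_curried(2))
  also have "\<dots> = tsum3 (\<lambda>U V W. tsum3 (\<lambda>X Y Z.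
      (\<Theta> U \<cdot>\<^sub>2 (q' \<cdot>\<^sub>2 tens [V * \<beta> * S W, 1])) \<cdot>\<^sub>2 (tens [1, S X * \<alpha> * Y] \<cdot>\<^sub>2 (p' \<cdot>\<^sub>2 \<Theta> Z))) \<Phi>) \<Phi>"
  proof -
    have "tsum2 (\<lambda>c d. f (a * U) (b * V) (Y * c) (Z * d)) (\<Delta> W) =
      tsum2 (\<lambda>c d. (\<Theta> U \<cdot>\<^sub>2 (\<Theta> a \<cdot>\<^sub>2 (q' \<cdot>\<^sub>2 tens [b * V * \<beta>, \<alpha> * Y]))) \<cdot>\<^sub>2 ((tens [1, c] \<cdot>\<^sub>2 (p' \<cdot>\<^sub>2 \<Theta> d)) \<cdot>\<^sub>2 \<Theta> Z))
          (\<Delta> W)"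
      for a b U V W Y Z
      by (simp add: f_def \<Theta>_mult tmult_assoc mult.assoc)
    also have "\<dots> a b U V W Y Z
        = \<Theta> U \<cdot>\<^sub>2 ((\<Theta> a \<cdot>\<^sub>2 (q' \<cdot>\<^sub>2 tens [b, 1])) \<cdot>\<^sub>2 (tens [V * \<beta> * S W, \<alpha> * Y] \<cdot>\<^sub>2 (p' \<cdot>\<^sub>2 \<Theta> Z)))"
      for a b U V W Y Z
      by (subst tsum2_sandwich) (simp_all add: p'_comult tmult_assoc mult.assoc)
    finally have "tsum2 (\<lambda>a b. tsum2 (\<lambda>c d. f (a * U) (b * V) (Y * c) (Z * d)) (\<Delta> W)) (\<Delta> X) =
      \<Theta> U \<cdot>\<^sub>2 ((q' \<cdot>\<^sub>2 tens [1, S X]) \<cdot>\<^sub>2 (tens [V * \<beta> * S W, \<alpha> * Y] \<cdot>\<^sub>2 (p' \<cdot>\<^sub>2 \<Theta> Z)))" for U V W X Y Z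
      by (simp only: ) (subst tsum2_sandwich, simp_all add: q'_comult)
    then show ?thesis by (simp add: tmult_assoc mult.assoc)
  qed
  also have "\<dots> = tsum3 (\<lambda>U V W. (\<Theta> U \<cdot>\<^sub>2 (q' \<cdot>\<^sub>2 tens [V * \<beta> * S W, 1])) \<cdot>\<^sub>2
      tsum3 (\<lambda>X Y Z. tens [1, S X * \<alpha> * Y] \<cdot>\<^sub>2 (p' \<cdot>\<^sub>2 \<Theta> Z)) \<Phi>) \<Phi>"
    by (subst tmult_tsum3(2)) simp_all
  also have "\<dots> = tone 2" by (simp add: pq_unit)
  finally show ?thesis .
qed

end

section \<open>The Drinfeld twist\<close>

context quasi_hopf_algebra
begin

abbreviation "F \<equiv> drinfeld_twist"

definition "Fi = tsum3 (\<lambda>X Y Z. \<Delta> (S X * \<alpha> * Y) \<cdot>\<^sub>2 (\<gamma>' \<cdot>\<^sub>2 \<Theta> Z)) \<Phi>"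

lemma F_eq: "F = tsum3 (\<lambda>X Y Z. \<Theta> X \<cdot>\<^sub>2 (\<gamma> \<cdot>\<^sub>2 \<Delta> (Y * \<beta> * S Z))) \<Phi>"
  by (simp add: drinfeld_twist_def tmap_trev[OF antipode_linear] \<Theta>_def[symmetric] tmult_assoc)

lemma F_in [simp]: "F \<in> tpow 2" "Fi \<in> tpow 2"
  by (auto simp: F_eq Fi_def intro!: tsum3_in)

text \<open>
  Evaluate \<open>\<Phi> (1 \<otimes> \<Delta>)\<Delta>(h) = (\<Delta> \<otimes> 1)\<Delta>(h) \<Phi>\<close> with the form that defines the twist.  On the left \<open>\<beta>\<close>
  absorbs the inner coproduct, on the right \<open>\<gamma>\<close> does.
\<close>

lemma F_\<Delta>: "F \<cdot>\<^sub>2 \<Delta> (S h) = \<Theta> h \<cdot>\<^sub>2 F"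
proof -
  define f where "f x y z = \<Theta> x \<cdot>\<^sub>2 (\<gamma> \<cdot>\<^sub>2 \<Delta> (y * \<beta> * S z))" for x y z
  have f_in [simp]: "f x y z \<in> tpow 2" for x y z by (simp add: f_def)
  have f: "multilin3 tscale f" unfolding f_def by (rule multilin3I; intro lins; simp)
  have F: "F = tsum3 f \<Phi>" by (simp add: F_eq f_def[abs_def])
  have r: "tsum2 (\<lambda>c d. f X (Y * c) (Z * d)) (\<Delta> a) = tscale (\<epsilon> a) (f X Y Z)" for a X Y Z
    using antipode_beta_lin[of tscale "\<lambda>t. \<Theta> X \<cdot>\<^sub>2 (\<gamma> \<cdot>\<^sub>2 \<Delta> (Y * t * S Z))" a]
    by (simp add: f_def mult.assoc lin_tmult lins)
  have l: "tsum2 (\<lambda>c d. f (c * X) (d * Y) Z) (\<Delta> a) = tscale (\<epsilon> a) (f X Y Z)" for a X Y Z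
  proof -
    have "tsum2 (\<lambda>c d. f (c * X) (d * Y) Z) (\<Delta> a) =
      tsum2 (\<lambda>c d. \<Theta> X \<cdot>\<^sub>2 ((\<Theta> c \<cdot>\<^sub>2 (\<gamma> \<cdot>\<^sub>2 \<Delta> d)) \<cdot>\<^sub>2 \<Delta> (Y * \<beta> * S Z))) (\<Delta> a)"
      by (simp add: f_def \<Theta>_mult comult_mult tmult_assoc)
    also have "\<dots> = tscale (\<epsilon> a) (f X Y Z)"
      by (subst tsum2_sandwich) (simp_all add: gamma_invariant f_def tmult_scale_left tmult_scale_right)
    finally show ?thesis .
  qed
  have counit: "tsum2 (\<lambda>a b. tscale (\<epsilon> b) (f (X * a) Y Z)) (\<Delta> h) = f (X * h) Y Z"
    "tsum2 (\<lambda>a b. tscale (\<epsilon> a) (f X Y (b * Z))) (\<Delta> h) = f X Y (h * Z)" for X Y Z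
    by (rule tsum2_counit(2), intro multilin3_lin[OF f] lins) (rule tsum2_counit(1), intro multilin3_lin[OF f]
        lins)
  have "\<Theta> h \<cdot>\<^sub>2 F = tsum3 (\<lambda>X Y Z. f (X * h) Y Z) \<Phi>"
    by (simp add: F tmult_tsum3) (simp add: f_def \<Theta>_mult tmult_assoc)
  also have "\<dots> = tsum3 (\<lambda>X Y Z. tsum2 (\<lambda>a b. tscale (\<epsilon> b) (f (X * a) Y Z)) (\<Delta> h)) \<Phi>"
    by (simp only: counit)
  also have "\<dots> = tsum3 (\<lambda>X Y Z. tsum2 (\<lambda>a b. tscale (\<epsilon> a) (f X Y (b * Z))) (\<Delta> h)) \<Phi>"
    using coassoc_eval(1)[OF f, of h] by (simp add: r l tsum_swap_curried(2))
  also have "\<dots> = tsum3 (\<lambda>X Y Z. f X Y (h * Z)) \<Phi>"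
    by (simp only: counit)
  also have "\<dots> = F \<cdot>\<^sub>2 \<Delta> (S h)"
    by (simp add: F tmult_tsum3) (simp add: f_def comult_mult tmult_assoc mult.assoc)
  finally show ?thesis by simp
qed

text \<open>
  Evaluate \<open>\<Phi> \<otimes> 1\<close>, written as a product of the other four factors of the pentagon: three of them are
  absorbed, and only \<open>1 \<otimes> \<Phi>\<^sup>-\<^sup>1\<close> survives.
\<close>

lemma F_alpha: "F \<cdot>\<^sub>2 \<Delta> \<alpha> = \<gamma>"
proof -
  define f where "f a b c d = \<Theta> a \<cdot>\<^sub>2 (\<gamma> \<cdot>\<^sub>2 \<Delta> (b * \<beta> * S c * \<alpha> * d))" for a b c d
  have f_in [simp]: "f a b c d \<in> tpow 2" for a b c d by (simp add: f_def)
  have f: "multilin4 tscale f" unfolding f_def by (rule multilin4I; intro lins; simp)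
  have l0: "tsum2 (\<lambda>x y. f (x * a) (y * b) c d) (\<Delta> h) = tscale (\<epsilon> h) (f a b c d)" for a b c d h
  proof -
    have "tsum2 (\<lambda>x y. f (x * a) (y * b) c d) (\<Delta> h) =
      tsum2 (\<lambda>x y. \<Theta> a \<cdot>\<^sub>2 ((\<Theta> x \<cdot>\<^sub>2 (\<gamma> \<cdot>\<^sub>2 \<Delta> y)) \<cdot>\<^sub>2 \<Delta> (b * \<beta> * S c * \<alpha> * d))) (\<Delta> h)"
      by (simp add: f_def \<Theta>_mult comult_mult tmult_assoc)
    also have "\<dots> = tscale (\<epsilon> h) (f a b c d)"
      by (subst tsum2_sandwich) (simp_all add: gamma_invariant f_def tmult_scale_left tmult_scale_right)
    finally show ?thesis .
  qed
  have l2: "tsum2 (\<lambda>x y. f a b (x * c) (y * d)) (\<Delta> h) = tscale (\<epsilon> h) (f a b c d)" for a b c d h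
    using antipode_alpha_lin[of tscale "\<lambda>t. \<Theta> a \<cdot>\<^sub>2 (\<gamma> \<cdot>\<^sub>2 \<Delta> (b * \<beta> * S c * t * d))" h]
    by (simp add: f_def mult.assoc lin_tmult lins)
  have r1: "tsum2 (\<lambda>x y. f a (b * x) (c * y) d) (\<Delta> h) = tscale (\<epsilon> h) (f a b c d)" for a b c d h
    using antipode_beta_lin[of tscale "\<lambda>t. \<Theta> a \<cdot>\<^sub>2 (\<gamma> \<cdot>\<^sub>2 \<Delta> (b * t * S c * \<alpha> * d))" h]
    by (simp add: f_def mult.assoc lin_tmult lins)
  have "F \<cdot>\<^sub>2 \<Delta> \<alpha> = tsum4 f (padr \<Phi>)"
    by (simp add: F_eq tmult_tsum3 tsum4_tcat[OF f] f_def tmult_assoc comult_mult)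
  also have "\<dots> = tsum4 f (padl \<Phi>i)"
    by (subst pentagon_variants(5))
      (simp add: absorb_left(1)[OF f _ _ l0] absorb_left(3)[OF f _ _ l2] absorb_right(2)[OF f _ _ r1])
  also have "\<dots> = tsum3 (\<lambda>x y z. \<gamma> \<cdot>\<^sub>2 \<Delta> (x * \<beta> * S y * \<alpha> * z)) \<Phi>i"
    by (simp add: tsum4_tcat[OF f] f_def)
  also have "\<dots> = \<gamma>"
    by (subst antipode_coassoc_lin(2)[of tscale]) (auto intro!: lins)
  finally show ?thesis .
qed

text \<open>
  As for \<open>F_alpha\<close>, starting from \<open>1 \<otimes> \<Phi>\<close>.  The factor that survives is \<open>\<Phi>\<^sup>-\<^sup>1 \<otimes> 1\<close>, and its
  evaluation is \<open>snake1\<close>.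
\<close>

lemma gamma'_F: "\<gamma>' \<cdot>\<^sub>2 F = \<Delta> \<beta>"
proof -
  define f where "f a b c d = \<Delta> a \<cdot>\<^sub>2 (\<gamma>' \<cdot>\<^sub>2 (\<Theta> b \<cdot>\<^sub>2 (\<gamma> \<cdot>\<^sub>2 \<Delta> (c * \<beta> * S d))))" for a b c d
  have f_in [simp]: "f a b c d \<in> tpow 2" for a b c d by (simp add: f_def)
  have f: "multilin4 tscale f" unfolding f_def by (rule multilin4I; intro lins; simp)
  have l1: "tsum2 (\<lambda>x y. f a (x * b) (y * c) d) (\<Delta> h) = tscale (\<epsilon> h) (f a b c d)" for a b c d h
  proof -
    have "tsum2 (\<lambda>x y. f a (x * b) (y * c) d) (\<Delta> h) =
      tsum2 (\<lambda>x y. (\<Delta> a \<cdot>\<^sub>2 (\<gamma>' \<cdot>\<^sub>2 \<Theta> b)) \<cdot>\<^sub>2 ((\<Theta> x \<cdot>\<^sub>2 (\<gamma> \<cdot>\<^sub>2 \<Delta> y)) \<cdot>\<^sub>2 \<Delta> (c * \<beta> * S d))) (\<Delta> h)"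
      by (simp add: f_def \<Theta>_mult comult_mult tmult_assoc)
    also have "\<dots> = tscale (\<epsilon> h) (f a b c d)"
      by (subst tsum2_sandwich) (simp_all add: gamma_invariant f_def tmult_scale_left tmult_scale_right
          tmult_assoc)
    finally show ?thesis .
  qed
  have r0: "tsum2 (\<lambda>x y. f (a * x) (b * y) c d) (\<Delta> h) = tscale (\<epsilon> h) (f a b c d)" for a b c d h
  proof -
    have "tsum2 (\<lambda>x y. f (a * x) (b * y) c d) (\<Delta> h) =
      tsum2 (\<lambda>x y. \<Delta> a \<cdot>\<^sub>2 ((\<Delta> x \<cdot>\<^sub>2 (\<gamma>' \<cdot>\<^sub>2 \<Theta> y)) \<cdot>\<^sub>2 (\<Theta> b \<cdot>\<^sub>2 (\<gamma> \<cdot>\<^sub>2 \<Delta> (c * \<beta> * S d))))) (\<Delta> h)"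
      by (simp add: f_def \<Theta>_mult comult_mult tmult_assoc)
    also have "\<dots> = tscale (\<epsilon> h) (f a b c d)"
      by (subst tsum2_sandwich) (simp_all add: gamma'_invariant f_def tmult_scale_left tmult_scale_right
          tmult_assoc)
    finally show ?thesis .
  qed
  have r2: "tsum2 (\<lambda>x y. f a b (c * x) (d * y)) (\<Delta> h) = tscale (\<epsilon> h) (f a b c d)" for a b c d h
    using antipode_beta_lin[of tscale "\<lambda>t. \<Delta> a \<cdot>\<^sub>2 (\<gamma>' \<cdot>\<^sub>2 (\<Theta> b \<cdot>\<^sub>2 (\<gamma> \<cdot>\<^sub>2 \<Delta> (c * t * S d))))" h]
    by (simp add: f_def mult.assoc lin_tmult lins)
  have "\<gamma>' \<cdot>\<^sub>2 F = tsum4 f (padl \<Phi>)"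
    by (simp add: F_eq tmult_tsum3 tsum4_tcat[OF f] f_def)
  also have "\<dots> = tsum4 f (padr \<Phi>i)"
    by (subst pentagon_variants(6))
      (simp add: absorb_left(2)[OF f _ _ l1] tmult_assoc[symmetric] absorb_right(3)[OF f _ _ r2]
          absorb_right(1)[OF f _ _ r0])
  also have "\<dots> = tsum3 (\<lambda>x y z. \<Delta> x \<cdot>\<^sub>2 (\<gamma>' \<cdot>\<^sub>2 (\<Theta> y \<cdot>\<^sub>2 (\<gamma> \<cdot>\<^sub>2 \<Delta> z)))) \<Phi>i \<cdot>\<^sub>2 \<Delta> \<beta>"
    by (simp add: tsum4_tcat[OF f] f_def tmult_tsum3 comult_mult tmult_assoc)
  also have "\<dots> = \<Delta> \<beta>" by (simp add: snake1)
  finally show ?thesis .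
qed

lemma F_Fi: "F \<cdot>\<^sub>2 Fi = tone 2"
proof -
  have "F \<cdot>\<^sub>2 (\<Delta> (S X * \<alpha> * Y) \<cdot>\<^sub>2 (\<gamma>' \<cdot>\<^sub>2 \<Theta> Z)) = \<Theta> X \<cdot>\<^sub>2 (\<gamma> \<cdot>\<^sub>2 (\<Delta> Y \<cdot>\<^sub>2 (\<gamma>' \<cdot>\<^sub>2 \<Theta> Z)))" for X Y Z
  proof -
    have "F \<cdot>\<^sub>2 (\<Delta> (S X * \<alpha> * Y) \<cdot>\<^sub>2 (\<gamma>' \<cdot>\<^sub>2 \<Theta> Z)) = (F \<cdot>\<^sub>2 \<Delta> (S X)) \<cdot>\<^sub>2 (\<Delta> \<alpha> \<cdot>\<^sub>2 (\<Delta> Y \<cdot>\<^sub>2 (\<gamma>' \<cdot>\<^sub>2 \<Theta> Z)))"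
      by (simp add: comult_mult tmult_assoc)
    also have "\<dots> = \<Theta> X \<cdot>\<^sub>2 ((F \<cdot>\<^sub>2 \<Delta> \<alpha>) \<cdot>\<^sub>2 (\<Delta> Y \<cdot>\<^sub>2 (\<gamma>' \<cdot>\<^sub>2 \<Theta> Z)))"
      by (simp only: F_\<Delta>) (simp add: tmult_assoc)
    finally show ?thesis by (simp add: F_alpha)
  qed
  then show ?thesis by (simp add: Fi_def tmult_tsum3 snake2)
qed

lemma Fi_F: "Fi \<cdot>\<^sub>2 F = tone 2"
proof -
  have "\<Delta> (S X * \<alpha> * Y) \<cdot>\<^sub>2 (\<gamma>' \<cdot>\<^sub>2 (\<Theta> Z \<cdot>\<^sub>2 F)) = \<Delta> (S X * \<alpha> * Y * \<beta> * S Z)" for X Y Z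
  proof -
    have "\<gamma>' \<cdot>\<^sub>2 (\<Theta> Z \<cdot>\<^sub>2 F) = (\<gamma>' \<cdot>\<^sub>2 F) \<cdot>\<^sub>2 \<Delta> (S Z)"
      by (simp only: F_\<Delta>[symmetric] tmult_assoc gammas_in F_in comult_in)
    also have "\<dots> = \<Delta> (\<beta> * S Z)" by (simp only: gamma'_F comult_mult)
    finally show ?thesis by (simp only: comult_mult[symmetric] mult.assoc)
  qed
  then have "Fi \<cdot>\<^sub>2 F = tsum3 (\<lambda>X Y Z. \<Delta> (S X * \<alpha> * Y * \<beta> * S Z)) \<Phi>"
    by (simp add: Fi_def tmult_tsum3 tmult_assoc)
  also have "\<dots> = tone 2"
    by (subst antipode_coassoc_lin(1)[OF comult_linear]) simp
  finally show ?thesis .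
qed

end

section \<open>Counits and canonical elements\<close>

context k_algebra
begin

lemma tsum2_tsum3:
  assumes "multilin2 sW g" "u \<in> tpow 3" "\<And>a b c. G a b c \<in> tpow 2"
  shows "tsum2 g (tsum3 G u) = tsum3 (\<lambda>a b c. tsum2 g (G a b c)) u"
  using tsum_tsum[OF multilin2_mlin[OF assms(1)] multilin2_space[OF assms(1)] assms(2), of
      "\<lambda>xs. G (xs ! 0) (xs ! 1) (xs ! 2)"]
    assms by (simp add: tsum3_def tsum2_def)

lemma counit_at_tsum3:
  "lin (*) e \<Longrightarrow> u \<in> tpow 3 \<Longrightarrow> i < 2 \<Longrightarrow> (\<And>a b c. G a b c \<in> tpow 2) \<Longrightarrow>
    counit_at e 2 i (tsum3 G u) = tsum3 (\<lambda>a b c. counit_at e 2 i (G a b c)) u"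
  by (simp add: tsum3_def counit_at_tsum)

end

context quasi_hopf_algebra
begin

lemma counit_sum:
  assumes "multilin2 sW g" and u: "u = \<Phi> \<or> u = \<Phi>i"
  shows "tsum3 (\<lambda>a b c. sW (\<epsilon> a) (g b c)) u = g 1 1"
    "tsum3 (\<lambda>a b c. sW (\<epsilon> b) (g a c)) u = g 1 1"
    "tsum3 (\<lambda>a b c. sW (\<epsilon> c) (g a b)) u = g 1 1"
  using u tsum2_counit_at[OF assms(1), of _ \<epsilon>, symmetric] by (auto simp: tone_tens tsum2_pure[OF assms(1)])

lemma counit_sums:
  assumes h: "lin sW h" and u: "u = \<Phi> \<or> u = \<Phi>i"
  shows "tsum3 (\<lambda>a b c. sW (\<epsilon> b * \<epsilon> c) (h a)) u = h 1"
    "tsum3 (\<lambda>a b c. sW (\<epsilon> a * \<epsilon> b) (h c)) u = h 1"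
proof -
  interpret W: vector_space sW by (rule lin_vector_space[OF h])
  have "multilin2 sW (\<lambda>a c. sW (\<epsilon> c) (h a))" "multilin2 sW (\<lambda>b c. sW (\<epsilon> b) (h c))"
    by (intro multilin2I lin_scale_value lin_scalar counit_linear h W.vector_space_axioms)+
  from this[THEN counit_sum(2)[OF _ u]] this[THEN counit_sum(1)[OF _ u]]
  show "tsum3 (\<lambda>a b c. sW (\<epsilon> b * \<epsilon> c) (h a)) u = h 1"
    "tsum3 (\<lambda>a b c. sW (\<epsilon> a * \<epsilon> b) (h c)) u = h 1" by (simp_all add: W.scale_scale)
qed

context
  assumes counit_alpha: "\<epsilon> \<alpha> = 1"
begin

lemma counit_S: "\<epsilon> (S a) = \<epsilon> a"
proof -
  have "tsum2 (\<lambda>b c. \<epsilon> c * \<epsilon> (S b)) (\<Delta> a) = \<epsilon> (S a)"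
    by (rule tsum2_counit(2)) (intro lin_counit lins)
  moreover have "tsum2 (\<lambda>b c. \<epsilon> (S b * \<alpha> * c)) (\<Delta> a) = \<epsilon> a"
    using antipode_alpha_lin[OF counit_linear, of a] by (simp add: counit_alpha)
  ultimately show ?thesis by (simp add: counit_mult counit_alpha mult.commute)
qed

lemma counit_beta: "\<epsilon> \<beta> = 1"
proof -
  have "tsum3 (\<lambda>X Y Z. (\<epsilon> Y * \<epsilon> Z) * (\<epsilon> X * \<epsilon> \<beta>)) \<Phi> = \<epsilon> 1 * \<epsilon> \<beta>"
  proof (rule counit_sums(1)[where h = "\<lambda>a. \<epsilon> a * \<epsilon> \<beta>"])
    show "lin (*) (\<lambda>a. \<epsilon> a * \<epsilon> \<beta>)"
      using lin_scale_value[OF counit_linear, of "\<epsilon> \<beta>"] by (simp add: mult.commute)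
  qed simp
  then have "tsum3 (\<lambda>X Y Z. \<epsilon> (S X * \<alpha> * Y * \<beta> * S Z)) \<Phi> = \<epsilon> \<beta>"
    by (simp add: counit_mult counit_S counit_alpha mult_ac)
  then show ?thesis using antipode_coassoc_lin(1)[OF counit_linear] by simp
qed

lemma counit_\<Theta>: "counit_at \<epsilon> 2 0 (\<Theta> a) = tens [S a]" "counit_at \<epsilon> 2 1 (\<Theta> a) = tens [S a]"
  using tanti_counit_at[OF antipode_linear counit_linear counit_S comult_in, of 0 1 1 a]
    tanti_counit_at[OF antipode_linear counit_linear counit_S comult_in, of 1 0 1 a]
  by (simp_all add: \<Theta>_def counit_left counit_right antipode_linear)

lemma counit_at_tens2: "counit_at \<epsilon> 2 0 (tens [a, b]) = tscale (\<epsilon> a) (tens [b])"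
  "counit_at \<epsilon> 2 1 (tens [a, b]) = tscale (\<epsilon> b) (tens [a])"
  by (simp_all add: counit_at_tens[OF counit_linear])

lemma tmult1_tens [simp]: "tmult 1 (tens [a]) (tens [b]) = tens [a * b]"
  by simp

lemma counit_gamma: "counit_at \<epsilon> 2 0 \<gamma> = tens [\<alpha>]" "counit_at \<epsilon> 2 1 \<gamma> = tens [\<alpha>]"
proof -
  have q0: "counit_at \<epsilon> 2 0 q' = tone 1"
    using counit_sums(1)[of tscale "\<lambda>a. tens [S a]" \<Phi>i]
    by (simp add: q'_def counit_at_tsum3 counit_linear counit_at_tens2 counit_mult counit_S counit_alpha lins
        tone_tens)
  have q1: "counit_at \<epsilon> 2 1 q' = tens [\<alpha>]"
    using counit_sum(1)[of tscale "\<lambda>a b. tens [S a * \<alpha> * b]" \<Phi>i]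
    by (simp add: q'_def counit_at_tsum3 counit_linear counit_at_tens2 counit_S multilin2I lins)
  have 1: "counit_at \<epsilon> 2 i \<gamma>
      = tsum3 (\<lambda>X Y Z. tmult 1 (counit_at \<epsilon> 2 i (\<Theta> X)) (tmult 1 (counit_at \<epsilon> 2 i q')
      (counit_at \<epsilon> 2 i (tens [Y, \<alpha> * Z])))) \<Phi>"
    if "i < 2" for i
    using that unfolding gamma_eq_q' by (simp add: counit_at_tsum3 counit_linear counit_at_mult[where m = 1])
  show "counit_at \<epsilon> 2 0 \<gamma> = tens [\<alpha>]"
    using counit_sum(2)[of tscale "\<lambda>a c. tens [S a * \<alpha> * c]" \<Phi>] 
    by (simp add: 1 q0 counit_\<Theta> counit_at_tens2 tone_tens tmult_scale_right multilin2I lins mult.assoc)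
  show "counit_at \<epsilon> 2 1 \<gamma> = tens [\<alpha>]"
    using counit_sum(3)[of tscale "\<lambda>a b. tens [S a * \<alpha> * b]" \<Phi>] 
    by (simp add: 1 q1 counit_\<Theta> counit_at_tens2 tmult_scale_right multilin2I lins mult.assoc counit_mult
        counit_alpha)
qed

lemma counit_F: "counit_at \<epsilon> 2 0 F = tone 1" "counit_at \<epsilon> 2 1 F = tone 1"
proof -
  have 1: "counit_at \<epsilon> 2 i F
      = tsum3 (\<lambda>X Y Z. tmult 1 (counit_at \<epsilon> 2 i (\<Theta> X)) (tmult 1 (counit_at \<epsilon> 2 i \<gamma>)
      (counit_at \<epsilon> 2 i (\<Delta> (Y * \<beta> * S Z))))) \<Phi>"
    if "i < 2" for i
    using that unfolding F_eq by (simp add: counit_at_tsum3 counit_linear counit_at_mult[where m = 1])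
  show "counit_at \<epsilon> 2 0 F = tone 1" "counit_at \<epsilon> 2 1 F = tone 1"
    using antipode_coassoc_lin(1)[of tscale "\<lambda>t. tens [t]"]
    by (simp_all add: 1 counit_gamma counit_\<Theta> counit_left counit_right tone_tens lins mult.assoc)
qed

text \<open>
  The form \<open>x \<otimes> y \<mapsto> x \<beta> S(y)\<close> absorbs a right factor \<open>\<Delta>(w)\<close>.  This first reduces the twist to \<open>\<gamma>\<close>, and
  then \<open>\<gamma>\<close> to \<open>(1 \<otimes> \<alpha>) q\<^sub>L\<close>, whose value is the antipode axiom for \<open>\<Phi>\<close>.
\<close>

lemma beta_F: "tsum2 (\<lambda>x y. x * \<beta> * S y) F = S \<alpha>"
proof -
  define g where "g x y = x * \<beta> * S y" for x y
  have g: "multilin2 scale g" unfolding g_def by (intro multilin2I lins)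
  have absorb: "tsum2 g (u \<cdot>\<^sub>2 \<Delta> w) = \<epsilon> w *s tsum2 g u" if "u \<in> tpow 2" for u w
  proof -
    have "tsum2 (\<lambda>c d. g (a * c) (b * d)) (\<Delta> w) = \<epsilon> w *s g a b" for a b
      using antipode_beta_lin[of scale "\<lambda>t. a * t * S b" w] by (simp add: g_def lins mult.assoc)
    then have "tsum2 g (u \<cdot>\<^sub>2 \<Delta> w) = tsum2 (\<lambda>a b. \<epsilon> w *s g a b) u"
      using that by (simp add: tsum2_tmult[OF g])
    then show ?thesis using tsum2_additive[of "scale (\<epsilon> w)" g u] by (simp add: scale_right_distrib)
  qed
  have "tsum2 g F = tsum3 (\<lambda>X Y Z. (\<epsilon> Y * \<epsilon> Z) *s tsum2 g (\<Theta> X \<cdot>\<^sub>2 \<gamma>)) \<Phi>"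
    by (simp add: F_eq tsum2_tsum3[OF g] absorb tmult_assoc[symmetric] counit_mult counit_beta counit_S)
  also have "\<dots> = tsum2 g \<gamma>"
  proof -
    have "lin scale (\<lambda>X. tsum2 g (\<Theta> X \<cdot>\<^sub>2 \<gamma>))"
      unfolding tsum2_def by (rule lin_tsum_arg[OF _ _ multilin2_mlin[OF g]]) (auto intro!: lin_tmult lin_\<Theta>
          lin_id)
    from counit_sums(1)[OF this, of \<Phi>] show ?thesis by simp
  qed
  also have "\<dots> = tsum3 (\<lambda>x y z. \<epsilon> z *s tsum2 g (tens [S y, S x * \<alpha>] \<cdot>\<^sub>2 q\<^sub>L)) \<Phi>i"
    by (simp add: gamma_eq_q\<^sub>L tsum2_tsum3[OF g] absorb tmult_assoc[symmetric])
  also have "\<dots> = tsum2 g (tens [1, \<alpha>] \<cdot>\<^sub>2 q\<^sub>L)"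
  proof -
    have "multilin2 scale (\<lambda>x y. tsum2 g (tens [S y, S x * \<alpha>] \<cdot>\<^sub>2 q\<^sub>L))"
      unfolding tsum2_def by (rule multilin2I; rule lin_tsum_arg[OF _ _ multilin2_mlin[OF g]])
          (auto intro!: lins)
    from counit_sum(3)[OF this, of \<Phi>i] show ?thesis by simp
  qed
  also have "\<dots> = tsum3 (\<lambda>X Y Z. g (S X * \<alpha> * Y) (\<alpha> * Z)) \<Phi>"
    by (simp add: q\<^sub>L_def tmult_tsum3 tsum2_tsum3[OF g] tsum2_pure[OF g])
  also have "\<dots> = S \<alpha>"
    using antipode_coassoc_lin(1)[of scale "\<lambda>t. t * S \<alpha>"] by (simp add: g_def lins mult.assoc)
  finally show ?thesis by (simp add: g_def[abs_def])
qed

lemma alpha_Fi: "tsum2 (\<lambda>x y. S x * \<alpha> * y) Fi = S \<beta>"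
proof -
  define g where "g x y = S x * \<alpha> * y" for x y
  have g: "multilin2 scale g" unfolding g_def by (intro multilin2I lins)
  have absorb: "tsum2 g (\<Delta> w \<cdot>\<^sub>2 u) = \<epsilon> w *s tsum2 g u" if "u \<in> tpow 2" for u w
  proof -
    have "tsum2 (\<lambda>c d. g (c * a) (d * b)) (\<Delta> w) = \<epsilon> w *s g a b" for a b
      using antipode_alpha_lin[of scale "\<lambda>t. S a * t * b" w] by (simp add: g_def lins mult.assoc)
    then have "tsum2 g (\<Delta> w \<cdot>\<^sub>2 u) = tsum2 (\<lambda>a b. \<epsilon> w *s g a b) u"
      using that by (subst tsum2_tmult[OF g]) (simp_all add: tsum_swap_curried(1)[of _ u])
    then show ?thesis using tsum2_additive[of "scale (\<epsilon> w)" g u] by (simp add: scale_right_distrib)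
  qed
  have "tsum2 g Fi = tsum3 (\<lambda>X Y Z. (\<epsilon> X * \<epsilon> Y) *s tsum2 g (\<gamma>' \<cdot>\<^sub>2 \<Theta> Z)) \<Phi>"
    by (simp add: Fi_def tsum2_tsum3[OF g] absorb counit_mult counit_alpha counit_S)
  also have "\<dots> = tsum2 g \<gamma>'"
  proof -
    have "lin scale (\<lambda>X. tsum2 g (\<gamma>' \<cdot>\<^sub>2 \<Theta> X))"
      unfolding tsum2_def by (rule lin_tsum_arg[OF _ _ multilin2_mlin[OF g]]) (auto intro!: lin_tmult lin_\<Theta>
          lin_id)
    from counit_sums(2)[OF this, of \<Phi>] show ?thesis by simp
  qed
  also have "\<dots> = tsum3 (\<lambda>x y z. \<epsilon> x *s tsum2 g (p\<^sub>R \<cdot>\<^sub>2 tens [\<beta> * S z, S y])) \<Phi>i"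
    by (simp add: gamma'_eq_p\<^sub>R tsum2_tsum3[OF g] absorb)
  also have "\<dots> = tsum2 g (p\<^sub>R \<cdot>\<^sub>2 tens [\<beta>, 1])"
  proof -
    have "multilin2 scale (\<lambda>y z. tsum2 g (p\<^sub>R \<cdot>\<^sub>2 tens [\<beta> * S z, S y]))"
      unfolding tsum2_def by (rule multilin2I; rule lin_tsum_arg[OF _ _ multilin2_mlin[OF g]])
          (auto intro!: lins)
    from counit_sum(1)[OF this, of \<Phi>i] show ?thesis by simp
  qed
  also have "\<dots> = tsum3 (\<lambda>X Y Z. g (X * \<beta>) (Y * \<beta> * S Z)) \<Phi>"
    by (simp add: p\<^sub>R_def tmult_tsum3 tsum2_tsum3[OF g] tsum2_pure[OF g])
  also have "\<dots> = S \<beta>"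
    using antipode_coassoc_lin(1)[of scale "\<lambda>t. S \<beta> * t"] by (simp add: g_def lins mult.assoc)
  finally show ?thesis by (simp add: g_def[abs_def])
qed

end

end

section \<open>The coassociator twisted by the Drinfeld twist\<close>

context k_algebra
begin

text \<open>
  \<open>u \<otimes> c\<close> and \<open>c \<otimes> u\<close> for \<open>u \<in> H \<otimes> H\<close>.  They are constants in order that products of such tensors are
  computed in \<open>H \<otimes> H\<close>, even when \<open>u\<close> is a pure tensor.
\<close>

definition rten :: "('k, 'h) tensor \<Rightarrow> 'h \<Rightarrow> ('k, 'h) tensor"
  where "rten u c = tcat 2 1 u (tens [c])"
definition lten :: "'h \<Rightarrow> ('k, 'h) tensor \<Rightarrow> ('k, 'h) tensor"
  where "lten c u = tcat 1 2 (tens [c]) u"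

lemma rten_lten_mult [simp]:
  "u \<in> tpow 2 \<Longrightarrow> v \<in> tpow 2 \<Longrightarrow> rten u c \<cdot>\<^sub>3 rten v d = rten (u \<cdot>\<^sub>2 v) (c * d)"
  "u \<in> tpow 2 \<Longrightarrow> v \<in> tpow 2 \<Longrightarrow> lten c u \<cdot>\<^sub>3 lten d v = lten (c * d) (u \<cdot>\<^sub>2 v)"
  by (simp_all add: rten_def lten_def tcat_mult)

lemma rten_lten_in [simp]: "u \<in> tpow 2 \<Longrightarrow> rten u c \<in> tpow 3" "u \<in> tpow 2 \<Longrightarrow> lten c u \<in> tpow 3"
  by (simp_all add: rten_def lten_def)

lemma rten_lten_tens: "rten (tens [a, b]) c = tens [a, b, c]" "lten c (tens [a, b]) = tens [c, a, b]"
  by (simp_all add: rten_def lten_def)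

lemma rten_lten_mult' [simp]:
  "u \<in> tpow 2 \<Longrightarrow> v \<in> tpow 2 \<Longrightarrow> w \<in> tpow 3 \<Longrightarrow> rten u c \<cdot>\<^sub>3 (rten v d \<cdot>\<^sub>3 w) = rten (u \<cdot>\<^sub>2 v) (c * d) \<cdot>\<^sub>3 w"
  "u \<in> tpow 2 \<Longrightarrow> v \<in> tpow 2 \<Longrightarrow> w \<in> tpow 3 \<Longrightarrow> lten c u \<cdot>\<^sub>3 (lten d v \<cdot>\<^sub>3 w) = lten (c * d) (u \<cdot>\<^sub>2 v) \<cdot>\<^sub>3 w"
  by (simp_all flip: tmult_assoc)

lemma rten_lten_one [simp]: "rten (tone 2) 1 = tone 3" "lten 1 (tone 2) = tone 3"
  by (simp_all add: tone_tens rten_lten_tens)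

text \<open>
  The middle factor \<open>a \<otimes> s \<otimes> t\<close> is \<open>(a \<otimes> s) \<otimes> t\<close> for its left neighbour and \<open>a \<otimes> (s \<otimes> t)\<close> for its right one.
\<close>

lemma rten_lten_exchange:
  assumes "u \<in> tpow 2" "w \<in> tpow 2"
  shows "rten (u \<cdot>\<^sub>2 tens [a, s]) (c * t) \<cdot>\<^sub>3 lten d w = rten u c \<cdot>\<^sub>3 lten (a * d) (tens [s, t] \<cdot>\<^sub>2 w)"
proof -
  have "rten (u \<cdot>\<^sub>2 tens [a, s]) (c * t) \<cdot>\<^sub>3 lten d w = rten u c \<cdot>\<^sub>3 (rten (tens [a, s]) t \<cdot>\<^sub>3 lten d w)"
    using assms by simp
  also have "rten (tens [a, s]) t = lten a (tens [s, t])" by (simp add: rten_lten_tens)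
  finally show ?thesis using assms by simp
qed

lemma rten_lten_tsum:
  "u \<in> tpow 2 \<Longrightarrow> (\<And>a b. G a b \<in> tpow 2) \<Longrightarrow> rten (tsum2 G u) c = tsum2 (\<lambda>a b. rten (G a b) c) u"
  "u \<in> tpow 2 \<Longrightarrow> (\<And>a b. G a b \<in> tpow 2) \<Longrightarrow> lten c (tsum2 G u) = tsum2 (\<lambda>a b. lten c (G a b)) u"
  "v \<in> tpow 3 \<Longrightarrow> (\<And>x y z. H x y z \<in> tpow 2) \<Longrightarrow> rten (tsum3 H v) c = tsum3 (\<lambda>x y z. rten (H x y z) c) v"
  "v \<in> tpow 3 \<Longrightarrow> (\<And>x y z. H x y z \<in> tpow 2) \<Longrightarrow> lten c (tsum3 H v) = tsum3 (\<lambda>x y z. lten c (H x y z)) v"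
  by (simp_all add: tsum2_def tsum3_def rten_def lten_def tcat_tsum_left tcat_tsum_right)

lemma lin_rten_lten:
  "lin tscale h \<Longrightarrow> (\<And>x. h x \<in> tpow 2) \<Longrightarrow> lin tscale (\<lambda>x. rten (h x) c)"
  "lin tscale h \<Longrightarrow> (\<And>x. h x \<in> tpow 2) \<Longrightarrow> lin tscale (\<lambda>x. lten c (h x))"
  "lin scale k \<Longrightarrow> u \<in> tpow 2 \<Longrightarrow> lin tscale (\<lambda>x. rten u (k x))"
  "lin scale k \<Longrightarrow> u \<in> tpow 2 \<Longrightarrow> lin tscale (\<lambda>x. lten (k x) u)"
  by (simp_all add: rten_def lten_def lin_tcat lin_tens1)

lemma comult_at_tens2:
  assumes "lin tscale D" "\<And>a. D a \<in> tpow 2"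
  shows "comult_at D 2 0 (tens [a, b]) = rten (D a) b" "comult_at D 2 1 (tens [a, b]) = lten a (D b)"
proof -
  show "comult_at D 2 0 (tens [a, b]) = rten (D a) b"
    using rten_lten_tsum(1)[of "D a" "\<lambda>a b. tens [a, b]" b] assms
    by (simp add: comult_at_tens[OF assms] tsum_2 rten_lten_tens)
  show "comult_at D 2 1 (tens [a, b]) = lten a (D b)"
    using rten_lten_tsum(2)[of "D b" "\<lambda>a b. tens [a, b]" a] assms
    by (simp add: comult_at_tens[OF assms] tsum_2 rten_lten_tens)
qed

lemma comult_at_eval2:
  assumes "lin tscale D" "\<And>a. D a \<in> tpow 2" "u \<in> tpow 2"
  shows "comult_at D 2 0 u = tsum2 (\<lambda>a b. rten (D a) b) u" "comult_at D 2 1 u = tsum2 (\<lambda>a b. lten a (D b)) u"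
  using comult_at_tsum[OF assms(1,2), of _ 2 u 2 tens] assms(3)
  by (simp_all add: tsum_2[OF assms(3)] comult_at_tens2[OF assms(1,2)])

lemma comult_at_tsum4:
  assumes "lin tscale D" "\<And>a. D a \<in> tpow 2" "u \<in> tpow 4" "i < 2" "\<And>a b c d. G a b c d \<in> tpow 2"
  shows "comult_at D 2 i (tsum4 G u) = tsum4 (\<lambda>a b c d. comult_at D 2 i (G a b c d)) u"
  using assms by (simp add: tsum4_def comult_at_tsum)

lemma tmult_tsum4:
  "u \<in> tpow 4 \<Longrightarrow> v \<in> tpow m \<Longrightarrow> (\<And>a b c d. G a b c d \<in> tpow m) \<Longrightarrow> tmult m (tsum4 G u) v
      = tsum4 (\<lambda>a b c d. tmult m (G a b c d) v) u"
  "u \<in> tpow 4 \<Longrightarrow> v \<in> tpow m \<Longrightarrow> (\<And>a b c d. G a b c d \<in> tpow m) \<Longrightarrow> tmult m v (tsum4 G u)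
      = tsum4 (\<lambda>a b c d. tmult m v (G a b c d)) u"
  by (simp_all add: tsum4_def tmult_tsum_left tmult_tsum_right)

end

context quasi_hopf_algebra
begin

abbreviation "\<Delta>l u \<equiv> comult_at \<Delta> 2 0 u"
abbreviation "\<Delta>r u \<equiv> comult_at \<Delta> 2 1 u"

lemmas \<Delta>lr_eval = comult_at_eval2[OF comult_linear comult_in]
lemmas \<Delta>lr_tens = comult_at_tens2[OF comult_linear comult_in]

lemma \<Delta>lr_mult: "u \<in> tpow 2 \<Longrightarrow> v \<in> tpow 2 \<Longrightarrow> \<Delta>l (u \<cdot>\<^sub>2 v) = \<Delta>l u \<cdot>\<^sub>3 \<Delta>l v"
  "u \<in> tpow 2 \<Longrightarrow> v \<in> tpow 2 \<Longrightarrow> \<Delta>r (u \<cdot>\<^sub>2 v) = \<Delta>r u \<cdot>\<^sub>3 \<Delta>r v"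
  by (simp_all add: comult_at_mult[OF comult_hom])

text \<open>
  \<open>\<gamma>\<close> is a sum over \<open>\<Phi>\<close> in which \<open>q'\<close> is enclosed, and the sum over \<open>\<Phi>\<^sup>-\<^sup>1\<close> cancels that \<open>\<Phi>\<close>.
\<close>

lemma gamma_coassoc_inv: "tsum3 (\<lambda>x y z. \<Theta> x \<cdot>\<^sub>2 (\<gamma> \<cdot>\<^sub>2 tens [y, z])) \<Phi>i = q' \<cdot>\<^sub>2 tens [1, \<alpha>]"
proof -
  define f where "f a b c = \<Theta> a \<cdot>\<^sub>2 (q' \<cdot>\<^sub>2 tens [b, \<alpha> * c])" for a b c
  have f_in [simp]: "f a b c \<in> tpow 2" for a b c by (simp add: f_def)
  have f: "multilin3 tscale f" unfolding f_def by (rule multilin3I; intro lins; simp)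
  have "tsum3 (\<lambda>x y z. \<Theta> x \<cdot>\<^sub>2 (\<gamma> \<cdot>\<^sub>2 tens [y, z])) \<Phi>i =
    tsum3 (\<lambda>x y z. tsum3 (\<lambda>X Y Z. f (X * x) (Y * y) (Z * z)) \<Phi>) \<Phi>i"
    by (simp add: gamma_eq_q' tmult_tsum3 f_def \<Theta>_mult tmult_assoc mult.assoc)
  also have "\<dots> = tsum3 f (\<Phi> \<cdot>\<^sub>3 \<Phi>i)"
    by (subst tsum_swap_curried(4)) (simp add: tsum3_tmult[OF f] del: coassoc_inv)
  also have "\<dots> = q' \<cdot>\<^sub>2 tens [1, \<alpha>]"
    by (simp add: tone_tens tsum3_pure[OF f]) (simp add: f_def)
  finally show ?thesis .
qed

text \<open>
  The left-hand side is a form evaluated at \<open>(1 \<otimes> \<Delta> \<otimes> 1)\<Phi>(1 \<otimes> \<Phi>)\<close>. After the pentagon the factor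
  \<open>\<Phi>\<^sup>-\<^sup>1 \<otimes> 1\<close> cancels against \<open>\<gamma>\<close> by \<open>gamma_coassoc_inv\<close>, and the coproduct that remains next to
  \<open>q'\<close> is moved away by \<open>q'_comult\<close>, which produces \<open>q\<^sub>L\<close>.
\<close>

lemma gamma_coassoc:
  "tsum3 (\<lambda>X Y Z. rten (\<Theta> X \<cdot>\<^sub>2 (\<gamma> \<cdot>\<^sub>2 \<Delta> Y)) Z \<cdot>\<^sub>3 \<Phi>) \<Phi> =
    tsum3 (\<lambda>U V W. rten (\<Theta> U \<cdot>\<^sub>2 q') 1 \<cdot>\<^sub>3 lten V (q\<^sub>L \<cdot>\<^sub>2 \<Delta> W)) \<Phi>"
proof -
  define k where "k a b c d = rten (\<Theta> a \<cdot>\<^sub>2 (\<gamma> \<cdot>\<^sub>2 tens [b, c])) d" for a b c d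
  define k' where "k' a b c d = rten (\<Theta> a \<cdot>\<^sub>2 (q' \<cdot>\<^sub>2 tens [b, \<alpha> * c])) d" for a b c d
  have k_in [simp]: "k a b c d \<in> tpow 3" "k' a b c d \<in> tpow 3" for a b c d by (simp_all add: k_def k'_def)
  have k: "multilin4 tscale k" "multilin4 tscale k'" unfolding k_def k'_def
    by (rule multilin4I; intro lins lin_rten_lten; simp)+
  have s: "multilin4 tscale (\<lambda>a b c d. k' (x * a) (y * b) (z * c) (w * d))" for x y z w
    by (rule multilin4_shift[OF k(2)])
  have s1: "multilin4 tscale (\<lambda>a b c d. k a (y * b) (z * c) (w * d))" for y z w
    using multilin4_shift[OF k(1), of 1] by simp
  have "rten (\<Theta> X \<cdot>\<^sub>2 (\<gamma> \<cdot>\<^sub>2 \<Delta> Y)) Z \<cdot>\<^sub>3 \<Phi> =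
    tsum2 (\<lambda>a b. tsum3 (\<lambda>U V W. k X (a * U) (b * V) (Z * W)) \<Phi>) (\<Delta> Y)" for X Y Z
  proof -
    have "rten (\<Theta> X \<cdot>\<^sub>2 (\<gamma> \<cdot>\<^sub>2 \<Delta> Y)) Z = tsum2 (\<lambda>a b. k X a b Z) (\<Delta> Y)"
      by (subst tmult2_expand(1)[of \<gamma> "\<Delta> Y"]) (simp_all add: tmult_tsum2 rten_lten_tsum k_def)
    moreover have "k X a b Z \<cdot>\<^sub>3 \<Phi> = tsum3 (\<lambda>U V W. k X (a * U) (b * V) (Z * W)) \<Phi>" for a b
    proof -
      have "k X a b Z \<cdot>\<^sub>3 \<Phi> = k X a b Z \<cdot>\<^sub>3 tsum3 (\<lambda>U V W. rten (tens [U, V]) W) \<Phi>"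
        by (simp add: rten_lten_tens)
      also have "\<dots> = tsum3 (\<lambda>U V W. k X (a * U) (b * V) (Z * W)) \<Phi>"
        by (simp only: tmult_tsum3 coassoc_in k_in rten_lten_in tens_in length_Cons list.size) 
          (simp add: k_def tmult_assoc)
      finally show ?thesis .
    qed
    ultimately show ?thesis by (simp add: tmult_tsum2)
  qed
  then have "tsum3 (\<lambda>X Y Z. rten (\<Theta> X \<cdot>\<^sub>2 (\<gamma> \<cdot>\<^sub>2 \<Delta> Y)) Z \<cdot>\<^sub>3 \<Phi>) \<Phi> = tsum4 k (\<Delta>1 \<Phi> \<cdot>\<^sub>4 padl \<Phi>)"
    by (simp add: tsum4_comult_tmult[OF k(1)] tsum4_tcat[OF multilin4_shift[OF k(1)]])
  also have "\<dots> = tsum4 k (padr \<Phi>i \<cdot>\<^sub>4 (\<Delta>0 \<Phi> \<cdot>\<^sub>4 \<Delta>2 \<Phi>))" by (simp add: pentagon_variants(7))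
  also have "\<dots> = tsum4 k' (\<Delta>0 \<Phi> \<cdot>\<^sub>4 \<Delta>2 \<Phi>)"
  proof -
    have "tsum3 (\<lambda>x y z. k (x * a) (y * b) (z * c) d) \<Phi>i = k' a b c d" for a b c d
    proof -
      have "tsum3 (\<lambda>x y z. k (x * a) (y * b) (z * c) d) \<Phi>i =
        rten (\<Theta> a \<cdot>\<^sub>2 (tsum3 (\<lambda>x y z. \<Theta> x \<cdot>\<^sub>2 (\<gamma> \<cdot>\<^sub>2 tens [y, z])) \<Phi>i \<cdot>\<^sub>2 tens [b, c])) d"
        by (simp add: tmult_tsum3 rten_lten_tsum k_def \<Theta>_mult tmult_assoc)
      then show ?thesis by (simp add: gamma_coassoc_inv k'_def tmult_assoc)
    qed
    then show ?thesis by (simp add: tsum4_tcat_tmult[OF k(1)] tsum_swap_curried(5))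
  qed
  also have "\<dots> = tsum3 (\<lambda>U V W. tsum3 (\<lambda>X Y Z. tsum2 (\<lambda>a b. tsum2 (\<lambda>c d. k' (a * U) (b * V) (Y * c) (Z * d))
      (\<Delta> W)) (\<Delta> X)) \<Phi>) \<Phi>"
    by (subst tsum_swap_curried(4)) (simp add: tsum4_comult_tmult[OF k(2)] tsum4_comult[OF s]
        tsum_swap_curried(2))
  also have "\<dots> = tsum3
      (\<lambda>U V W. tsum3 (\<lambda>X Y Z. tsum2 (\<lambda>c d. rten (\<Theta> U \<cdot>\<^sub>2 q') 1 \<cdot>\<^sub>3 lten V (tens [S X * \<alpha> * Y * c, Z * d]))
      (\<Delta> W)) \<Phi>) \<Phi>"
  proof -
    have "tsum2 (\<lambda>a b. k' (a * U) (b * V) (Y * c) (Z * d)) (\<Delta> X) =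
      rten (\<Theta> U \<cdot>\<^sub>2 (tsum2 (\<lambda>a b. \<Theta> a \<cdot>\<^sub>2 (q' \<cdot>\<^sub>2 tens [b, 1])) (\<Delta> X) \<cdot>\<^sub>2 tens [V, \<alpha> * Y * c])) (Z * d)" for U V X
          Y Z c d
      by (simp add: tmult_tsum2 rten_lten_tsum k'_def \<Theta>_mult tmult_assoc mult.assoc)
    then have eq: "tsum2 (\<lambda>a b. k' (a * U) (b * V) (Y * c) (Z * d)) (\<Delta> X) =
      rten ((\<Theta> U \<cdot>\<^sub>2 q') \<cdot>\<^sub>2 tens [V, S X * \<alpha> * Y * c]) (1 * (Z * d)) \<cdot>\<^sub>3 lten 1 (tone 2)" for U V X Y Z c d
      by (simp add: q'_comult tmult_assoc mult.assoc)
    have "tsum2 (\<lambda>a b. tsum2 (\<lambda>c d. k' (a * U) (b * V) (Y * c) (Z * d)) (\<Delta> W)) (\<Delta> X) =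
      tsum2 (\<lambda>c d. rten (\<Theta> U \<cdot>\<^sub>2 q') 1 \<cdot>\<^sub>3 lten V (tens [S X * \<alpha> * Y * c, Z * d])) (\<Delta> W)" for U V W X Y Z
      by (subst tsum_swap_curried(1)) (simp only: eq rten_lten_exchange tmult_in \<Theta>_in pq_in tone_in, simp)
    then show ?thesis by simp
  qed
  also have "\<dots> = tsum3 (\<lambda>U V W. rten (\<Theta> U \<cdot>\<^sub>2 q') 1 \<cdot>\<^sub>3 lten V (q\<^sub>L \<cdot>\<^sub>2 \<Delta> W)) \<Phi>"
    by (simp add: q\<^sub>L_\<Delta> rten_lten_tsum tmult_tsum3 tmult_tsum2 tsum_in_simps)
  finally show ?thesis .
qed


end

context quasi_hopf_algebra
begin

text \<open>
  \<open>\<Omega> = (S \<otimes> S \<otimes> S)\<Phi>\<^sub>3\<^sub>2\<^sub>1\<close> is the coassociator of the structure obtained by twisting with \<open>F\<close>.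
\<close>

definition \<Omega> where "\<Omega> = tanti 3 S \<Phi>"

lemma \<Omega>_in [simp]: "\<Omega> \<in> tpow 3" by (simp add: \<Omega>_def)

lemma \<Omega>_eval: "\<Omega> = tsum3 (\<lambda>X Y Z. tens [S Z, S Y, S X]) \<Phi>"
  by (simp add: \<Omega>_def tanti_def tsum_3)

text \<open>
  These two elements are what distinguishes the two bracketings in \<open>right_gamma\<close> and \<open>left_gamma\<close>.
\<close>

definition "M' = tsum3 (\<lambda>x y z. lten (S y * \<alpha> * z) (\<Theta> x)) \<Phi>i"
definition "M = tsum3 (\<lambda>x y z. rten (\<Theta> y \<cdot>\<^sub>2 q') (S x) \<cdot>\<^sub>3 lten z (tone 2)) \<Phi>i"

lemma M_in [simp]: "M' \<in> tpow 3" "M \<in> tpow 3"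
  by (auto simp: M_def M'_def intro!: tsum3_in)

text \<open>
  Writing out \<open>q'\<close> turns the right-hand side into an evaluation of \<open>(1 \<otimes> \<Phi>\<^sup>-\<^sup>1)(1 \<otimes> \<Delta> \<otimes> 1)\<Phi>\<^sup>-\<^sup>1\<close>; by the
  pentagon, and after absorbing \<open>(1 \<otimes> 1 \<otimes> \<Delta>)\<Phi>\<^sup>-\<^sup>1\<close>, it becomes one of
  \<open>(\<Delta> \<otimes> 1 \<otimes> 1)\<Phi>\<^sup>-\<^sup>1(\<Phi> \<otimes> 1)\<close>, where \<open>\<Phi>\<close> contributes \<open>\<Omega>\<close>.
\<close>

lemma \<Omega>_M': "\<Omega> \<cdot>\<^sub>3 M' = M"
proof -
  define m where "m a b c d = tens [S c * \<alpha> * d, S b, S a]" for a b c d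
  have m: "multilin4 tscale m" unfolding m_def by (intro multilin4I lins)
  have s: "multilin4 tscale (\<lambda>a b c d. m a (y * b) (z * c) (w * d))" for y z w
    using multilin4_shift[OF m, of 1] by simp
  have s': "multilin4 tscale (\<lambda>a b c d. m (x * a) (y * b) (z * c) d)" for x y z
    using multilin4_shift[OF m, of _ _ _ 1] by simp
  have l: "tsum2 (\<lambda>x y. m a b (x * c) (y * d)) (\<Delta> h) = tscale (\<epsilon> h) (m a b c d)" for a b c d h
    using antipode_alpha_lin[of tscale "\<lambda>t. tens [S c * t * d, S b, S a]" h]
      by (simp add: m_def lins mult.assoc)
  have "M = tsum3 (\<lambda>x y z. tsum3 (\<lambda>X Y Z. tsum2 (\<lambda>b c. m x (X * b) (Y * c) (Z * z)) (\<Delta> y)) \<Phi>i) \<Phi>i"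
    by (simp add: M_def \<Theta>_q' rten_lten_tsum tmult_tsum3 tmult_tsum2 tsum_in_simps m_def tone_tens(2)
        rten_lten_tens mult.assoc)
  also have "\<dots> = tsum4 m (padl \<Phi>i \<cdot>\<^sub>4 \<Delta>1 \<Phi>i)"
    by (subst tsum_swap_curried(4)) (simp add: tsum4_tcat_tmult[OF m] tsum4_comult[OF s])
  also have "\<dots> = tsum4 m (\<Delta>0 \<Phi>i \<cdot>\<^sub>4 padr \<Phi>)"
    by (simp add: pentagon_variants(8) absorb_left(3)[OF m _ _ l])
  also have "\<dots> = tsum3 (\<lambda>x y z. tsum2 (\<lambda>a b. tsum3 (\<lambda>X Y Z. m (a * X) (b * Y) (y * Z) z) \<Phi>) (\<Delta> x)) \<Phi>i"
    by (simp add: tsum4_comult_tmult[OF m] tsum4_tcat[where sW = tscale] m_def lins multilin4I)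
  also have "\<dots> = \<Omega> \<cdot>\<^sub>3 M'"
    by (simp add: M'_def \<Omega>_eval \<Theta>_expand rten_lten_tsum tmult_tsum3 tmult_tsum2 tsum_in_simps m_def
      rten_lten_tens mult.assoc)
  finally show ?thesis by simp
qed

lemma anti_comult2:
  "tanti 3 S (\<Delta>l (\<Delta> x)) = tsum2 (\<lambda>a b. lten (S b) (\<Theta> a)) (\<Delta> x)"
  "tanti 3 S (\<Delta>r (\<Delta> x)) = tsum2 (\<lambda>a b. rten (\<Theta> b) (S a)) (\<Delta> x)"
proof -
  have a: "tanti 3 S (rten u c) = lten (S c) (tanti 2 S u)" "tanti 3 S (lten c u) = rten (tanti 2 S u) (S c)"
    if "u \<in> tpow 2" for u c
    using that by (simp_all add: rten_def lten_def tanti_tcat[OF antipode_linear] antipode_linear)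
  have t: "tanti 3 S (tsum2 G u) = tsum2 (\<lambda>a b. tanti 3 S (G a b)) u" if "u \<in> tpow 2" "\<And>a b. G a b \<in> tpow 3"
      for G u
    using that by (simp add: tsum2_def tanti_tsum[OF antipode_linear])
  show "tanti 3 S (\<Delta>l (\<Delta> x)) = tsum2 (\<lambda>a b. lten (S b) (\<Theta> a)) (\<Delta> x)"
  "tanti 3 S (\<Delta>r (\<Delta> x)) = tsum2 (\<lambda>a b. rten (\<Theta> b) (S a)) (\<Delta> x)"
    by (simp_all add: \<Delta>lr_eval t a \<Theta>_def)
qed

lemma F_comult_gamma: "F \<cdot>\<^sub>2 \<Delta> (S a * \<alpha> * b) = \<Theta> a \<cdot>\<^sub>2 (\<gamma> \<cdot>\<^sub>2 \<Delta> b)"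
proof -
  have "F \<cdot>\<^sub>2 \<Delta> (S a * \<alpha> * b) = (F \<cdot>\<^sub>2 \<Delta> (S a)) \<cdot>\<^sub>2 (\<Delta> \<alpha> \<cdot>\<^sub>2 \<Delta> b)"
    by (simp add: comult_mult tmult_assoc)
  also have "\<dots> = \<Theta> a \<cdot>\<^sub>2 ((F \<cdot>\<^sub>2 \<Delta> \<alpha>) \<cdot>\<^sub>2 \<Delta> b)"
    by (simp only: F_\<Delta>) (simp add: tmult_assoc)
  finally show ?thesis by (simp add: F_alpha)
qed

lemma right_gamma:
  "lten 1 F \<cdot>\<^sub>3 \<Delta>r \<gamma> = tsum3 (\<lambda>X Y Z. tanti 3 S (\<Delta>l (\<Delta> X)) \<cdot>\<^sub>3 (M' \<cdot>\<^sub>3 lten Y (\<gamma> \<cdot>\<^sub>2 \<Delta> Z))) \<Phi>"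
proof -
  define f where "f a b c d = lten (S b * \<alpha> * c) (\<Theta> a \<cdot>\<^sub>2 (\<gamma> \<cdot>\<^sub>2 \<Delta> d))" for a b c d
  have f: "multilin4 tscale f" unfolding f_def by (rule multilin4I; intro lins lin_rten_lten; simp)
  have "lten 1 F \<cdot>\<^sub>3 \<Delta>r \<gamma> = tsum4 f (padr \<Phi>i \<cdot>\<^sub>4 \<Delta>0 \<Phi>)"
    unfolding gamma_eq_tsum4(1)
    by (simp add: comult_at_tsum4 comult_linear \<Delta>lr_tens tmult_tsum4 F_comult_gamma f_def[abs_def])
  also have "\<dots> = tsum3 (\<lambda>X Y Z. tsum3 (\<lambda>x y z. tsum2 (\<lambda>a b. f (x * a) (y * b) (z * Y) Z) (\<Delta> X)) \<Phi>i) \<Phi>"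
    by (subst tsum_swap_curried(4)) (simp add: tsum4_tcat_tmult[OF f] tsum4_comult[OF multilin4_shift[OF f, of
        _ _ _ 1, simplified]])
  also have "\<dots> = tsum3 (\<lambda>X Y Z. tanti 3 S (\<Delta>l (\<Delta> X)) \<cdot>\<^sub>3 (M' \<cdot>\<^sub>3 lten Y (\<gamma> \<cdot>\<^sub>2 \<Delta> Z))) \<Phi>"
    by (simp add: anti_comult2 M'_def tmult_tsum3 tmult_tsum2 tsum_in_simps f_def \<Theta>_mult tmult_assoc
        mult.assoc)
  finally show ?thesis .
qed

text \<open>
  The bracketing of \<open>\<gamma>\<close> is chosen such that \<open>gamma_coassoc\<close> can move \<open>\<Phi>\<close> to the other side of \<open>\<gamma>\<close>.  What
  results is again an evaluation at \<open>(1 \<otimes> \<Phi>)(1 \<otimes> 1 \<otimes> \<Delta>)\<Phi>\<^sup>-\<^sup>1\<close>; in the other form of this product the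
  factor \<open>(1 \<otimes> \<Delta> \<otimes> 1)\<Phi>\<^sup>-\<^sup>1\<close> is consumed by \<open>q'\<close> and \<open>q\<^sub>L\<close>, which reassembles \<open>\<gamma>\<close>.
\<close>

lemma left_gamma:
  "rten F 1 \<cdot>\<^sub>3 (\<Delta>l \<gamma> \<cdot>\<^sub>3 \<Phi>) = tsum3 (\<lambda>X Y Z. tanti 3 S (\<Delta>r (\<Delta> X)) \<cdot>\<^sub>3 (M \<cdot>\<^sub>3 lten Y (\<gamma> \<cdot>\<^sub>2 \<Delta> Z))) \<Phi>"
proof -
  define f where "f a b c d = rten (\<Theta> b \<cdot>\<^sub>2 (\<gamma> \<cdot>\<^sub>2 \<Delta> c)) (S a * \<alpha> * d) \<cdot>\<^sub>3 \<Phi>" for a b c d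
  define g where "g a b c d = rten (\<Theta> b \<cdot>\<^sub>2 q') (S a * \<alpha>) \<cdot>\<^sub>3 lten c (q\<^sub>L \<cdot>\<^sub>2 \<Delta> d)" for a b c d
  define h where "h a b c d = rten (\<Theta> b \<cdot>\<^sub>2 q') (S a) \<cdot>\<^sub>3 lten c (\<gamma> \<cdot>\<^sub>2 \<Delta> d)" for a b c d
  have f: "multilin4 tscale f" unfolding f_def by (rule multilin4I; intro lins lin_rten_lten; simp)
  have g: "multilin4 tscale g" unfolding g_def by (rule multilin4I; intro lins lin_rten_lten; simp)
  have h: "multilin4 tscale h" unfolding h_def by (rule multilin4I; intro lins lin_rten_lten; simp)
  have f': "multilin4 tscale (\<lambda>a b c d. f a (x * b) (y * c) (z * d))" for x y z
    using multilin4_shift[OF f, of 1] by simp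
  have g': "multilin4 tscale (\<lambda>a b c d. g a (x * b) (y * c) (z * d))" for x y z
    using multilin4_shift[OF g, of 1] by simp
  have h': "multilin4 tscale (\<lambda>a b c d. h (x * a) (y * b) (z * c) d)" for x y z
    using multilin4_shift[OF h, of _ _ _ 1] by simp
  have "rten F 1 \<cdot>\<^sub>3 (\<Delta>l \<gamma> \<cdot>\<^sub>3 \<Phi>) = tsum4 f (padl \<Phi> \<cdot>\<^sub>4 \<Delta>2 \<Phi>i)"
    unfolding gamma_eq_tsum4(2)
    by (simp add: comult_at_tsum4 comult_linear \<Delta>lr_tens tmult_tsum4 F_comult_gamma f_def[abs_def])
  also have "\<dots> = tsum3 (\<lambda>x y z. tsum3 (\<lambda>X Y Z. tsum2 (\<lambda>c d. f x (X * y) (Y * c) (Z * d)) (\<Delta> z)) \<Phi>) \<Phi>i"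
    by (subst tsum_swap_curried(4)) (simp add: tsum4_tcat_tmult[OF f] tsum4_comult[OF f'])
  also have "\<dots> = tsum3 (\<lambda>x y z. rten (\<Theta> y) (S x * \<alpha>) \<cdot>\<^sub>3
      (tsum3 (\<lambda>X Y Z. rten (\<Theta> X \<cdot>\<^sub>2 (\<gamma> \<cdot>\<^sub>2 \<Delta> Y)) Z \<cdot>\<^sub>3 \<Phi>) \<Phi> \<cdot>\<^sub>3 \<Delta>r (\<Delta> z))) \<Phi>i"
  proof -
    have "tsum2 (\<lambda>c d. f x (X * y) (Y * c) (Z * d)) (\<Delta> z) = 
      rten (\<Theta> y) (S x * \<alpha>) \<cdot>\<^sub>3 (rten (\<Theta> X \<cdot>\<^sub>2 (\<gamma> \<cdot>\<^sub>2 \<Delta> Y)) Z \<cdot>\<^sub>3 (\<Delta>l (\<Delta> z) \<cdot>\<^sub>3 \<Phi>))" for x y z X Y Z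
      by (simp add: \<Delta>lr_eval tmult_tsum2 f_def \<Theta>_mult comult_mult tmult_assoc mult.assoc)
    then have "tsum2 (\<lambda>c d. f x (X * y) (Y * c) (Z * d)) (\<Delta> z) = 
      rten (\<Theta> y) (S x * \<alpha>) \<cdot>\<^sub>3 ((rten (\<Theta> X \<cdot>\<^sub>2 (\<gamma> \<cdot>\<^sub>2 \<Delta> Y)) Z \<cdot>\<^sub>3 \<Phi>) \<cdot>\<^sub>3 \<Delta>r (\<Delta> z))" for x y z X Y Z
      by (simp only: coassoc_comult[symmetric]) (simp add: tmult_assoc)
    then show ?thesis by (simp add: tmult_tsum3 del: rten_lten_mult')
  qed
  also have "\<dots> = tsum3 (\<lambda>x y z. tsum3 (\<lambda>U V W. tsum2 (\<lambda>c d. g x (U * y) (V * c) (W * d)) (\<Delta> z)) \<Phi>) \<Phi>i"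
    unfolding gamma_coassoc
    by (simp add: \<Delta>lr_eval tmult_tsum3 tmult_tsum2 tsum_in_simps g_def \<Theta>_mult comult_mult tmult_assoc
        mult.assoc tsum_swap_curried(2))
  also have "\<dots> = tsum4 g (padl \<Phi> \<cdot>\<^sub>4 \<Delta>2 \<Phi>i)"
    by (subst tsum_swap_curried(4)) (simp add: tsum4_tcat_tmult[OF g] tsum4_comult[OF g'])
  also have "\<dots> = tsum4 g (\<Delta>1 \<Phi>i \<cdot>\<^sub>4 (padr \<Phi>i \<cdot>\<^sub>4 \<Delta>0 \<Phi>))" by (simp add: pentagon_variants(2))
  also have "\<dots> = tsum4 h (padr \<Phi>i \<cdot>\<^sub>4 \<Delta>0 \<Phi>)"
  proof -
    have "tsum2 (\<lambda>e e'. g (x * a) (e * b) (e' * c) (z * d)) (\<Delta> y) =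
      rten (\<Theta> b \<cdot>\<^sub>2 q') (S a) \<cdot>\<^sub>3 lten c (tens [S y, S x * \<alpha>] \<cdot>\<^sub>2 (q\<^sub>L \<cdot>\<^sub>2 (\<Delta> z \<cdot>\<^sub>2 \<Delta> d)))" for x y z a b c d
    proof -
      have "g (x * a) (e * b) (e' * c) (z * d) =
        rten (\<Theta> b \<cdot>\<^sub>2 (\<Theta> e \<cdot>\<^sub>2 (q' \<cdot>\<^sub>2 tens [e', 1]))) (S a * (S x * \<alpha>)) \<cdot>\<^sub>3 lten c (q\<^sub>L \<cdot>\<^sub>2 \<Delta> (z * d))" for e e'
        using rten_lten_exchange[of "\<Theta> b \<cdot>\<^sub>2 (\<Theta> e \<cdot>\<^sub>2 q')" "q\<^sub>L \<cdot>\<^sub>2 \<Delta> (z * d)" e' 1 "S a * (S x * \<alpha>)" 1 c]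
        by (simp add: g_def \<Theta>_mult tmult_assoc mult.assoc tone_tens(2)[symmetric])
      then have "tsum2 (\<lambda>e e'. g (x * a) (e * b) (e' * c) (z * d)) (\<Delta> y) =
        rten (\<Theta> b \<cdot>\<^sub>2 tsum2 (\<lambda>e e'. \<Theta> e \<cdot>\<^sub>2 (q' \<cdot>\<^sub>2 tens [e', 1])) (\<Delta> y)) (S a * (S x * \<alpha>)) \<cdot>\<^sub>3 lten c
            (q\<^sub>L \<cdot>\<^sub>2 \<Delta> (z * d))"
        by (simp add: tmult_tsum2 rten_lten_tsum)
      also have "\<dots> = rten ((\<Theta> b \<cdot>\<^sub>2 q') \<cdot>\<^sub>2 tens [1, S y]) (S a * (S x * \<alpha>)) \<cdot>\<^sub>3 lten c (q\<^sub>L \<cdot>\<^sub>2 \<Delta> (z * d))"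
        by (simp only: q'_comult) (simp add: tmult_assoc)
      also have "\<dots> = rten (\<Theta> b \<cdot>\<^sub>2 q') (S a) \<cdot>\<^sub>3 lten (1 * c) (tens [S y, S x * \<alpha>] \<cdot>\<^sub>2 (q\<^sub>L \<cdot>\<^sub>2 \<Delta> (z * d)))"
        by (rule rten_lten_exchange) simp_all
      finally show ?thesis by (simp add: comult_mult)
    qed
    moreover have "tsum3 (\<lambda>x y z. rten (\<Theta> b \<cdot>\<^sub>2 q') (S a) \<cdot>\<^sub>3 lten c
        (tens [S y, S x * \<alpha>] \<cdot>\<^sub>2 (q\<^sub>L \<cdot>\<^sub>2 (\<Delta> z \<cdot>\<^sub>2 \<Delta> d)))) \<Phi>i = h a b c d"
      for a b c d
      by (simp add: h_def gamma_eq_q\<^sub>L tmult_tsum3 rten_lten_tsum tmult_assoc)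
    ultimately show ?thesis
      by (simp add: tsum4_comult_tmult[OF g] tsum_swap_curried(3) tsum_swap_curried(5))
  qed
  also have "\<dots> = tsum3 (\<lambda>X Y Z. tsum3 (\<lambda>x y z. tsum2 (\<lambda>a b. h (x * a) (y * b) (z * Y) Z) (\<Delta> X)) \<Phi>i) \<Phi>"
    by (subst tsum_swap_curried(4)) (simp add: tsum4_tcat_tmult[OF h] tsum4_comult[OF h'])
  also have "\<dots> = tsum3 (\<lambda>X Y Z. tanti 3 S (\<Delta>r (\<Delta> X)) \<cdot>\<^sub>3 (M \<cdot>\<^sub>3 lten Y (\<gamma> \<cdot>\<^sub>2 \<Delta> Z))) \<Phi>"
    by (simp add: anti_comult2 M_def tmult_tsum3 tmult_tsum2 tsum_in_simps h_def \<Theta>_mult tmult_assoc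
        mult.assoc)
  finally show ?thesis .
qed

end

context k_algebra
begin

lemma comult_at_tsum2:
  assumes "lin tscale D" "\<And>a. D a \<in> tpow 2" "u \<in> tpow 2" "i < 2" "\<And>a b. G a b \<in> tpow 2"
  shows "comult_at D 2 i (tsum2 G u) = tsum2 (\<lambda>a b. comult_at D 2 i (G a b)) u"
  using assms by (simp add: tsum2_def comult_at_tsum)

lemma lin_comult_at:
  assumes "lin tscale D" "\<And>a. D a \<in> tpow 2" "i < n" "lin tscale h" "\<And>x. h x \<in> tpow n"
  shows "lin tscale (\<lambda>x. comult_at D n i (h x))"
  unfolding comult_at_def
  by (rule lin_tsum_arg[OF assms(4,5)]) (use assms(3) in \<open>auto intro!: mlin_comult_at assms multilinear_tens\<close>)

lemma tcat_tone_rten: "tcat 2 1 u (tone 1) = rten u 1" "tcat 1 2 (tone 1) u = lten 1 u"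
  by (simp_all add: rten_def lten_def tone_tens)

lemma tanti_rten:
  assumes "lin scale f" "u \<in> tpow 2"
  shows "tanti 3 f (rten u c) = lten (f c) (tanti 2 f u)" "tanti 3 f (lten c u) = rten (tanti 2 f u) (f c)"
  using assms by (simp_all add: rten_def lten_def tanti_tcat)

end

context quasi_hopf_algebra
begin

lemma F_comult_\<Theta>:
  "lten 1 F \<cdot>\<^sub>3 \<Delta>r (\<Theta> a) = tanti 3 S (\<Delta>l (\<Delta> a)) \<cdot>\<^sub>3 lten 1 F"
  "rten F 1 \<cdot>\<^sub>3 \<Delta>l (\<Theta> a) = tanti 3 S (\<Delta>r (\<Delta> a)) \<cdot>\<^sub>3 rten F 1"
  by (simp_all add: \<Theta>_expand[of a] anti_comult2 comult_at_tsum2 comult_linear \<Delta>lr_tens tmult_tsum2 F_\<Delta>)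

text \<open>
  Since \<open>\<Sum> S(X) \<alpha> Y \<beta> S(Z) = 1\<close>, an intertwiner is determined by its product with the image of \<open>\<alpha>\<close>: the
  factor \<open>S(X)\<close> can be moved to the other side of \<open>T\<close>.
\<close>

lemma intertwiner_unique:
  assumes T: "T \<in> tpow 3" "T' \<in> tpow 3" and G: "\<And>a. G a \<in> tpow 3"
    and i: "\<And>a. T \<cdot>\<^sub>3 \<Delta>r (\<Delta> (S a)) = G a \<cdot>\<^sub>3 T" "\<And>a. T' \<cdot>\<^sub>3 \<Delta>r (\<Delta> (S a)) = G a \<cdot>\<^sub>3 T'"
    and \<alpha>: "T \<cdot>\<^sub>3 \<Delta>r (\<Delta> \<alpha>) = T' \<cdot>\<^sub>3 \<Delta>r (\<Delta> \<alpha>)"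
  shows "T = T'"
proof -
  have *: "U = tsum3 (\<lambda>X Y Z. G X \<cdot>\<^sub>3 ((U \<cdot>\<^sub>3 \<Delta>r (\<Delta> \<alpha>)) \<cdot>\<^sub>3 \<Delta>r (\<Delta> (Y * \<beta> * S Z)))) \<Phi>"
    if U: "U \<in> tpow 3" "\<And>a. U \<cdot>\<^sub>3 \<Delta>r (\<Delta> (S a)) = G a \<cdot>\<^sub>3 U" for U
  proof -
    have "lin tscale (\<lambda>t. U \<cdot>\<^sub>3 \<Delta>r (\<Delta> t))"
      using U by (intro lin_tmult lin_comult_at comult_linear) auto
    from antipode_coassoc_lin(1)[OF this]
    have "U = tsum3 (\<lambda>X Y Z. U \<cdot>\<^sub>3 \<Delta>r (\<Delta> (S X * \<alpha> * Y * \<beta> * S Z))) \<Phi>"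
      using U by (simp add: comult_at_tone[OF comult_linear comult_in comult_one])
    also have "\<dots> = tsum3 (\<lambda>X Y Z. (U \<cdot>\<^sub>3 \<Delta>r (\<Delta> (S X))) \<cdot>\<^sub>3 (\<Delta>r (\<Delta> \<alpha>) \<cdot>\<^sub>3 \<Delta>r (\<Delta> (Y * \<beta> * S Z)))) \<Phi>"
      using U(1) by (simp add: \<Delta>lr_mult(2)[symmetric] tmult_assoc comult_mult[symmetric] mult.assoc)
    also have "\<dots> = tsum3 (\<lambda>X Y Z. G X \<cdot>\<^sub>3 ((U \<cdot>\<^sub>3 \<Delta>r (\<Delta> \<alpha>)) \<cdot>\<^sub>3 \<Delta>r (\<Delta> (Y * \<beta> * S Z)))) \<Phi>"
      by (simp only: U(2)) (simp add: U(1) G tmult_assoc)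
    finally show ?thesis .
  qed
  show ?thesis using *[OF T(1) i(1)] *[OF T(2) i(2)] \<alpha> by simp
qed

text \<open>
  Both sides intertwine \<open>(1 \<otimes> \<Delta>)\<Delta>(S a)\<close> with \<open>(S \<otimes> S \<otimes> S)((1 \<otimes> \<Delta>)\<Delta>(a))\<^sub>3\<^sub>2\<^sub>1\<close>, each by one
  application of quasi-coassociativity.  On the image of \<open>\<alpha>\<close> they agree by \<open>left_gamma\<close>, \<open>\<Omega>_M'\<close> and
  \<open>right_gamma\<close>.
\<close>

lemma coassoc_F: "rten F 1 \<cdot>\<^sub>3 (\<Delta>l F \<cdot>\<^sub>3 \<Phi>) = \<Omega> \<cdot>\<^sub>3 (lten 1 F \<cdot>\<^sub>3 \<Delta>r F)"
proof (rule intertwiner_unique[where G = "\<lambda>a. tanti 3 S (\<Delta>r (\<Delta> a))"])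
  have \<Omega>: "\<Omega> \<cdot>\<^sub>3 tanti 3 S (\<Delta>l (\<Delta> a)) = tanti 3 S (\<Delta>r (\<Delta> a)) \<cdot>\<^sub>3 \<Omega>" for a
    using arg_cong[OF coassoc_comult, of "tanti 3 S" a]
    by (simp add: \<Omega>_def tanti_mult[OF antipode_linear antipode_mult])
  show "(rten F 1 \<cdot>\<^sub>3 (\<Delta>l F \<cdot>\<^sub>3 \<Phi>)) \<cdot>\<^sub>3 \<Delta>r (\<Delta> (S a)) = tanti 3 S (\<Delta>r (\<Delta> a)) \<cdot>\<^sub>3 (rten F 1 \<cdot>\<^sub>3 (\<Delta>l F \<cdot>\<^sub>3 \<Phi>))" for a
  proof -
    have "(rten F 1 \<cdot>\<^sub>3 (\<Delta>l F \<cdot>\<^sub>3 \<Phi>)) \<cdot>\<^sub>3 \<Delta>r (\<Delta> (S a)) = rten F 1 \<cdot>\<^sub>3 (\<Delta>l F \<cdot>\<^sub>3 (\<Phi> \<cdot>\<^sub>3 \<Delta>r (\<Delta> (S a))))"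
      by (simp add: tmult_assoc)
    also have "\<dots> = rten F 1 \<cdot>\<^sub>3 (\<Delta>l (F \<cdot>\<^sub>2 \<Delta> (S a)) \<cdot>\<^sub>3 \<Phi>)"
      by (simp only: coassoc_comult) (simp add: \<Delta>lr_mult tmult_assoc)
    also have "\<dots> = (rten F 1 \<cdot>\<^sub>3 \<Delta>l (\<Theta> a)) \<cdot>\<^sub>3 (\<Delta>l F \<cdot>\<^sub>3 \<Phi>)"
      by (simp add: F_\<Delta> \<Delta>lr_mult tmult_assoc)
    finally show ?thesis by (simp only: F_comult_\<Theta>) (simp add: tmult_assoc)
  qed
  have R: "(lten 1 F \<cdot>\<^sub>3 \<Delta>r F) \<cdot>\<^sub>3 \<Delta>r (\<Delta> (S a)) = tanti 3 S (\<Delta>l (\<Delta> a)) \<cdot>\<^sub>3 (lten 1 F \<cdot>\<^sub>3 \<Delta>r F)" for a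
  proof -
    have "(lten 1 F \<cdot>\<^sub>3 \<Delta>r F) \<cdot>\<^sub>3 \<Delta>r (\<Delta> (S a)) = lten 1 F \<cdot>\<^sub>3 \<Delta>r (F \<cdot>\<^sub>2 \<Delta> (S a))"
      by (simp add: \<Delta>lr_mult tmult_assoc)
    also have "\<dots> = (lten 1 F \<cdot>\<^sub>3 \<Delta>r (\<Theta> a)) \<cdot>\<^sub>3 \<Delta>r F"
      by (simp add: F_\<Delta> \<Delta>lr_mult tmult_assoc)
    finally show ?thesis by (simp only: F_comult_\<Theta>) (simp add: tmult_assoc)
  qed
  show "(\<Omega> \<cdot>\<^sub>3 (lten 1 F \<cdot>\<^sub>3 \<Delta>r F)) \<cdot>\<^sub>3 \<Delta>r (\<Delta> (S a)) = tanti 3 S (\<Delta>r (\<Delta> a)) \<cdot>\<^sub>3 (\<Omega> \<cdot>\<^sub>3 (lten 1 F \<cdot>\<^sub>3 \<Delta>r F))" for a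
  proof -
    have "(\<Omega> \<cdot>\<^sub>3 (lten 1 F \<cdot>\<^sub>3 \<Delta>r F)) \<cdot>\<^sub>3 \<Delta>r (\<Delta> (S a)) = \<Omega> \<cdot>\<^sub>3 ((lten 1 F \<cdot>\<^sub>3 \<Delta>r F) \<cdot>\<^sub>3 \<Delta>r (\<Delta> (S a)))"
      by (simp add: tmult_assoc)
    also have "\<dots> = (\<Omega> \<cdot>\<^sub>3 tanti 3 S (\<Delta>l (\<Delta> a))) \<cdot>\<^sub>3 (lten 1 F \<cdot>\<^sub>3 \<Delta>r F)"
      by (simp only: R) (simp add: tmult_assoc)
    finally show ?thesis by (simp only: \<Omega>) (simp add: tmult_assoc)
  qed
  show "(rten F 1 \<cdot>\<^sub>3 (\<Delta>l F \<cdot>\<^sub>3 \<Phi>)) \<cdot>\<^sub>3 \<Delta>r (\<Delta> \<alpha>) = (\<Omega> \<cdot>\<^sub>3 (lten 1 F \<cdot>\<^sub>3 \<Delta>r F)) \<cdot>\<^sub>3 \<Delta>r (\<Delta> \<alpha>)"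
  proof -
    have "(rten F 1 \<cdot>\<^sub>3 (\<Delta>l F \<cdot>\<^sub>3 \<Phi>)) \<cdot>\<^sub>3 \<Delta>r (\<Delta> \<alpha>) = rten F 1 \<cdot>\<^sub>3 (\<Delta>l F \<cdot>\<^sub>3 (\<Phi> \<cdot>\<^sub>3 \<Delta>r (\<Delta> \<alpha>)))"
      by (simp add: tmult_assoc)
    also have "\<dots> = rten F 1 \<cdot>\<^sub>3 (\<Delta>l (F \<cdot>\<^sub>2 \<Delta> \<alpha>) \<cdot>\<^sub>3 \<Phi>)"
      by (simp only: coassoc_comult) (simp add: \<Delta>lr_mult tmult_assoc)
    also have "\<dots> = tsum3 (\<lambda>X Y Z. tanti 3 S (\<Delta>r (\<Delta> X)) \<cdot>\<^sub>3 ((\<Omega> \<cdot>\<^sub>3 M') \<cdot>\<^sub>3 lten Y (\<gamma> \<cdot>\<^sub>2 \<Delta> Z))) \<Phi>"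
      by (simp only: F_alpha left_gamma \<Omega>_M')
    also have "\<dots> = tsum3 (\<lambda>X Y Z. (tanti 3 S (\<Delta>r (\<Delta> X)) \<cdot>\<^sub>3 \<Omega>) \<cdot>\<^sub>3 (M' \<cdot>\<^sub>3 lten Y (\<gamma> \<cdot>\<^sub>2 \<Delta> Z))) \<Phi>"
      by (simp add: tmult_assoc)
    also have "\<dots> = \<Omega> \<cdot>\<^sub>3 (lten 1 F \<cdot>\<^sub>3 \<Delta>r \<gamma>)"
      by (simp only: \<Omega>[symmetric] right_gamma) (simp add: tmult_assoc tmult_tsum3)
    also have "\<dots> = (\<Omega> \<cdot>\<^sub>3 (lten 1 F \<cdot>\<^sub>3 \<Delta>r F)) \<cdot>\<^sub>3 \<Delta>r (\<Delta> \<alpha>)"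
      by (simp add: F_alpha[symmetric] \<Delta>lr_mult tmult_assoc)
    finally show ?thesis .
  qed
qed simp_all

end

section \<open>Transport along the inverse of the antipode\<close>

locale bijective_antipode = quasi_hopf_algebra scale \<Delta> \<epsilon> \<Phi> S \<alpha> \<beta>
  for scale :: "'k::field \<Rightarrow> 'h::ring_1 \<Rightarrow> 'h" (infixr "*s" 75)
    and \<Delta> :: "'h \<Rightarrow> ('k, 'h) tensor" and \<epsilon> :: "'h \<Rightarrow> 'k" and \<Phi> :: "('k, 'h) tensor"
    and S :: "'h \<Rightarrow> 'h" and \<alpha> \<beta> :: 'h +
  assumes bij_S: "bij S"
    and counit_alpha: "\<epsilon> \<alpha> = 1"
begin

abbreviation "S' \<equiv> inv S"

lemma S_S' [simp]: "S (S' a) = a" "S' (S a) = a"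
  using bij_S by (simp_all add: bij_is_inj bij_is_surj surj_f_inv_f)

lemma S'_eq: "S' a = b \<longleftrightarrow> a = S b"
  by (metis S_S')

lemma S'_mult [simp]: "S' (a * b) = S' b * S' a"
  by (simp add: S'_eq)

lemma S'_one [simp]: "S' 1 = 1"
  by (simp add: S'_eq)

lemma S'_linear: "lin scale S'"
  by (rule linI[OF vector_space_axioms])
    (simp_all add: S'_eq lin_add[OF antipode_linear] lin_scale[OF antipode_linear])

lemma counit_S' [simp]: "\<epsilon> (S' a) = \<epsilon> a"
  using counit_S[OF counit_alpha, of "S' a"] by simp

definition "\<Delta>' a = tanti 2 S' (\<Delta> (S a))"
definition "\<Phi>' = tanti 3 S' \<Phi>"
definition "F0 = tanti 2 S' F"
definition "F0i = tanti 2 S' Fi"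

lemma opp_in [simp]: "\<Delta>' a \<in> tpow 2" "\<Phi>' \<in> tpow 3" "F0 \<in> tpow 2" "F0i \<in> tpow 2"
  by (simp_all add: \<Delta>'_def \<Phi>'_def F0_def F0i_def)

lemmas anti_mult = tanti_mult[OF S'_linear S'_mult]

lemma \<Delta>'_linear: "lin tscale \<Delta>'"
  unfolding \<Delta>'_def by (intro lin_tanti S'_linear lins) auto

lemma \<Delta>'_S': "\<Delta>' (S' a) = tanti 2 S' (\<Delta> a)"
  by (simp add: \<Delta>'_def)

lemma anti_comult:
  "u \<in> tpow 2 \<Longrightarrow> comult_at \<Delta>' 2 0 (tanti 2 S' u) = tanti 3 S' (\<Delta>r u)"
  "u \<in> tpow 2 \<Longrightarrow> comult_at \<Delta>' 2 1 (tanti 2 S' u) = tanti 3 S' (\<Delta>l u)"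
  "v \<in> tpow 3 \<Longrightarrow> comult_at \<Delta>' 3 0 (tanti 3 S' v) = tanti 4 S' (\<Delta>2 v)"
  "v \<in> tpow 3 \<Longrightarrow> comult_at \<Delta>' 3 1 (tanti 3 S' v) = tanti 4 S' (\<Delta>1 v)"
  "v \<in> tpow 3 \<Longrightarrow> comult_at \<Delta>' 3 2 (tanti 3 S' v) = tanti 4 S' (\<Delta>0 v)"
  using tanti_comult_at[OF S'_linear comult_linear comult_in \<Delta>'_linear opp_in(1) \<Delta>'_S', where u = u and i = 1
      and j = 0 and n = 2 and k = 3]
    tanti_comult_at[OF S'_linear comult_linear comult_in \<Delta>'_linear opp_in(1) \<Delta>'_S', where u = u and i = 0 and
        j = 1 and n = 2 and k = 3]
    tanti_comult_at[OF S'_linear comult_linear comult_in \<Delta>'_linear opp_in(1) \<Delta>'_S', where u = v and i = 2 and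
        j = 0 and n = 3 and k = 4]
    tanti_comult_at[OF S'_linear comult_linear comult_in \<Delta>'_linear opp_in(1) \<Delta>'_S', where u = v and i = 1 and
        j = 1 and n = 3 and k = 4]
    tanti_comult_at[OF S'_linear comult_linear comult_in \<Delta>'_linear opp_in(1) \<Delta>'_S', where u = v and i = 0 and
        j = 2 and n = 3 and k = 4]
  by simp_all

lemma anti_counit:
  "u \<in> tpow 2 \<Longrightarrow> counit_at \<epsilon> 2 0 (tanti 2 S' u) = tanti 1 S' (counit_at \<epsilon> 2 1 u)"
  "u \<in> tpow 2 \<Longrightarrow> counit_at \<epsilon> 2 1 (tanti 2 S' u) = tanti 1 S' (counit_at \<epsilon> 2 0 u)"
  "v \<in> tpow 3 \<Longrightarrow> counit_at \<epsilon> 3 1 (tanti 3 S' v) = tanti 2 S' (counit_at \<epsilon> 3 1 v)"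
proof -
  note * = tanti_counit_at[where f = S' and e = \<epsilon>, OF S'_linear counit_linear counit_S', symmetric]
  show "u \<in> tpow 2 \<Longrightarrow> counit_at \<epsilon> 2 0 (tanti 2 S' u) = tanti 1 S' (counit_at \<epsilon> 2 1 u)"
    by (rule *[where i = 1]) simp_all
  show "u \<in> tpow 2 \<Longrightarrow> counit_at \<epsilon> 2 1 (tanti 2 S' u) = tanti 1 S' (counit_at \<epsilon> 2 0 u)"
    by (rule *[where i = 0]) simp_all
  show "v \<in> tpow 3 \<Longrightarrow> counit_at \<epsilon> 3 1 (tanti 3 S' v) = tanti 2 S' (counit_at \<epsilon> 3 1 v)"
    by (rule *[where i = 1]) simp_all
qed

lemma \<Phi>'_inv: "tinvertible 3 \<Phi>'" "tinv 3 \<Phi>' = tanti 3 S' \<Phi>i"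
proof -
  have "tanti 3 S' \<Phi> \<cdot>\<^sub>3 tanti 3 S' \<Phi>i = tone 3" "tanti 3 S' \<Phi>i \<cdot>\<^sub>3 tanti 3 S' \<Phi> = tone 3"
    by (simp_all add: anti_mult[symmetric] tanti_tone[OF S'_linear])
  from tinvI[OF opp_in(2) _ this[folded \<Phi>'_def]]
  show "tinvertible 3 \<Phi>'" "tinv 3 \<Phi>' = tanti 3 S' \<Phi>i" by simp_all
qed

lemma F0_inv: "tinvertible 2 F0" "tinv 2 F0 = F0i" and F0_F0i: "F0 \<cdot>\<^sub>2 F0i = tone 2" "F0i \<cdot>\<^sub>2 F0 = tone 2"
proof -
  show *: "F0 \<cdot>\<^sub>2 F0i = tone 2" "F0i \<cdot>\<^sub>2 F0 = tone 2"
    by (simp_all add: F0_def F0i_def anti_mult[symmetric] F_Fi Fi_F tanti_tone[OF S'_linear])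
  show "tinvertible 2 F0" "tinv 2 F0 = F0i"
    using tinvI[OF opp_in(3,4) *] by simp_all
qed

text \<open>
  All axioms are images of axioms of \<open>H\<close> under \<open>tanti n S'\<close>.  As this map reverses both the factors and
  the products, each axiom is sent to one of the same shape, and the two axioms for \<open>\<alpha>\<close> and \<open>\<beta>\<close> are
  exchanged.
\<close>

lemma transported_quasi_hopf: "quasi_hopf_algebra scale \<Delta>' \<epsilon> \<Phi>' S (S' \<beta>) (S' \<alpha>)"
proof -
  have in_tpow: "\<Delta>' a \<in> tpow 2" for a by simp
  have mult: "\<Delta>' (a * b) = \<Delta>' a \<cdot>\<^sub>2 \<Delta>' b" for a b by (simp add: \<Delta>'_def comult_mult anti_mult)
  have one: "\<Delta>' 1 = tone 2" by (simp add: \<Delta>'_def tanti_tone[OF S'_linear])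
  have linear: "Vector_Spaces.linear (*s) tscale \<Delta>'" by (rule \<Delta>'_linear)
  have invertible: "tinvertible 3 \<Phi>'" by (rule \<Phi>'_inv)
  have quasi_coassoc: "comult_at \<Delta>' 2 1 (\<Delta>' a) = tinv 3 \<Phi>' \<cdot>\<^sub>3 comult_at \<Delta>' 2 0 (\<Delta>' a) \<cdot>\<^sub>3 \<Phi>'" for a
  proof -
    have "\<Phi> \<cdot>\<^sub>3 (\<Delta>r (\<Delta> (S a)) \<cdot>\<^sub>3 \<Phi>i) = \<Delta>l (\<Delta> (S a))"
      by (simp add: coassoc_comult tmult_assoc[symmetric]) (simp add: tmult_assoc)
    from arg_cong[OF this, of "tanti 3 S'"] show ?thesis
      unfolding \<Delta>'_def[of a] \<Phi>'_inv unfolding \<Phi>'_def by (simp add: anti_comult anti_mult tmult_assoc)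
  qed
  have pentagon: "comult_at \<Delta>' 3 0 \<Phi>' \<cdot>\<^sub>4 comult_at \<Delta>' 3 2 \<Phi>' =
      tcat 3 1 \<Phi>' (tone 1) \<cdot>\<^sub>4 comult_at \<Delta>' 3 1 \<Phi>' \<cdot>\<^sub>4 tcat 1 3 (tone 1) \<Phi>'"
  proof -
    have "tcat 3 1 \<Phi>' (tone 1) = tanti 4 S' (padl \<Phi>)" "tcat 1 3 (tone 1) \<Phi>' = tanti 4 S' (padr \<Phi>)"
      by (simp_all add: \<Phi>'_def tanti_tcat[OF S'_linear] tanti_tone[OF S'_linear])
    with arg_cong[OF pentagon_right_assoc, of "tanti 4 S'"] show ?thesis
      by (simp add: \<Phi>'_def anti_comult anti_mult)
  qed
  have counit: "counit_at \<epsilon> 2 0 (\<Delta>' a) = tens [a]" "counit_at \<epsilon> 2 1 (\<Delta>' a) = tens [a]" for a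
    by (simp_all add: \<Delta>'_def anti_counit counit_left counit_right S'_linear)
  have counit_coassoc: "counit_at \<epsilon> 3 1 \<Phi>' = tone 2"
    by (simp add: \<Phi>'_def anti_counit tanti_tone[OF S'_linear])
  have antipode1: "tsum3 (\<lambda>X Y Z. S X * S' \<beta> * Y * S' \<alpha> * S Z) \<Phi>' = 1"
  proof -
    have "multilin3 scale (\<lambda>X Y Z. S X * S' \<beta> * Y * S' \<alpha> * S Z)" by (intro multilin3I lins)
    then show ?thesis using antipode_coassoc_lin(1)[OF S'_linear]
      by (simp add: \<Phi>'_def tsum3_tanti mult.assoc)
  qed
  have antipode2: "tsum3 (\<lambda>X Y Z. X * S' \<alpha> * S Y * S' \<beta> * Z) (tinv 3 \<Phi>') = 1"
  proof -
    have "multilin3 scale (\<lambda>X Y Z. X * S' \<alpha> * S Y * S' \<beta> * Z)" by (intro multilin3I lins)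
    then show ?thesis using antipode_coassoc_lin(2)[OF S'_linear]
      by (simp add: \<Phi>'_inv tsum3_tanti mult.assoc)
  qed
  have antipode_alpha: "tsum2 (\<lambda>a1 a2. S a1 * S' \<beta> * a2) (\<Delta>' a) = \<epsilon> a *s S' \<beta>" for a
  proof -
    have "multilin2 scale (\<lambda>X Y. S X * S' \<beta> * Y)" by (intro multilin2I lins)
    then show ?thesis using antipode_beta_lin[OF S'_linear, of "S a"]
      by (simp add: \<Delta>'_def tsum2_tanti mult.assoc counit_S[OF counit_alpha])
  qed
  have antipode_beta: "tsum2 (\<lambda>a1 a2. a1 * S' \<alpha> * S a2) (\<Delta>' a) = \<epsilon> a *s S' \<alpha>" for a
  proof -
    have "multilin2 scale (\<lambda>X Y. X * S' \<alpha> * S Y)" by (intro multilin2I lins)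
    then show ?thesis using antipode_alpha_lin[OF S'_linear, of "S a"]
      by (simp add: \<Delta>'_def tsum2_tanti mult.assoc counit_S[OF counit_alpha])
  qed
  show ?thesis
    unfolding quasi_hopf_algebra_def quasi_hopf_algebra_axioms_def quasi_bialgebra_def
        quasi_bialgebra_axioms_def
    by (intro conjI allI k_algebra_axioms counit_linear counit_mult counit_one antipode_linear antipode_mult
      antipode_one in_tpow mult one linear invertible quasi_coassoc pentagon counit counit_coassoc antipode1
          antipode2 antipode_alpha antipode_beta)
qed

lemma F0_comult: "F0 \<cdot>\<^sub>2 \<Delta> h = \<Delta>' h \<cdot>\<^sub>2 F0"
proof -
  have "tanti 2 S' (\<Theta> h) = \<Delta> h"
    by (simp add: \<Theta>_def tanti_tanti[OF S'_linear antipode_linear])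
  with arg_cong[OF F_\<Delta>, of "tanti 2 S'" h] show ?thesis
    by (simp add: anti_mult F0_def \<Delta>'_def)
qed

lemma F0_is_twist: "is_twist F0"
  unfolding is_twist_def
  by (simp add: F0_inv) (simp add: F0_def anti_counit counit_F[OF counit_alpha] tanti_tone[OF S'_linear
      S'_one])

lemma twist_comult_F0: "twist_comult F0 a = \<Delta>' a"
  by (simp add: twist_comult_def F0_inv F0_comult tmult_assoc F0_F0i)

text \<open>
  The image of \<open>coassoc_F\<close> expresses \<open>\<Phi>'\<close> by the new coproduct; \<open>F0_comult\<close> then replaces the new
  coproduct by the old one.
\<close>

lemma twist_coassoc_F0: "twist_coassoc F0 = \<Phi>'"
proof -
  have "tanti 3 S' \<Omega> = \<Phi>"
    by (simp add: \<Omega>_def tanti_tanti[OF S'_linear antipode_linear])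
  moreover have "tanti 3 S' (\<Delta>l F) = comult_at \<Delta>' 2 1 F0" "tanti 3 S' (\<Delta>r F) = comult_at \<Delta>' 2 0 F0"
    by (simp_all add: F0_def anti_comult)
  ultimately have "(comult_at \<Delta>' 2 0 F0 \<cdot>\<^sub>3 rten F0 1) \<cdot>\<^sub>3 \<Phi> = \<Phi>' \<cdot>\<^sub>3 (comult_at \<Delta>' 2 1 F0 \<cdot>\<^sub>3 lten 1 F0)"
    using arg_cong[OF coassoc_F, of "tanti 3 S'"]
    by (simp add: anti_mult tanti_rten[OF S'_linear] tmult_assoc flip: F0_def \<Phi>'_def)
  moreover have "comult_at \<Delta>' 2 0 F0 \<cdot>\<^sub>3 rten F0 1 = rten F0 1 \<cdot>\<^sub>3 \<Delta>l F0"
    "comult_at \<Delta>' 2 1 F0 \<cdot>\<^sub>3 lten 1 F0 = lten 1 F0 \<cdot>\<^sub>3 \<Delta>r F0"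
    by (simp_all add: comult_at_eval2[OF \<Delta>'_linear opp_in(1)] \<Delta>lr_eval tmult_tsum2 F0_comult)
  ultimately have "rten F0 1 \<cdot>\<^sub>3 (\<Delta>l F0 \<cdot>\<^sub>3 \<Phi>) = \<Phi>' \<cdot>\<^sub>3 (lten 1 F0 \<cdot>\<^sub>3 \<Delta>r F0)"
    by (simp add: tmult_assoc)
  then have "twist_coassoc F0 = (\<Phi>' \<cdot>\<^sub>3 (lten 1 F0 \<cdot>\<^sub>3 \<Delta>r F0)) \<cdot>\<^sub>3 (\<Delta>r F0i \<cdot>\<^sub>3 lten 1 F0i)"
    by (simp add: twist_coassoc_def F0_inv tcat_tone_rten tmult_assoc[symmetric])
  also have "\<dots> = \<Phi>' \<cdot>\<^sub>3 (lten 1 F0 \<cdot>\<^sub>3 (\<Delta>r (F0 \<cdot>\<^sub>2 F0i) \<cdot>\<^sub>3 lten 1 F0i))"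
    by (simp only: \<Delta>lr_mult opp_in) (simp add: tmult_assoc)
  also have "\<dots> = \<Phi>'"
    by (simp add: F0_F0i comult_at_tone[OF comult_linear comult_in comult_one])
  finally show ?thesis .
qed

text \<open>
  \<open>beta_F\<close> says what twisting with \<open>F\<close> does to \<open>\<beta>\<close>, and untwisting recovers \<open>\<beta>\<close> from \<open>S(\<alpha>)\<close>.  The map \<open>S'\<close>
  turns this into the statement about \<open>\<alpha>\<close>.
\<close>

lemma twist_alpha_F0: "twist_alpha F0 = S' \<beta>"
proof -
  have g: "multilin2 scale (\<lambda>x y. x * \<beta> * S y)" by (intro multilin2I lins)
  have "tsum2 (\<lambda>x y. x * tsum2 (\<lambda>a b. a * \<beta> * S b) F * S y) Fi = \<beta>"
  proof -
    have "x * tsum2 (\<lambda>a b. a * \<beta> * S b) F * S y = tsum2 (\<lambda>a b. (x * a) * \<beta> * S (y * b)) F" for x y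
      using tsum2_lin[of scale "\<lambda>t. x * t * S y" "\<lambda>a b. a * \<beta> * S b" F] by (simp add: lins mult.assoc)
    then show ?thesis using tsum2_tmult[OF g F_in(2,1)] by (simp add: Fi_F tone_tens tsum2_pure[OF g])
  qed
  then have *: "tsum2 (\<lambda>x y. x * S \<alpha> * S y) Fi = \<beta>" by (simp add: beta_F[OF counit_alpha])
  have "multilin2 scale (\<lambda>x y. S x * \<alpha> * y)" by (intro multilin2I lins)
  then have "twist_alpha F0 = tsum2 (\<lambda>x y. S' (x * S \<alpha> * S y)) Fi"
    by (simp add: twist_alpha_def F0_inv F0i_def tsum2_tanti mult.assoc)
  also have "\<dots> = S' \<beta>" using tsum2_lin[OF S'_linear] * by metis
  finally show ?thesis .
qed

lemma twist_beta_F0: "twist_beta F0 = S' \<alpha>"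
proof -
  have g: "multilin2 scale (\<lambda>x y. S x * \<alpha> * y)" by (intro multilin2I lins)
  have "tsum2 (\<lambda>x y. S x * tsum2 (\<lambda>a b. S a * \<alpha> * b) Fi * y) F = \<alpha>"
  proof -
    have "S x * tsum2 (\<lambda>a b. S a * \<alpha> * b) Fi * y = tsum2 (\<lambda>a b. S (a * x) * \<alpha> * (b * y)) Fi" for x y
      using tsum2_lin[of scale "\<lambda>t. S x * t * y" "\<lambda>a b. S a * \<alpha> * b" Fi] by (simp add: lins mult.assoc)
    then show ?thesis using tsum2_tmult[OF g F_in(2,1)]
      by (subst (asm) tsum_swap_curried(1)) (simp add: Fi_F tone_tens tsum2_pure[OF g])
  qed
  then have *: "tsum2 (\<lambda>x y. S x * S \<beta> * y) F = \<alpha>" by (simp add: alpha_Fi[OF counit_alpha])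
  have "multilin2 scale (\<lambda>x y. x * \<beta> * S y)" by (intro multilin2I lins)
  then have "twist_beta F0 = tsum2 (\<lambda>x y. S' (S x * S \<beta> * y)) F"
    by (simp add: twist_beta_def F0_def tsum2_tanti mult.assoc)
  also have "\<dots> = S' \<alpha>" using tsum2_lin[OF S'_linear] * by metis
  finally show ?thesis .
qed

lemma second_drinfeld_twist_eq: "second_drinfeld_twist = F0"
  by (simp add: second_drinfeld_twist_def F0_def tmap_trev[OF S'_linear])

end

theorem theorem3:
  fixes scale :: "'k::field \<Rightarrow> 'h::ring_1 \<Rightarrow> 'h"
    and \<Delta> :: "'h \<Rightarrow> ('k, 'h) tensor" and \<epsilon> :: "'h \<Rightarrow> 'k" and \<Phi> :: "('k, 'h) tensor"
    and S :: "'h \<Rightarrow> 'h" and \<alpha> \<beta> :: 'h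
  assumes "quasi_hopf_algebra scale \<Delta> \<epsilon> \<Phi> S \<alpha> \<beta>"
    and "bij S"
    and "\<epsilon> \<alpha> = 1"
  shows "let
      F\<^sub>0 = quasi_hopf_algebra.second_drinfeld_twist scale \<Delta> \<Phi> S \<alpha> \<beta>;
      \<Delta>\<^sub>0 = (\<lambda>a. k_algebra.tmap scale 2 (inv S) (k_algebra.trev scale 2 (\<Delta> (S a))));
      \<Phi>\<^sub>0 = k_algebra.tmap scale 3 (inv S) (k_algebra.trev scale 3 \<Phi>);
      \<alpha>\<^sub>0 = inv S \<beta>;
      \<beta>\<^sub>0 = inv S \<alpha>
    in
      quasi_hopf_algebra scale \<Delta>\<^sub>0 \<epsilon> \<Phi>\<^sub>0 S \<alpha>\<^sub>0 \<beta>\<^sub>0 \<and>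
      quasi_hopf_algebra.is_twist scale \<epsilon> F\<^sub>0 \<and>
      quasi_hopf_algebra.twist_comult scale \<Delta> F\<^sub>0 = \<Delta>\<^sub>0 \<and>
      quasi_hopf_algebra.twist_coassoc scale \<Delta> \<Phi> F\<^sub>0 = \<Phi>\<^sub>0 \<and>
      quasi_hopf_algebra.twist_alpha scale S \<alpha> F\<^sub>0 = \<alpha>\<^sub>0 \<and>
      quasi_hopf_algebra.twist_beta scale S \<beta> F\<^sub>0 = \<beta>\<^sub>0"
proof -
  interpret bijective_antipode scale \<Delta> \<epsilon> \<Phi> S \<alpha> \<beta>
    by (intro bijective_antipode.intro bijective_antipode_axioms.intro assms)
  have "(\<lambda>a. tmap 2 (inv S) (trev 2 (\<Delta> (S a)))) = \<Delta>'" "tmap 3 (inv S) (trev 3 \<Phi>) = \<Phi>'"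
    by (simp_all add: tmap_trev[OF S'_linear] \<Delta>'_def[abs_def] \<Phi>'_def)
  then show ?thesis
    unfolding Let_def second_drinfeld_twist_eq
    by (auto simp: transported_quasi_hopf F0_is_twist twist_comult_F0 twist_coassoc_F0 twist_alpha_F0
        twist_beta_F0)
qed

end
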